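(* Let $\pi$ be an abelian group. Let $(H,\triangleright)$ be a cocommutative post-Hopf $\pi$-algebra, with $H=(\{H_\alpha\}_{\alpha\in\pi},\cdot,1,\Delta,\varepsilon,S)$. Then $(H,\cdot,1,\Delta,\varepsilon,S)$ and the subadjacent Hopf $\pi$-algebra $(H,*,1,\Delta,\varepsilon,T)$, given by $$x*_{\alpha,\beta}y=x_{(1,\alpha)}\cdot(x_{(2,\alpha)}\triangleright_{\alpha,\beta}y),\qquad T_\alpha(x)=\psi_{\alpha,\bar\alpha,x_{(1,\alpha)}}(S_\alpha(x_{(2,\alpha)}))\qquad(x\in H_\alpha,\ y\in H_\beta),$$ form a Hopf $\pi$-brace $(H,\cdot,* )$. Conversely, any cocommutative Hopf $\pi$-brace $(H,\cdot,\circ)$ gives a post-Hopf $\pi$-algebra $(H,\triangleright)$, where $H$ carries the Hopf $\pi$-algebra structure $(H,\cdot,1,\Delta,\varepsilon,S)$ and $\triangleright$ is defined by $$x\triangleright_{\alpha,\beta}y=S_\alpha(x_{(1,\alpha)})\cdot_{\bar\alpha,\alpha\beta}(x_{(2,\alpha)}\circ_{\alpha,\beta}y),\qquad\forall x\in H_\alpha,\ y\in H_\beta,\ \alpha,\beta\in\pi.$$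
   Context: All spaces and tensor products are over a base field $\Bbbk$. Let $\pi$ be an abelian group with unit $e$; write $\bar\alpha=\alpha^{-1}$. A Hopf $\pi$-algebra is a family $H=\{H_\alpha\}_{\alpha\in\pi}$ of coalgebras $(H_\alpha,\Delta_\alpha,\varepsilon_\alpha)$ with linear maps $m_{\alpha,\beta}:H_\alpha\otimes H_\beta\to H_{\alpha\beta}$ (the multiplication) and $\eta:\Bbbk\to H_e$ (the unit, $1=\eta(1)\in H_e$) that are coalgebra maps, associative and unital in the graded sense, and with an antipode, a family of linear maps $S_\alpha:H_\alpha\to H_{\bar\alpha}$ with $S_\alpha(h_{(1,\alpha)})h_{(2,\alpha)}=\varepsilon_\alpha(h)1=h_{(1,\alpha)}S_\alpha(h_{(2,\alpha)})$. Here $\Delta_\alpha(h)=h_{(1,\alpha)}\otimes h_{(2,\alpha)}$ is Sweedler notation. $H$ is cocommutative if every $H_\alpha$ is cocommutative. A post-Hopf $\pi$-algebra is a pair $(H,\triangleright)$ where $H=(\{H_\alpha\}_{\alpha\in\pi},\cdot,1,\Delta,\varepsilon,S)$ is a Hopf $\pi$-algebra and $\triangleright=\{\triangleright_{\alpha,\beta}:H_\alpha\otimes H_\beta\to H_\beta\}$ is a family of coalgebra homomorphisms such that for all $x\in H_\alpha,y\in H_\beta,z\in H_\gamma$: $x\triangleright_{\alpha,\beta\gamma}(yz)=(x_{(1,\alpha)}\triangleright_{\alpha,\beta}y)(x_{(2,\alpha)}\triangleright_{\alpha,\gamma}z)$ and $x\triangleright_{\alpha,\gamma}(y\triangleright_{\beta,\gamma}z)=(x_{(1,\alpha)}(x_{(2,\alpha)}\triangleright_{\alpha,\beta}y))\triangleright_{\alpha\beta,\gamma}z$;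 and such that the map $\theta_{\alpha,\beta}:H_\alpha\to\mathrm{End}(H_\beta)$, $\theta_{\alpha,\beta,x}(y)=x\triangleright_{\alpha,\beta}y$, is convolution invertible in $\mathrm{Hom}(H_\alpha,\mathrm{End}(H_\beta))$, i.e. there is a unique $\psi_{\alpha,\beta}:H_\alpha\to\mathrm{End}(H_\beta)$, $x\mapsto\psi_{\alpha,\beta,x}$, with $\psi_{\alpha,\beta,x_{(1,\alpha)}}\theta_{\alpha,\beta,x_{(2,\alpha)}}=\theta_{\alpha,\beta,x_{(1,\alpha)}}\psi_{\alpha,\beta,x_{(2,\alpha)}}=\varepsilon_\alpha(x)\mathrm{id}_{H_\beta}$. It is cocommutative if each $H_\alpha$ is cocommutative. A Hopf $\pi$-brace $(H,\cdot,\circ)$ over a family of coalgebras $H=\{H_\alpha\}$ consists of two Hopf $\pi$-algebra structures $(H,\cdot,1,S)$ and $(H,\circ,1_\circ,T)$ on these coalgebras such that, writing $\cdot$ as juxtaposition, $g\circ(h\ell)=(g_{(1,\alpha)}\circ h)S_\alpha(g_{(2,\alpha)})(g_{(3,\alpha)}\circ\ell)$ for all $g\in H_\alpha,h\in H_\beta,\ell\in H_\gamma$ (then $1_\circ=1$). It is cocommutative if each $H_\alpha$ is cocommutative. *)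

theory Defs
  imports Complex_Main "HOL-Library.Poly_Mapping"
begin

text \<open>
  Conventions. Vector spaces over the field \<open>'k\<close> are subspaces of an ambient vector space
  (type \<open>'h\<close>, scalar multiplication \<open>scale\<close>). A family \<open>H\<close> of vector spaces indexed by
  \<open>\<pi>\<close> is a family of such subspaces; the members need not be independent, so every family
  of vector spaces occurs up to isomorphism (inside its direct sum). The abelian group \<open>\<pi>\<close> is
  written additively: \<open>\<alpha> + \<beta>\<close>, \<open>- \<alpha>\<close>, \<open>0\<close> are the product, the inverse and the unit.
  Structure maps are total functions; only their values on the given subspaces are constrained.
\<close>

section \<open>Linear and bilinear maps between subspaces\<close>

definition linear_on ::
  "('k::field \<Rightarrow> 'a::ab_group_add \<Rightarrow> 'a) \<Rightarrow> ('k \<Rightarrow> 'b::ab_group_add \<Rightarrow> 'b) \<Rightarrow>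
   'a set \<Rightarrow> 'b set \<Rightarrow> ('a \<Rightarrow> 'b) \<Rightarrow> bool" where
  "linear_on sA sB A B f \<longleftrightarrow>
     (\<forall>x\<in>A. f x \<in> B) \<and>
     (\<forall>x\<in>A. \<forall>y\<in>A. f (x + y) = f x + f y) \<and>
     (\<forall>c. \<forall>x\<in>A. f (sA c x) = sB c (f x))"

definition bilinear_on ::
  "('k::field \<Rightarrow> 'h::ab_group_add \<Rightarrow> 'h) \<Rightarrow> ('k \<Rightarrow> 'u::ab_group_add \<Rightarrow> 'u) \<Rightarrow>
   'h set \<Rightarrow> 'h set \<Rightarrow> 'u set \<Rightarrow> ('h \<Rightarrow> 'h \<Rightarrow> 'u) \<Rightarrow> bool" where
  "bilinear_on s sU A B U f \<longleftrightarrow>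
     (\<forall>x\<in>A. linear_on s sU B U (\<lambda>y. f x y)) \<and>
     (\<forall>y\<in>B. linear_on s sU A U (\<lambda>x. f x y))"

section \<open>Tensor products of finitely many subspaces\<close>

text \<open>
  The tensor product of \<open>V\<^sub>1, \<dots>, V\<^sub>n\<close> is the free vector space on
  \<open>V\<^sub>1 \<times> \<dots> \<times> V\<^sub>n\<close> (tuples are lists) modulo the span of the multilinearity relations.
  Its elements are thus cosets of formal linear combinations.
\<close>

definition free_scale :: "'k::field \<Rightarrow> ('b \<Rightarrow>\<^sub>0 'k) \<Rightarrow> ('b \<Rightarrow>\<^sub>0 'k)" where
  "free_scale c f = Poly_Mapping.map (\<lambda>a. c * a) f"

abbreviation gen :: "'b \<Rightarrow> ('b \<Rightarrow>\<^sub>0 'k::field)" where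
  "gen b \<equiv> Poly_Mapping.single b 1"

definition tensor_relations ::
  "('k::field \<Rightarrow> 'h::ab_group_add \<Rightarrow> 'h) \<Rightarrow> 'h set list \<Rightarrow> ('h list \<Rightarrow>\<^sub>0 'k) set" where
  "tensor_relations scale Vs = module.span free_scale
     ({gen (xs[i := u + v]) - gen (xs[i := u]) - gen (xs[i := v]) | xs i u v.
         xs \<in> listset Vs \<and> i < length Vs \<and> u \<in> Vs ! i \<and> v \<in> Vs ! i} \<union>
      {gen (xs[i := scale c u]) - free_scale c (gen (xs[i := u])) | xs i c u.
         xs \<in> listset Vs \<and> i < length Vs \<and> u \<in> Vs ! i})"

definition formal_tensors :: "'h set list \<Rightarrow> ('h list \<Rightarrow>\<^sub>0 'k::field) set" where
  "formal_tensors Vs = {f. Poly_Mapping.keys f \<subseteq> listset Vs}"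

definition tensor_equiv ::
  "('k::field \<Rightarrow> 'h::ab_group_add \<Rightarrow> 'h) \<Rightarrow> 'h set list \<Rightarrow>
   (('h list \<Rightarrow>\<^sub>0 'k) \<times> ('h list \<Rightarrow>\<^sub>0 'k)) set" where
  "tensor_equiv scale Vs =
     {(f, g). f \<in> formal_tensors Vs \<and> g \<in> formal_tensors Vs \<and> f - g \<in> tensor_relations scale Vs}"

definition tensor_product ::
  "('k::field \<Rightarrow> 'h::ab_group_add \<Rightarrow> 'h) \<Rightarrow> 'h set list \<Rightarrow> ('h list \<Rightarrow>\<^sub>0 'k) set set" where
  "tensor_product scale Vs = formal_tensors Vs // tensor_equiv scale Vs"

definition tensor_class ::
  "('k::field \<Rightarrow> 'h::ab_group_add \<Rightarrow> 'h) \<Rightarrow> 'h set list \<Rightarrow>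
   ('h list \<Rightarrow>\<^sub>0 'k) \<Rightarrow> ('h list \<Rightarrow>\<^sub>0 'k) set" where
  "tensor_class scale Vs f = tensor_equiv scale Vs `` {f}"

definition tensor_rep :: "('h list \<Rightarrow>\<^sub>0 'k::field) set \<Rightarrow> ('h list \<Rightarrow>\<^sub>0 'k)" where
  "tensor_rep t = (SOME f. f \<in> t)"

text \<open>
  \<open>sweedler s t \<phi>\<close> is \<open>\<phi> t\<^sub>1 t\<^sub>2\<close> summed as in Sweedler notation: the value at \<open>t\<close> of the
  linear map on the tensor product of two spaces induced by the bilinear map \<open>\<phi>\<close>, where \<open>s\<close> is the
  scalar multiplication of the target. It is computed on a representative of \<open>t\<close>; the choice
  is immaterial for bilinear \<open>\<phi>\<close>, see \<open>sweedler_eq\<close> and \<open>sweedler_class_eq\<close> below.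
\<close>

definition free_extend ::
  "('k::field \<Rightarrow> 'u::ab_group_add \<Rightarrow> 'u) \<Rightarrow> ('b \<Rightarrow> 'u) \<Rightarrow> ('b \<Rightarrow>\<^sub>0 'k) \<Rightarrow> 'u" where
  "free_extend s \<phi> f = (\<Sum>b\<in>Poly_Mapping.keys f. s (Poly_Mapping.lookup f b) (\<phi> b))"

definition sweedler ::
  "('k::field \<Rightarrow> 'u::ab_group_add \<Rightarrow> 'u) \<Rightarrow> ('h list \<Rightarrow>\<^sub>0 'k) set \<Rightarrow> ('h \<Rightarrow> 'h \<Rightarrow> 'u) \<Rightarrow> 'u" where
  "sweedler s t \<phi> = free_extend s (\<lambda>xs. \<phi> (xs ! 0) (xs ! 1)) (tensor_rep t)"

lemma lookup_free_scale [simp]: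
  "Poly_Mapping.lookup (free_scale c f) b = c * Poly_Mapping.lookup f b"
  by (simp add: free_scale_def Poly_Mapping.map.rep_eq when_def)

lemma vector_space_free_scale: "vector_space (free_scale :: 'k::field \<Rightarrow> _)"
  by unfold_locales (auto intro!: poly_mapping_eqI simp: lookup_add algebra_simps)

lemma free_extend_superset:
  assumes "vector_space s" "finite X" "Poly_Mapping.keys f \<subseteq> X"
  shows "free_extend s \<phi> f = (\<Sum>b\<in>X. s (Poly_Mapping.lookup f b) (\<phi> b))"
proof -
  interpret vector_space s by fact
  show ?thesis
    unfolding free_extend_def using assms
    by (intro sum.mono_neutral_left) (auto simp: in_keys_iff)
qed

lemma free_extend_add:
  assumes "vector_space s"
  shows "free_extend s \<phi> (f + g) = free_extend s \<phi> f + free_extend s \<phi> g"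
proof -
  interpret vector_space s by fact
  let ?X = "Poly_Mapping.keys f \<union> Poly_Mapping.keys g"
  have k: "Poly_Mapping.keys (f + g) \<subseteq> ?X" by (rule keys_add)
  show ?thesis
    using k by (simp add: free_extend_superset[OF assms, of ?X] lookup_add scale_left_distrib sum.distrib)
qed

lemma free_extend_scale:
  assumes "vector_space s"
  shows "free_extend s \<phi> (free_scale c f) = s c (free_extend s \<phi> f)"
proof -
  interpret vector_space s by fact
  have k: "Poly_Mapping.keys (free_scale c f) \<subseteq> Poly_Mapping.keys f"
    by (auto simp: in_keys_iff)
  show ?thesis
    using k by (simp add: free_extend_superset[OF assms, of "Poly_Mapping.keys f"] scale_sum_right)
qed

lemma free_extend_gen [simp]:
  assumes "vector_space s"
  shows "free_extend s \<phi> (gen b) = \<phi> b"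
proof -
  interpret vector_space s by fact
  show ?thesis by (simp add: free_extend_def)
qed

lemma free_extend_diff:
  assumes "vector_space s"
  shows "free_extend s \<phi> (f - g) = free_extend s \<phi> f - free_extend s \<phi> g"
  using free_extend_add[OF assms, of \<phi> "f - g" g] by (simp add: algebra_simps)

lemma listset_pair: "listset [A, B] = {[a, b] | a b. a \<in> A \<and> b \<in> B}"
  by (auto simp: set_Cons_def)

lemma equiv_tensor_equiv:
  fixes scale :: "'k::field \<Rightarrow> 'h::ab_group_add \<Rightarrow> 'h"
  shows "equiv (formal_tensors Vs) (tensor_equiv scale Vs)"
proof -
  interpret F: vector_space "free_scale :: 'k \<Rightarrow> ('h list \<Rightarrow>\<^sub>0 'k) \<Rightarrow> _"
    by (rule vector_space_free_scale)
  have sub: "F.subspace (tensor_relations scale Vs)"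
    unfolding tensor_relations_def by (rule F.subspace_span)
  show ?thesis
  proof (rule equivI)
    show "tensor_equiv scale Vs \<subseteq> formal_tensors Vs \<times> formal_tensors Vs"
      by (auto simp: tensor_equiv_def)
    show "refl_on (formal_tensors Vs) (tensor_equiv scale Vs)"
      using F.subspace_0[OF sub] by (auto simp: refl_on_def tensor_equiv_def)
    show "sym (tensor_equiv scale Vs)"
      using F.subspace_neg[OF sub] by (force simp: sym_def tensor_equiv_def)
    show "trans (tensor_equiv scale Vs)"
      using F.subspace_add[OF sub] by (force simp: trans_def tensor_equiv_def)
  qed
qed

text \<open>Representative independence, for maps that are bilinear modulo a subspace \<open>N\<close> of the target.\<close>

lemma free_extend_tensor_equiv:
  fixes scale :: "'k::field \<Rightarrow> 'h::ab_group_add \<Rightarrow> 'h" and s :: "'k \<Rightarrow> 'u::ab_group_add \<Rightarrow> 'u"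
  assumes s: "vector_space s" and N: "module.subspace s N"
    and add1: "\<And>u v w. u \<in> A \<Longrightarrow> v \<in> A \<Longrightarrow> w \<in> B \<Longrightarrow> \<phi> (u + v) w - \<phi> u w - \<phi> v w \<in> N"
    and add2: "\<And>u v w. w \<in> A \<Longrightarrow> u \<in> B \<Longrightarrow> v \<in> B \<Longrightarrow> \<phi> w (u + v) - \<phi> w u - \<phi> w v \<in> N"
    and scale1: "\<And>c u w. u \<in> A \<Longrightarrow> w \<in> B \<Longrightarrow> \<phi> (scale c u) w - s c (\<phi> u w) \<in> N"
    and scale2: "\<And>c u w. w \<in> A \<Longrightarrow> u \<in> B \<Longrightarrow> \<phi> w (scale c u) - s c (\<phi> w u) \<in> N"
    and fg: "(f, g) \<in> tensor_equiv scale [A, B]"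
  shows "free_extend s (\<lambda>xs. \<phi> (xs ! 0) (xs ! 1)) f - free_extend s (\<lambda>xs. \<phi> (xs ! 0) (xs ! 1)) g \<in> N"
proof -
  interpret vector_space s by fact
  interpret F: vector_space "free_scale :: 'k \<Rightarrow> ('h list \<Rightarrow>\<^sub>0 'k) \<Rightarrow> _"
    by (rule vector_space_free_scale)
  let ?E = "free_extend s (\<lambda>xs. \<phi> (xs ! 0) (xs ! 1))"
  note lin = free_extend_add[OF s] free_extend_diff[OF s] free_extend_scale[OF s] free_extend_gen[OF s]
  have sub: "F.subspace {h. ?E h \<in> N}"
    using subspace_0[OF N] subspace_add[OF N] subspace_scale[OF N]
    by (auto simp: F.subspace_def lin free_extend_def[of _ _ 0])
  have "tensor_relations scale [A, B] \<subseteq> {h. ?E h \<in> N}"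
    unfolding tensor_relations_def
  proof (rule F.span_minimal[OF _ sub], safe, goal_cases)
    case (1 _ xs i u v)
    then obtain a b where ab: "xs = [a, b]" "a \<in> A" "b \<in> B"
      by (auto simp: set_Cons_def)
    from 1(2) have "i = 0 \<or> i = 1" by auto
    with 1 ab show ?case by (auto simp: lin add1 add2)
  next
    case (2 _ xs i c u)
    then obtain a b where ab: "xs = [a, b]" "a \<in> A" "b \<in> B"
      by (auto simp: set_Cons_def)
    from 2(2) have "i = 0 \<or> i = 1" by auto
    with 2 ab show ?case by (auto simp: lin scale1 scale2)
  qed
  with fg show ?thesis by (auto simp: tensor_equiv_def lin)
qed

lemma tensor_rep_equiv:
  assumes "t \<in> tensor_product scale Vs" "f \<in> t"
  shows "(tensor_rep t, f) \<in> tensor_equiv scale Vs"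
proof -
  have "tensor_rep t \<in> t" unfolding tensor_rep_def using assms(2) by (rule someI)
  with assms show ?thesis
    using quotient_eq_iff[OF equiv_tensor_equiv[of Vs scale], of t t "tensor_rep t" f]
    by (simp add: tensor_product_def)
qed

lemma sweedler_eq:
  assumes s: "vector_space s" and \<phi>: "bilinear_on scale s A B U \<phi>"
    and t: "t \<in> tensor_product scale [A, B]" "f \<in> t"
  shows "sweedler s t \<phi> = free_extend s (\<lambda>xs. \<phi> (xs ! 0) (xs ! 1)) f"
proof -
  interpret vector_space s by fact
  have "free_extend s (\<lambda>xs. \<phi> (xs ! 0) (xs ! 1)) (tensor_rep t) -
      free_extend s (\<lambda>xs. \<phi> (xs ! 0) (xs ! 1)) f \<in> {0}"
    by (rule free_extend_tensor_equiv[OF s subspace_single_0 _ _ _ _ tensor_rep_equiv[OF t]])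
      (use \<phi> in \<open>auto simp: bilinear_on_def linear_on_def\<close>)
  then show ?thesis by (simp add: sweedler_def)
qed

lemma free_extend_formal:
  assumes "\<And>b. b \<in> Poly_Mapping.keys f \<Longrightarrow> \<phi> b \<in> formal_tensors Vs"
  shows "free_extend free_scale \<phi> f \<in> formal_tensors Vs"
proof -
  have "Poly_Mapping.keys (free_scale (Poly_Mapping.lookup f b) (\<phi> b)) \<subseteq> listset Vs"
    if "b \<in> Poly_Mapping.keys f" for b
    using assms[OF that] by (auto simp: formal_tensors_def in_keys_iff)
  then show ?thesis
    unfolding formal_tensors_def free_extend_def
    using keys_sum[of "\<lambda>b. free_scale (Poly_Mapping.lookup f b) (\<phi> b)" "Poly_Mapping.keys f"] by blast
qed

text \<open>Here \<open>\<phi>\<close> takes values in formal tensors and is bilinear after passing to classes.\<close>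

lemma sweedler_class_eq:
  fixes scale :: "'k::field \<Rightarrow> 'h::ab_group_add \<Rightarrow> 'h"
  defines "R Vs \<equiv> tensor_relations scale Vs"
  assumes closed: "\<And>u v. u \<in> A \<Longrightarrow> v \<in> B \<Longrightarrow> \<phi> u v \<in> formal_tensors Vs"
    and add1: "\<And>u v w. u \<in> A \<Longrightarrow> v \<in> A \<Longrightarrow> w \<in> B \<Longrightarrow> \<phi> (u + v) w - \<phi> u w - \<phi> v w \<in> R Vs"
    and add2: "\<And>u v w. w \<in> A \<Longrightarrow> u \<in> B \<Longrightarrow> v \<in> B \<Longrightarrow> \<phi> w (u + v) - \<phi> w u - \<phi> w v \<in> R Vs"
    and scale1: "\<And>c u w. u \<in> A \<Longrightarrow> w \<in> B \<Longrightarrow> \<phi> (scale c u) w - free_scale c (\<phi> u w) \<in> R Vs"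
    and scale2: "\<And>c u w. w \<in> A \<Longrightarrow> u \<in> B \<Longrightarrow> \<phi> w (scale c u) - free_scale c (\<phi> w u) \<in> R Vs"
    and t: "t \<in> tensor_product scale [A, B]" "f \<in> t"
  shows "tensor_class scale Vs (sweedler free_scale t \<phi>) =
    tensor_class scale Vs (free_extend free_scale (\<lambda>xs. \<phi> (xs ! 0) (xs ! 1)) f)"
proof -
  interpret F: vector_space "free_scale :: 'k \<Rightarrow> ('h list \<Rightarrow>\<^sub>0 'k) \<Rightarrow> _"
    by (rule vector_space_free_scale)
  let ?E = "free_extend free_scale (\<lambda>xs. \<phi> (xs ! 0) (xs ! 1))"
  have sub: "F.subspace (R Vs)"
    unfolding R_def tensor_relations_def by (rule F.subspace_span)
  have eq: "(tensor_rep t, f) \<in> tensor_equiv scale [A, B]" by (rule tensor_rep_equiv[OF t])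
  have "?E (tensor_rep t) - ?E f \<in> R Vs"
    by (rule free_extend_tensor_equiv[OF vector_space_free_scale sub _ _ _ _ eq])
      (fact add1 add2 scale1 scale2)+
  moreover have "?E g \<in> formal_tensors Vs" if "g \<in> formal_tensors [A, B]" for g
  proof (rule free_extend_formal)
    fix b assume "b \<in> Poly_Mapping.keys g"
    with that have "b \<in> listset [A, B]" by (auto simp: formal_tensors_def)
    then obtain x y where "b = [x, y]" "x \<in> A" "y \<in> B" unfolding listset_pair by blast
    then show "\<phi> (b ! 0) (b ! 1) \<in> formal_tensors Vs" by (simp add: closed)
  qed
  ultimately have "(?E (tensor_rep t), ?E f) \<in> tensor_equiv scale Vs"
    using eq by (auto simp: tensor_equiv_def R_def)
  then show ?thesis
    unfolding tensor_class_def sweedler_def by (rule equiv_class_eq[OF equiv_tensor_equiv])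
qed

section \<open>Coalgebras\<close>

locale coalgebra = vector_space scale
  for scale :: "'k::field \<Rightarrow> 'h::ab_group_add \<Rightarrow> 'h" +
  fixes C :: "'h set"
    and \<Delta> :: "'h \<Rightarrow> ('h list \<Rightarrow>\<^sub>0 'k) set"
    and \<epsilon> :: "'h \<Rightarrow> 'k"
  assumes subspace_C: "subspace C"
    and comult_closed: "x \<in> C \<Longrightarrow> \<Delta> x \<in> tensor_product scale [C, C]"
    and comult_add: "x \<in> C \<Longrightarrow> y \<in> C \<Longrightarrow>
          \<Delta> (x + y) = tensor_class scale [C, C] (tensor_rep (\<Delta> x) + tensor_rep (\<Delta> y))"
    and comult_scale: "x \<in> C \<Longrightarrow>
          \<Delta> (scale c x) = tensor_class scale [C, C] (free_scale c (tensor_rep (\<Delta> x)))"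
    and counit_linear: "linear_on scale (*) C UNIV \<epsilon>"
    and coassoc: "x \<in> C \<Longrightarrow>
          tensor_class scale [C, C, C]
            (sweedler free_scale (\<Delta> x) (\<lambda>a b. sweedler free_scale (\<Delta> a) (\<lambda>a1 a2. gen [a1, a2, b]))) =
          tensor_class scale [C, C, C]
            (sweedler free_scale (\<Delta> x) (\<lambda>a b. sweedler free_scale (\<Delta> b) (\<lambda>b1 b2. gen [a, b1, b2])))"
    and counit_left: "x \<in> C \<Longrightarrow> sweedler scale (\<Delta> x) (\<lambda>a b. scale (\<epsilon> a) b) = x"
    and counit_right: "x \<in> C \<Longrightarrow> sweedler scale (\<Delta> x) (\<lambda>a b. scale (\<epsilon> b) a) = x"

definition cocommutative ::
  "('k::field \<Rightarrow> 'h::ab_group_add \<Rightarrow> 'h) \<Rightarrow> 'h set \<Rightarrow> ('h \<Rightarrow> ('h list \<Rightarrow>\<^sub>0 'k) set) \<Rightarrow> bool" where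
  "cocommutative scale C \<Delta> \<longleftrightarrow>
     (\<forall>x\<in>C. tensor_class scale [C, C] (sweedler free_scale (\<Delta> x) (\<lambda>a b. gen [b, a])) = \<Delta> x)"

text \<open>
  A linear map from the tensor product of \<open>A\<close> and \<open>B\<close> to \<open>C\<close>, given as a bilinear map, that is a
  coalgebra map for the tensor product coalgebra structure
  \<open>a \<otimes> b \<mapsto> (a\<^sub>1 \<otimes> b\<^sub>1) \<otimes> (a\<^sub>2 \<otimes> b\<^sub>2)\<close> with counit \<open>\<epsilon>\<^sub>A a * \<epsilon>\<^sub>B b\<close>.
\<close>

definition coalgebra_map2 ::
  "('k::field \<Rightarrow> 'h::ab_group_add \<Rightarrow> 'h) \<Rightarrow>
   'h set \<Rightarrow> ('h \<Rightarrow> ('h list \<Rightarrow>\<^sub>0 'k) set) \<Rightarrow> ('h \<Rightarrow> 'k) \<Rightarrow>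
   'h set \<Rightarrow> ('h \<Rightarrow> ('h list \<Rightarrow>\<^sub>0 'k) set) \<Rightarrow> ('h \<Rightarrow> 'k) \<Rightarrow>
   'h set \<Rightarrow> ('h \<Rightarrow> ('h list \<Rightarrow>\<^sub>0 'k) set) \<Rightarrow> ('h \<Rightarrow> 'k) \<Rightarrow>
   ('h \<Rightarrow> 'h \<Rightarrow> 'h) \<Rightarrow> bool" where
  "coalgebra_map2 scale A \<Delta>A \<epsilon>A B \<Delta>B \<epsilon>B C \<Delta>C \<epsilon>C f \<longleftrightarrow>
     bilinear_on scale scale A B C f \<and>
     (\<forall>x\<in>A. \<forall>y\<in>B.
        \<Delta>C (f x y) =
          tensor_class scale [C, C]
            (sweedler free_scale (\<Delta>A x) (\<lambda>x1 x2.
               sweedler free_scale (\<Delta>B y) (\<lambda>y1 y2. gen [f x1 y1, f x2 y2]))) \<and>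
        \<epsilon>C (f x y) = \<epsilon>A x * \<epsilon>B y)"

section \<open>Hopf algebras graded by an abelian group\<close>

locale hopf_pi_algebra = vector_space scale
  for scale :: "'k::field \<Rightarrow> 'h::ab_group_add \<Rightarrow> 'h" +
  fixes H :: "'p::ab_group_add \<Rightarrow> 'h set"
    and \<Delta> :: "'p \<Rightarrow> 'h \<Rightarrow> ('h list \<Rightarrow>\<^sub>0 'k) set"
    and \<epsilon> :: "'p \<Rightarrow> 'h \<Rightarrow> 'k"
    and mul :: "'p \<Rightarrow> 'p \<Rightarrow> 'h \<Rightarrow> 'h \<Rightarrow> 'h"
    and one :: "'h"
    and S :: "'p \<Rightarrow> 'h \<Rightarrow> 'h"
  assumes coalg: "\<And>\<alpha>. coalgebra scale (H \<alpha>) (\<Delta> \<alpha>) (\<epsilon> \<alpha>)"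
    and mul_coalgebra_map: "\<And>\<alpha> \<beta>.
          coalgebra_map2 scale (H \<alpha>) (\<Delta> \<alpha>) (\<epsilon> \<alpha>) (H \<beta>) (\<Delta> \<beta>) (\<epsilon> \<beta>)
            (H (\<alpha> + \<beta>)) (\<Delta> (\<alpha> + \<beta>)) (\<epsilon> (\<alpha> + \<beta>)) (mul \<alpha> \<beta>)"
    and one_closed: "one \<in> H 0"
    and comult_one: "\<Delta> 0 one = tensor_class scale [H 0, H 0] (gen [one, one])"
    and counit_one: "\<epsilon> 0 one = 1"
    and mul_assoc: "\<And>\<alpha> \<beta> \<gamma> x y z. x \<in> H \<alpha> \<Longrightarrow> y \<in> H \<beta> \<Longrightarrow> z \<in> H \<gamma> \<Longrightarrow>
          mul (\<alpha> + \<beta>) \<gamma> (mul \<alpha> \<beta> x y) z = mul \<alpha> (\<beta> + \<gamma>) x (mul \<beta> \<gamma> y z)"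
    and mul_one_left: "\<And>\<alpha> x. x \<in> H \<alpha> \<Longrightarrow> mul 0 \<alpha> one x = x"
    and mul_one_right: "\<And>\<alpha> x. x \<in> H \<alpha> \<Longrightarrow> mul \<alpha> 0 x one = x"
    and antipode_linear: "\<And>\<alpha>. linear_on scale scale (H \<alpha>) (H (- \<alpha>)) (S \<alpha>)"
    and antipode_left: "\<And>\<alpha> x. x \<in> H \<alpha> \<Longrightarrow>
          sweedler scale (\<Delta> \<alpha> x) (\<lambda>x1 x2. mul (- \<alpha>) \<alpha> (S \<alpha> x1) x2) = scale (\<epsilon> \<alpha> x) one"
    and antipode_right: "\<And>\<alpha> x. x \<in> H \<alpha> \<Longrightarrow>
          sweedler scale (\<Delta> \<alpha> x) (\<lambda>x1 x2. mul \<alpha> (- \<alpha>) x1 (S \<alpha> x2)) = scale (\<epsilon> \<alpha> x) one"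

definition cocommutative_family ::
  "('k::field \<Rightarrow> 'h::ab_group_add \<Rightarrow> 'h) \<Rightarrow> ('p \<Rightarrow> 'h set) \<Rightarrow>
   ('p \<Rightarrow> 'h \<Rightarrow> ('h list \<Rightarrow>\<^sub>0 'k) set) \<Rightarrow> bool" where
  "cocommutative_family scale H \<Delta> \<longleftrightarrow> (\<forall>\<alpha>. cocommutative scale (H \<alpha>) (\<Delta> \<alpha>))"

section \<open>Post-Hopf algebras\<close>

text \<open>
  Linear maps from \<open>C\<close> to \<open>End V\<close> are given as bilinear maps from \<open>C\<close> and \<open>V\<close> to \<open>V\<close>.
  The unit for convolution is \<open>x \<mapsto> \<epsilon> x\<close> times the identity.
\<close>

definition convolution_inverse ::
  "('k::field \<Rightarrow> 'h::ab_group_add \<Rightarrow> 'h) \<Rightarrow>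
   'h set \<Rightarrow> ('h \<Rightarrow> ('h list \<Rightarrow>\<^sub>0 'k) set) \<Rightarrow> ('h \<Rightarrow> 'k) \<Rightarrow> 'h set \<Rightarrow>
   ('h \<Rightarrow> 'h \<Rightarrow> 'h) \<Rightarrow> ('h \<Rightarrow> 'h \<Rightarrow> 'h) \<Rightarrow> bool" where
  "convolution_inverse scale C \<Delta> \<epsilon> V \<theta> \<psi> \<longleftrightarrow>
     bilinear_on scale scale C V V \<psi> \<and>
     (\<forall>x\<in>C. \<forall>y\<in>V.
        sweedler scale (\<Delta> x) (\<lambda>x1 x2. \<psi> x1 (\<theta> x2 y)) = scale (\<epsilon> x) y \<and>
        sweedler scale (\<Delta> x) (\<lambda>x1 x2. \<theta> x1 (\<psi> x2 y)) = scale (\<epsilon> x) y)"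

definition convolution_invertible ::
  "('k::field \<Rightarrow> 'h::ab_group_add \<Rightarrow> 'h) \<Rightarrow>
   'h set \<Rightarrow> ('h \<Rightarrow> ('h list \<Rightarrow>\<^sub>0 'k) set) \<Rightarrow> ('h \<Rightarrow> 'k) \<Rightarrow> 'h set \<Rightarrow>
   ('h \<Rightarrow> 'h \<Rightarrow> 'h) \<Rightarrow> bool" where
  "convolution_invertible scale C \<Delta> \<epsilon> V \<theta> \<longleftrightarrow>
     (\<exists>\<psi>. convolution_inverse scale C \<Delta> \<epsilon> V \<theta> \<psi> \<and>
          (\<forall>\<psi>'. convolution_inverse scale C \<Delta> \<epsilon> V \<theta> \<psi>' \<longrightarrow> (\<forall>x\<in>C. \<forall>y\<in>V. \<psi>' x y = \<psi> x y)))"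

locale post_hopf_pi_algebra = hopf_pi_algebra scale H \<Delta> \<epsilon> mul one S
  for scale :: "'k::field \<Rightarrow> 'h::ab_group_add \<Rightarrow> 'h"
    and H :: "'p::ab_group_add \<Rightarrow> 'h set"
    and \<Delta> :: "'p \<Rightarrow> 'h \<Rightarrow> ('h list \<Rightarrow>\<^sub>0 'k) set"
    and \<epsilon> :: "'p \<Rightarrow> 'h \<Rightarrow> 'k"
    and mul :: "'p \<Rightarrow> 'p \<Rightarrow> 'h \<Rightarrow> 'h \<Rightarrow> 'h"
    and one :: "'h"
    and S :: "'p \<Rightarrow> 'h \<Rightarrow> 'h" +
  fixes act :: "'p \<Rightarrow> 'p \<Rightarrow> 'h \<Rightarrow> 'h \<Rightarrow> 'h"
  assumes act_coalgebra_map: "\<And>\<alpha> \<beta>.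
          coalgebra_map2 scale (H \<alpha>) (\<Delta> \<alpha>) (\<epsilon> \<alpha>) (H \<beta>) (\<Delta> \<beta>) (\<epsilon> \<beta>)
            (H \<beta>) (\<Delta> \<beta>) (\<epsilon> \<beta>) (act \<alpha> \<beta>)"
    and act_mul: "\<And>\<alpha> \<beta> \<gamma> x y z. x \<in> H \<alpha> \<Longrightarrow> y \<in> H \<beta> \<Longrightarrow> z \<in> H \<gamma> \<Longrightarrow>
          act \<alpha> (\<beta> + \<gamma>) x (mul \<beta> \<gamma> y z) =
          sweedler scale (\<Delta> \<alpha> x) (\<lambda>x1 x2. mul \<beta> \<gamma> (act \<alpha> \<beta> x1 y) (act \<alpha> \<gamma> x2 z))"
    and act_act: "\<And>\<alpha> \<beta> \<gamma> x y z. x \<in> H \<alpha> \<Longrightarrow> y \<in> H \<beta> \<Longrightarrow> z \<in> H \<gamma> \<Longrightarrow>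
          act \<alpha> \<gamma> x (act \<beta> \<gamma> y z) =
          act (\<alpha> + \<beta>) \<gamma> (sweedler scale (\<Delta> \<alpha> x) (\<lambda>x1 x2. mul \<alpha> \<beta> x1 (act \<alpha> \<beta> x2 y))) z"
    and act_invertible: "\<And>\<alpha> \<beta>.
          convolution_invertible scale (H \<alpha>) (\<Delta> \<alpha>) (\<epsilon> \<alpha>) (H \<beta>) (act \<alpha> \<beta>)"

definition subadjacent_mul ::
  "('k::field \<Rightarrow> 'h::ab_group_add \<Rightarrow> 'h) \<Rightarrow> ('p \<Rightarrow> 'h \<Rightarrow> ('h list \<Rightarrow>\<^sub>0 'k) set) \<Rightarrow>
   ('p \<Rightarrow> 'p \<Rightarrow> 'h \<Rightarrow> 'h \<Rightarrow> 'h) \<Rightarrow> ('p \<Rightarrow> 'p \<Rightarrow> 'h \<Rightarrow> 'h \<Rightarrow> 'h) \<Rightarrow>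
   'p \<Rightarrow> 'p \<Rightarrow> 'h \<Rightarrow> 'h \<Rightarrow> 'h" where
  "subadjacent_mul scale \<Delta> mul act \<alpha> \<beta> x y =
     sweedler scale (\<Delta> \<alpha> x) (\<lambda>x1 x2. mul \<alpha> \<beta> x1 (act \<alpha> \<beta> x2 y))"

definition subadjacent_antipode ::
  "('k::field \<Rightarrow> 'h::ab_group_add \<Rightarrow> 'h) \<Rightarrow> ('p::ab_group_add \<Rightarrow> 'h \<Rightarrow> ('h list \<Rightarrow>\<^sub>0 'k) set) \<Rightarrow>
   ('p \<Rightarrow> 'h \<Rightarrow> 'h) \<Rightarrow> ('p \<Rightarrow> 'p \<Rightarrow> 'h \<Rightarrow> 'h \<Rightarrow> 'h) \<Rightarrow>
   'p \<Rightarrow> 'h \<Rightarrow> 'h" where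
  "subadjacent_antipode scale \<Delta> S \<psi> \<alpha> x =
     sweedler scale (\<Delta> \<alpha> x) (\<lambda>x1 x2. \<psi> \<alpha> (- \<alpha>) x1 (S \<alpha> x2))"

section \<open>Hopf braces\<close>

locale hopf_pi_brace =
  dot: hopf_pi_algebra scale H \<Delta> \<epsilon> mul one S +
  circ: hopf_pi_algebra scale H \<Delta> \<epsilon> cmul cone T
  for scale :: "'k::field \<Rightarrow> 'h::ab_group_add \<Rightarrow> 'h"
    and H :: "'p::ab_group_add \<Rightarrow> 'h set"
    and \<Delta> :: "'p \<Rightarrow> 'h \<Rightarrow> ('h list \<Rightarrow>\<^sub>0 'k) set"
    and \<epsilon> :: "'p \<Rightarrow> 'h \<Rightarrow> 'k"
    and mul :: "'p \<Rightarrow> 'p \<Rightarrow> 'h \<Rightarrow> 'h \<Rightarrow> 'h"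
    and one :: "'h"
    and S :: "'p \<Rightarrow> 'h \<Rightarrow> 'h"
    and cmul :: "'p \<Rightarrow> 'p \<Rightarrow> 'h \<Rightarrow> 'h \<Rightarrow> 'h"
    and cone :: "'h"
    and T :: "'p \<Rightarrow> 'h \<Rightarrow> 'h" +
  assumes brace: "\<And>\<alpha> \<beta> \<gamma> g h l. g \<in> H \<alpha> \<Longrightarrow> h \<in> H \<beta> \<Longrightarrow> l \<in> H \<gamma> \<Longrightarrow>
          cmul \<alpha> (\<beta> + \<gamma>) g (mul \<beta> \<gamma> h l) =
          sweedler scale (\<Delta> \<alpha> g) (\<lambda>g1 g'. sweedler scale (\<Delta> \<alpha> g') (\<lambda>g2 g3.
            mul (\<alpha> + \<beta> - \<alpha>) (\<alpha> + \<gamma>)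
              (mul (\<alpha> + \<beta>) (- \<alpha>) (cmul \<alpha> \<beta> g1 h) (S \<alpha> g2))
              (cmul \<alpha> \<gamma> g3 l)))"

definition brace_action ::
  "('k::field \<Rightarrow> 'h::ab_group_add \<Rightarrow> 'h) \<Rightarrow> ('p::ab_group_add \<Rightarrow> 'h \<Rightarrow> ('h list \<Rightarrow>\<^sub>0 'k) set) \<Rightarrow>
   ('p \<Rightarrow> 'p \<Rightarrow> 'h \<Rightarrow> 'h \<Rightarrow> 'h) \<Rightarrow> ('p \<Rightarrow> 'h \<Rightarrow> 'h) \<Rightarrow> ('p \<Rightarrow> 'p \<Rightarrow> 'h \<Rightarrow> 'h \<Rightarrow> 'h) \<Rightarrow>
   'p \<Rightarrow> 'p \<Rightarrow> 'h \<Rightarrow> 'h \<Rightarrow> 'h" where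
  "brace_action scale \<Delta> mul S cmul \<alpha> \<beta> x y =
     sweedler scale (\<Delta> \<alpha> x) (\<lambda>x1 x2. mul (- \<alpha>) (\<alpha> + \<beta>) (S \<alpha> x1) (cmul \<alpha> \<beta> x2 y))"

end

theory Submission
  imports Defs
begin

text \<open>
  An equality of tensors amounts to an equality under all bilinear maps, so every statement can be
  computed in Sweedler notation with an arbitrary multilinear map applied to the outcome.
  From a post-Hopf algebra, the brace identity follows from \<open>g * y = g\<^sub>1 (g\<^sub>2 \<triangleright> y)\<close> by cancelling
  \<open>S(g\<^sub>i) g\<^sub>i\<^sub>+\<^sub>1\<close>, and the antipode axiom for \<open>T\<close> holds because left multiplication by \<open>x\<close> in \<open>*\<close> has the
  two-sided inverse \<open>y \<mapsto> \<psi>\<^bsub>x\<^sub>1\<^esub>(S(x\<^sub>2) y)\<close>.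
  From a brace, the uniqueness of convolution inverses gives
  \<open>S(x \<circ> y) = S(x\<^sub>1) (x\<^sub>2 \<circ> S(y)) S(x\<^sub>3)\<close>, which turns \<open>(x \<circ> y) \<triangleright> z\<close> into \<open>x \<triangleright> (y \<triangleright> z)\<close>; then
  \<open>x \<mapsto> T(x) \<triangleright> _\<close> is the convolution inverse of the action.
  Cocommutativity enters in showing that \<open>*\<close> and \<open>\<triangleright>\<close> are coalgebra maps.
\<close>

section \<open>Linear maps and sums over representatives\<close>

text \<open>A Sweedler sum is evaluated on a chosen representative of a coset, and the
  representative of a sum is not the sum of representatives. Rewriting such sums therefore needs
  either bilinearity of the summand or an argument about finite sums that ignores what is summed.
  The calculus turns memberships and linearity into side conditions that simp can discharge, so that
  a calculation becomes a chain of coassociativity, cocommutativity and exchange of sums. Two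
  features of the axioms shape the algebra. The laws for x \<triangleright> 1 and 1 \<triangleright>
  y are not postulated and have to be derived before \<open>*\<close> has a unit. And T(x1) * x2
  cannot be computed directly, since expanding \<open>*\<close> needs the comultiplication of T(x1),
  about which nothing is known; the detour through a two-sided inverse of left multiplication avoids
  it. In the other direction the formula for S(x \<circ> y) comes from the brace law at h = y1, l =
  S(y2): the left side collapses to x, so x1 \<circ> y1 acquires a visible right convolution
  inverse.\<close>

lemma linear_on_sum:
  assumes "vector_space sA" "vector_space sB" "module.subspace sA A" "linear_on sA sB A B f"
    and "finite I" "\<And>i. i \<in> I \<Longrightarrow> h i \<in> A"
  shows "f (\<Sum>i\<in>I. h i) = (\<Sum>i\<in>I. f (h i)) \<and> (\<Sum>i\<in>I. h i) \<in> A"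
proof -
  interpret A: vector_space sA by fact
  interpret B: vector_space sB by fact
  have add: "f (x + y) = f x + f y" if "x \<in> A" "y \<in> A" for x y
    using assms(4) that by (auto simp: linear_on_def)
  have "f (sA 0 0) = sB 0 (f 0)"
    using assms(4) A.subspace_0[OF assms(3)] unfolding linear_on_def by blast
  then have 0: "f 0 = 0" by simp
  show ?thesis
    using assms(5,6)
    by (induction I rule: finite_induct)
      (auto simp: 0 add A.subspace_0[OF assms(3)] A.subspace_add[OF assms(3)])
qed

lemma linear_on_free_extend:
  assumes A: "vector_space sA" and B: "vector_space sB" and sub: "module.subspace sA A"
    and f: "linear_on sA sB A B f" and h: "\<And>b. b \<in> Poly_Mapping.keys t \<Longrightarrow> h b \<in> A"
  shows "f (free_extend sA h t) = free_extend sB (\<lambda>b. f (h b)) t"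
proof -
  interpret A: vector_space sA by fact
  have m: "sA c (h b) \<in> A" if "b \<in> Poly_Mapping.keys t" for b c
    using A.subspace_scale[OF sub h[OF that]] .
  have "f (free_extend sA h t) = (\<Sum>b\<in>Poly_Mapping.keys t. f (sA (Poly_Mapping.lookup t b) (h b)))"
    unfolding free_extend_def using linear_on_sum[OF A B sub f, of "Poly_Mapping.keys t"] m by simp
  also have "\<dots> = free_extend sB (\<lambda>b. f (h b)) t"
    unfolding free_extend_def using f h by (auto simp: linear_on_def intro!: sum.cong)
  finally show ?thesis .
qed

lemma free_extend_mem:
  assumes "vector_space s" "module.subspace s U" "\<And>b. b \<in> Poly_Mapping.keys t \<Longrightarrow> h b \<in> U"
  shows "free_extend s h t \<in> U"
proof -
  interpret vector_space s by fact
  show ?thesis unfolding free_extend_def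
    by (intro subspace_sum assms subspace_scale)
qed

lemma free_extend_cong:
  "(\<And>b. b \<in> Poly_Mapping.keys t \<Longrightarrow> g b = h b) \<Longrightarrow> free_extend s g t = free_extend s h t"
  by (simp add: free_extend_def)

lemma free_extend_swap:
  assumes "vector_space s"
  shows "free_extend s (\<lambda>b. free_extend s (\<lambda>c. F b c) u) t =
         free_extend s (\<lambda>c. free_extend s (\<lambda>b. F b c) t) u"
proof -
  interpret vector_space s by fact
  show ?thesis unfolding free_extend_def
    by (simp add: scale_sum_right) (subst sum.swap, simp add: mult.commute)
qed

lemma free_extend_gen_id: "free_extend free_scale gen f = f"
proof -
  interpret F: vector_space "free_scale :: 'b \<Rightarrow> ('a \<Rightarrow>\<^sub>0 'b) \<Rightarrow> _" by (rule vector_space_free_scale)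
  have "free_scale (Poly_Mapping.lookup f b) (gen b) = Poly_Mapping.single b (Poly_Mapping.lookup f b)" for b
    by (rule poly_mapping_eqI) (simp add: lookup_single when_def)
  then have "free_extend free_scale gen f =
      (\<Sum>b\<in>Poly_Mapping.keys f. Poly_Mapping.single b (Poly_Mapping.lookup f b))"
    by (simp add: free_extend_def)
  also have "\<dots> = f"
    by (rule poly_mapping_eqI)
      (simp add: lookup_sum lookup_single when_def in_keys_iff)
  finally show ?thesis .
qed

section \<open>Tensors are detected by multilinear maps\<close>

text \<open>Multilinearity makes the free extension vanish on both kinds of generators, hence on
  their span. Lists of any length are allowed because coassociativity lives in a threefold tensor
  product.\<close>

lemma tensor_relations_kernel:
  fixes scale :: "'k::field \<Rightarrow> 'h::ab_group_add \<Rightarrow> 'h" and s :: "'k \<Rightarrow> 'u::ab_group_add \<Rightarrow> 'u"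
  assumes s: "vector_space s"
    and add: "\<And>xs i u v. xs \<in> listset Vs \<Longrightarrow> i < length Vs \<Longrightarrow> u \<in> Vs ! i \<Longrightarrow> v \<in> Vs ! i \<Longrightarrow>
      \<phi> (xs[i := u + v]) = \<phi> (xs[i := u]) + \<phi> (xs[i := v])"
    and scl: "\<And>xs i c u. xs \<in> listset Vs \<Longrightarrow> i < length Vs \<Longrightarrow> u \<in> Vs ! i \<Longrightarrow>
      \<phi> (xs[i := scale c u]) = s c (\<phi> (xs[i := u]))"
    and f: "f \<in> tensor_relations scale Vs"
  shows "free_extend s \<phi> f = 0"
proof -
  interpret vector_space s by fact
  interpret F: vector_space "free_scale :: 'k \<Rightarrow> ('h list \<Rightarrow>\<^sub>0 'k) \<Rightarrow> _"
    by (rule vector_space_free_scale)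
  note lin = free_extend_add[OF s] free_extend_diff[OF s] free_extend_scale[OF s] free_extend_gen[OF s]
  have sub: "F.subspace {h. free_extend s \<phi> h = 0}"
    by (auto simp: F.subspace_def lin free_extend_def[of _ _ 0])
  have "tensor_relations scale Vs \<subseteq> {h. free_extend s \<phi> h = 0}"
    unfolding tensor_relations_def
    by (rule F.span_minimal[OF _ sub]) (auto simp: lin add scl)
  with f show ?thesis by auto
qed

text \<open>A substitute for the quotient map by R that stays inside the same type: extend a basis
  of R to a basis of the whole space, send the basis of R to 0 and fix the remaining basis
  vectors.\<close>

lemma exists_projection_with_kernel:
  assumes "vector_space s" "module.subspace s R"
  shows "\<exists>p. linear_on s s UNIV UNIV p \<and> (\<forall>x. p x = 0 \<longleftrightarrow> x \<in> R)"
proof -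
  interpret vector_space s by fact
  interpret P: vector_space_pair s s ..
  obtain B where B: "B \<subseteq> R" "independent B" "R \<subseteq> span B"
    using maximal_independent_subset by blast
  have spB: "span B = R" using B assms(2) by (simp add: span_subspace)
  let ?E = "extend_basis B"
  have E: "B \<subseteq> ?E" "independent ?E" "span ?E = UNIV"
    using extend_basis_superset[OF B(2)] independent_extend_basis[OF B(2)] span_extend_basis[OF B(2)] by auto
  define p where "p = P.construct ?E (\<lambda>b. if b \<in> B then 0 else b)"
  have p: "Vector_Spaces.linear s s p" unfolding p_def by (rule P.linear_construct[OF E(2)])
  interpret p: Vector_Spaces.linear s s p by (rule p)
  have pb: "p b = (if b \<in> B then 0 else b)" if "b \<in> ?E" for b
    unfolding p_def using P.construct_basis[OF E(2) that] .
  have p0: "p x = 0" if "x \<in> R" for x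
    by (metis (no_types, lifting) E(1) P.linear_0 P.linear_eq_0_on_span p pb spB subsetD that)
  have pid: "p x = x" if "x \<in> span (?E - B)" for x
  proof -
    have "Vector_Spaces.linear s s (\<lambda>x. x)" by (rule linear_ident)
    from P.linear_eq_on[OF p this that] pb show ?thesis by auto
  qed
  have "x \<in> R" if "p x = 0" for x
  proof -
    have "x \<in> span (B \<union> (?E - B))" using E by (simp add: Un_absorb1)
    then obtain y z where yz: "x = y + z" "y \<in> span B" "z \<in> span (?E - B)"
      unfolding span_Un by auto
    have "p x = p y + p z" using yz by (simp add: p.add)
    with yz that p0[of y] pid[of z] spB show ?thesis by simp
  qed
  moreover have "linear_on s s UNIV UNIV p"
    by (auto simp: linear_on_def p.add p.scale)
  ultimately show ?thesis using p0 by blast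
qed

lemma tensor_class_eq_iff:
  assumes "f \<in> formal_tensors Vs" "g \<in> formal_tensors Vs"
  shows "tensor_class scale Vs f = tensor_class scale Vs g \<longleftrightarrow> f - g \<in> tensor_relations scale Vs"
  using eq_equiv_class_iff[OF equiv_tensor_equiv[of Vs scale] assms] assms
  by (auto simp: tensor_class_def tensor_equiv_def)

lemma mem_tensor_class:
  "f \<in> formal_tensors Vs \<Longrightarrow> f \<in> tensor_class scale Vs f"
  using equiv_class_self[OF equiv_tensor_equiv] by (simp add: tensor_class_def)

lemma tensor_rep_mem:
  assumes "t \<in> tensor_product scale Vs"
  shows "tensor_rep t \<in> t" "tensor_rep t \<in> formal_tensors Vs" "tensor_class scale Vs (tensor_rep t) = t"
proof -
  obtain f where f: "f \<in> formal_tensors Vs" "t = tensor_equiv scale Vs `` {f}"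
    using assms by (auto simp: tensor_product_def quotient_def)
  then have "f \<in> t" using equiv_class_self[OF equiv_tensor_equiv] by blast
  then show r: "tensor_rep t \<in> t" unfolding tensor_rep_def by (rule someI)
  then have e: "(f, tensor_rep t) \<in> tensor_equiv scale Vs" using f by auto
  then show "tensor_rep t \<in> formal_tensors Vs" by (auto simp: tensor_equiv_def)
  show "tensor_class scale Vs (tensor_rep t) = t"
    using equiv_class_eq[OF equiv_tensor_equiv e] f by (simp add: tensor_class_def)
qed

abbreviation eval2 :: "('h \<Rightarrow> 'h \<Rightarrow> 'u) \<Rightarrow> 'h list \<Rightarrow> 'u" where
  "eval2 F \<equiv> \<lambda>xs. F (xs ! 0) (xs ! 1)"

text \<open>Converse to \<open>tensor_relations_kernel\<close> for two factors. With p a projection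
  whose kernel is exactly the relations, the map taking a, b to p (gen [a, b]) is bilinear, and its
  free extension is p itself on formal tensors; so agreement on this single test puts f - g into the
  relations. The target type of F is fixed because a hypothesis cannot quantify over types.\<close>

lemma tensor_class_eqI:
  fixes scale :: "'k::field \<Rightarrow> 'h::ab_group_add \<Rightarrow> 'h"
  assumes fg: "f \<in> formal_tensors [A, B]" "g \<in> formal_tensors [A, B]"
    and scl: "\<And>c x. x \<in> A \<Longrightarrow> scale c x \<in> A" "\<And>c x. x \<in> B \<Longrightarrow> scale c x \<in> B"
    and add: "\<And>x y. x \<in> A \<Longrightarrow> y \<in> A \<Longrightarrow> x + y \<in> A" "\<And>x y. x \<in> B \<Longrightarrow> y \<in> B \<Longrightarrow> x + y \<in> B"
    and eq: "\<And>F. bilinear_on scale free_scale A B UNIV F \<Longrightarrow>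
      free_extend free_scale (eval2 F) f = (free_extend free_scale (eval2 F) g :: 'h list \<Rightarrow>\<^sub>0 'k)"
  shows "tensor_class scale [A, B] f = tensor_class scale [A, B] g"
proof -
  interpret F: vector_space "free_scale :: 'k \<Rightarrow> ('h list \<Rightarrow>\<^sub>0 'k) \<Rightarrow> _"
    by (rule vector_space_free_scale)
  let ?R = "tensor_relations scale [A, B]"
  have R: "F.subspace ?R" unfolding tensor_relations_def by (rule F.subspace_span)
  obtain p :: "('h list \<Rightarrow>\<^sub>0 'k) \<Rightarrow> ('h list \<Rightarrow>\<^sub>0 'k)" where
    "linear_on free_scale free_scale UNIV UNIV p \<and> (\<forall>x. p x = 0 \<longleftrightarrow> x \<in> ?R)"
    by (rule exE[OF exists_projection_with_kernel[OF vector_space_free_scale R]])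
  then have p: "linear_on free_scale free_scale UNIV UNIV p" and ker: "\<And>x. p x = 0 \<longleftrightarrow> x \<in> ?R"
    by simp_all
  have padd: "p (x + y) = p x + p y" and pscl: "p (free_scale c x) = free_scale c (p x)" for x y c
    using p by (auto simp: linear_on_def)
  have pdiff: "p (x - y) = p x - p y" for x y
    using padd[of "x - y" y] by (simp add: algebra_simps)
  let ?F = "\<lambda>a b. p (gen [a, b])"
  have eqR: "p x = p y" if "x - y \<in> ?R" for x y
    using that by (simp add: ker[symmetric] pdiff)
  have gen_add: "gen (xs[i := u + v]) - (gen (xs[i := u]) + gen (xs[i := v])) \<in> ?R"
    if "xs \<in> listset [A, B]" "i < 2" "u \<in> [A, B] ! i" "v \<in> [A, B] ! i" for xs i u v
    unfolding tensor_relations_def diff_diff_add[symmetric]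
    by (rule F.span_base, rule UnI1, rule CollectI, intro exI, rule conjI[OF refl])
      (use that in \<open>simp del: listset.simps\<close>)
  have gen_scl: "gen (xs[i := scale c u]) - free_scale c (gen (xs[i := u])) \<in> ?R"
    if "xs \<in> listset [A, B]" "i < 2" "u \<in> [A, B] ! i" for xs i u c
    unfolding tensor_relations_def
    by (rule F.span_base, rule UnI2, rule CollectI, intro exI, rule conjI[OF refl])
      (use that in \<open>simp del: listset.simps\<close>)
  have "bilinear_on scale free_scale A B UNIV ?F"
    unfolding bilinear_on_def linear_on_def
  proof (intro conjI ballI allI UNIV_I)
    fix x y z c assume a: "x \<in> A" "y \<in> B" "z \<in> B"
    then have l: "[x, y] \<in> listset [A, B]" by (auto simp: set_Cons_def)
    show "?F x (y + z) = ?F x y + ?F x z"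
      using eqR[OF gen_add[OF l, of 1 y z]] a by (simp add: padd)
    show "?F x (scale c y) = free_scale c (?F x y)"
      using eqR[OF gen_scl[OF l, of 1 y c]] a by (simp add: pscl)
  next
    fix x y z c assume a: "y \<in> B" "x \<in> A" "z \<in> A"
    then have l: "[x, y] \<in> listset [A, B]" by (auto simp: set_Cons_def)
    show "?F (x + z) y = ?F x y + ?F z y"
      using eqR[OF gen_add[OF l, of 0 x z]] a by (simp add: padd)
    show "?F (scale c x) y = free_scale c (?F x y)"
      using eqR[OF gen_scl[OF l, of 0 x c]] a by (simp add: pscl)
  qed
  note eqF = eq[OF this]
  have pE: "free_extend free_scale (eval2 ?F) h = p h" if "h \<in> formal_tensors [A, B]" for h
  proof -
    have "free_extend free_scale (eval2 ?F) h = free_extend free_scale (\<lambda>xs. p (gen xs)) h"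
      using that
      by (intro free_extend_cong) (auto simp: formal_tensors_def listset_pair simp del: listset.simps)
    also have "\<dots> = p (free_extend free_scale gen h)"
      using linear_on_free_extend[OF vector_space_free_scale vector_space_free_scale F.subspace_UNIV p, of h gen]
      by simp
    finally show ?thesis by (simp add: free_extend_gen_id)
  qed
  have "p f = p g" using eqF pE fg by simp
  then have "f - g \<in> ?R" by (simp add: ker[symmetric] pdiff)
  then show ?thesis using tensor_class_eq_iff[OF fg] by blast
qed

section \<open>Sweedler calculus\<close>

text \<open>Isolates the data on which Sweedler sums depend, so that the two Hopf structures of a
  brace share one calculus.\<close>

locale coalgebra_family = vector_space scale
  for scale :: "'k::field \<Rightarrow> 'h::ab_group_add \<Rightarrow> 'h" +
  fixes H :: "'p \<Rightarrow> 'h set"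
    and \<Delta> :: "'p \<Rightarrow> 'h \<Rightarrow> ('h list \<Rightarrow>\<^sub>0 'k) set"
    and \<epsilon> :: "'p \<Rightarrow> 'h \<Rightarrow> 'k"
  assumes coalgebra: "\<And>\<alpha>. coalgebra scale (H \<alpha>) (\<Delta> \<alpha>) (\<epsilon> \<alpha>)"
begin

text \<open>Keeping the degree and the element visible, instead of only the tensor, gives rewrite
  rules access to the memberships in \<open>H \<alpha>\<close> that they have as premises.\<close>

definition sw :: "('k \<Rightarrow> 'u::ab_group_add \<Rightarrow> 'u) \<Rightarrow> 'p \<Rightarrow> 'h \<Rightarrow> ('h \<Rightarrow> 'h \<Rightarrow> 'u) \<Rightarrow> 'u" where
  "sw s \<alpha> x F = sweedler s (\<Delta> \<alpha> x) F"

text \<open>The target is \<open>UNIV\<close>, so that linearity and membership of the values are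
  separate side conditions.\<close>

definition lin :: "('k \<Rightarrow> 'u::ab_group_add \<Rightarrow> 'u) \<Rightarrow> 'p \<Rightarrow> ('h \<Rightarrow> 'u) \<Rightarrow> bool" where
  "lin s \<alpha> F \<longleftrightarrow> linear_on scale s (H \<alpha>) UNIV F"

lemma linI:
  assumes "\<And>x y. x \<in> H \<alpha> \<Longrightarrow> y \<in> H \<alpha> \<Longrightarrow> F (x + y) = F x + F y"
    and "\<And>c x. x \<in> H \<alpha> \<Longrightarrow> F (scale c x) = s c (F x)"
  shows "lin s \<alpha> F"
  using assms by (auto simp: lin_def linear_on_def)

lemma lin_add: "lin s \<alpha> F \<Longrightarrow> x \<in> H \<alpha> \<Longrightarrow> y \<in> H \<alpha> \<Longrightarrow> F (x + y) = F x + F y"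
  and lin_scale: "lin s \<alpha> F \<Longrightarrow> x \<in> H \<alpha> \<Longrightarrow> F (scale c x) = s c (F x)"
  by (auto simp: lin_def linear_on_def)

lemma subspace_H: "subspace (H \<alpha>)"
  using coalgebra.subspace_C[OF coalgebra] .

lemmas add_closed [simp] = subspace_add[OF subspace_H]
  and scale_closed [simp] = subspace_scale[OF subspace_H]

lemma \<Delta>_closed: "x \<in> H \<alpha> \<Longrightarrow> \<Delta> \<alpha> x \<in> tensor_product scale [H \<alpha>, H \<alpha>]"
  using coalgebra.comult_closed[OF coalgebra] .

lemma sw_eq_free_extend: "sw s \<alpha> x F = free_extend s (eval2 F) (tensor_rep (\<Delta> \<alpha> x))"
  by (simp add: sw_def sweedler_def)

lemma keys_comult:
  "x \<in> H \<alpha> \<Longrightarrow> b \<in> Poly_Mapping.keys (tensor_rep (\<Delta> \<alpha> x)) \<Longrightarrow>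
    \<exists>u v. b = [u, v] \<and> u \<in> H \<alpha> \<and> v \<in> H \<alpha>"
  using tensor_rep_mem(2)[OF \<Delta>_closed, of x \<alpha>] listset_pair[of "H \<alpha>" "H \<alpha>"]
  by (auto simp: formal_tensors_def simp del: listset.simps)

lemma keys_comult_nth:
  assumes "x \<in> H \<alpha>" "b \<in> Poly_Mapping.keys (tensor_rep (\<Delta> \<alpha> x))"
  shows "b ! 0 \<in> H \<alpha>" "b ! 1 \<in> H \<alpha>"
  using keys_comult[OF assms] by auto

text \<open>Guarding the memberships by an implication lets the simplifier use this as a congruence rule.\<close>

lemma sw_cong:
  assumes "x = y" "\<And>a b. (y \<in> H \<alpha> \<longrightarrow> a \<in> H \<alpha> \<and> b \<in> H \<alpha>) \<Longrightarrow> F a b = G a b"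
  shows "sw s \<alpha> x F = sw s \<alpha> y G"
  unfolding sw_eq_free_extend assms(1)
  by (rule free_extend_cong, rule assms(2)) (blast intro: keys_comult_nth)

text \<open>The sum of the representatives of \<Delta> x and \<Delta> y is some representative of
  \<Delta> (x + y), usually not the chosen one. Bilinearity of F makes the choice irrelevant; scalar
  multiples are handled alike.\<close>

lemma sw_linear:
  assumes s: "vector_space s"
    and F1: "\<And>a. a \<in> H \<alpha> \<Longrightarrow> lin s \<alpha> (F a)" and F2: "\<And>b. b \<in> H \<alpha> \<Longrightarrow> lin s \<alpha> (\<lambda>a. F a b)"
  shows "lin s \<alpha> (\<lambda>x. sw s \<alpha> x F)"
proof -
  interpret V: vector_space s by fact
  interpret C: coalgebra scale "H \<alpha>" "\<Delta> \<alpha>" "\<epsilon> \<alpha>" by (rule coalgebra)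
  interpret F: vector_space "free_scale :: 'k \<Rightarrow> ('h list \<Rightarrow>\<^sub>0 'k) \<Rightarrow> _"
    by (rule vector_space_free_scale)
  have bil: "bilinear_on scale s (H \<alpha>) (H \<alpha>) UNIV F"
    using F1 F2 by (auto simp: bilinear_on_def lin_def)
  have formal: "x \<in> H \<alpha> \<Longrightarrow> tensor_rep (\<Delta> \<alpha> x) \<in> formal_tensors [H \<alpha>, H \<alpha>]" for x
    using tensor_rep_mem(2)[OF \<Delta>_closed] .
  have key: "sw s \<alpha> x F = free_extend s (eval2 F) f"
    if "x \<in> H \<alpha>" "f \<in> formal_tensors [H \<alpha>, H \<alpha>]" "\<Delta> \<alpha> x = tensor_class scale [H \<alpha>, H \<alpha>] f" for x f
    unfolding sw_def
    by (rule sweedler_eq[OF s bil \<Delta>_closed[OF that(1)]], subst that(3), rule mem_tensor_class[OF that(2)])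
  show ?thesis
  proof (rule linI)
    fix x y assume xy: "x \<in> H \<alpha>" "y \<in> H \<alpha>"
    have "tensor_rep (\<Delta> \<alpha> x) + tensor_rep (\<Delta> \<alpha> y) \<in> formal_tensors [H \<alpha>, H \<alpha>]"
      using formal[OF xy(1)] formal[OF xy(2)]
      unfolding formal_tensors_def mem_Collect_eq by (rule order_trans[OF keys_add Un_least])
    from key[OF add_closed[OF xy] this C.comult_add[OF xy]]
    show "sw s \<alpha> (x + y) F = sw s \<alpha> x F + sw s \<alpha> y F"
      by (simp add: sw_eq_free_extend free_extend_add[OF s])
  next
    fix c x assume x: "x \<in> H \<alpha>"
    have "free_scale c (tensor_rep (\<Delta> \<alpha> x)) \<in> formal_tensors [H \<alpha>, H \<alpha>]"
      using formal[OF x] unfolding formal_tensors_def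
      by (simp add: in_keys_iff subset_iff del: listset.simps)
    from key[OF scale_closed[OF x] this C.comult_scale[OF x]]
    show "sw s \<alpha> (scale c x) F = s c (sw s \<alpha> x F)"
      by (simp add: sw_eq_free_extend free_extend_scale[OF s])
  qed
qed

lemma lin_id: "lin scale \<alpha> (\<lambda>x. x)"
  by (rule linI) auto

lemma lin_comp:
  assumes "lin scale \<beta> g" "\<And>x. x \<in> H \<beta> \<Longrightarrow> g x \<in> H \<alpha>" "lin s \<alpha> F"
  shows "lin s \<beta> (\<lambda>x. F (g x))"
  using assms(2)
  by (intro linI) (simp_all add: lin_add[OF assms(1)] lin_scale[OF assms(1)] lin_add[OF assms(3)] lin_scale[OF assms(3)])

lemma lin_sw_arg:
  assumes "vector_space s" "lin scale \<beta> g" "\<And>x. x \<in> H \<beta> \<Longrightarrow> g x \<in> H \<alpha>"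
    and "\<And>a. a \<in> H \<alpha> \<Longrightarrow> lin s \<alpha> (F a)" "\<And>b. b \<in> H \<alpha> \<Longrightarrow> lin s \<alpha> (\<lambda>a. F a b)"
  shows "lin s \<beta> (\<lambda>x. sw s \<alpha> (g x) F)"
  using assms by (intro lin_comp[OF assms(2), of \<alpha> s "\<lambda>x. sw s \<alpha> x F"] sw_linear)

text \<open>Here the tensor stays fixed and only the summand varies, so linearity is checked term by
  term.\<close>

lemma lin_sw:
  assumes "vector_space s" "c \<in> H \<alpha>"
    and "\<And>a b. a \<in> H \<alpha> \<Longrightarrow> b \<in> H \<alpha> \<Longrightarrow> lin s \<beta> (\<lambda>x. F x a b)"
  shows "lin s \<beta> (\<lambda>x. sw s \<alpha> c (F x))"
proof -
  interpret V: vector_space s by fact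
  note F = assms(3)[OF keys_comult_nth[OF assms(2)]]
  show ?thesis
    by (rule linI; unfold sw_eq_free_extend free_extend_def)
      (simp_all add: lin_add[OF F] lin_scale[OF F] V.scale_right_distrib sum.distrib V.scale_sum_right mult.commute
        del: One_nat_def)
qed

lemma lin_scale_const:
  assumes "vector_space s" "lin s \<alpha> F"
  shows "lin s \<alpha> (\<lambda>x. s c (F x))"
proof -
  interpret V: vector_space s by fact
  show ?thesis
    by (rule linI) (simp_all add: lin_add[OF assms(2)] lin_scale[OF assms(2)] V.scale_right_distrib mult.commute)
qed

lemma counit_add [simp]: "x \<in> H \<alpha> \<Longrightarrow> y \<in> H \<alpha> \<Longrightarrow> \<epsilon> \<alpha> (x + y) = \<epsilon> \<alpha> x + \<epsilon> \<alpha> y"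
  and counit_scale [simp]: "x \<in> H \<alpha> \<Longrightarrow> \<epsilon> \<alpha> (scale c x) = c * \<epsilon> \<alpha> x"
  using coalgebra.counit_linear[OF coalgebra, of \<alpha>] by (auto simp: linear_on_def)

lemma lin_counit:
  assumes "vector_space s" "lin scale \<beta> g" "\<And>x. x \<in> H \<beta> \<Longrightarrow> g x \<in> H \<alpha>"
  shows "lin s \<beta> (\<lambda>x. s (\<epsilon> \<alpha> (g x)) y)"
proof -
  interpret V: vector_space s by fact
  show ?thesis
    by (rule linI) (simp_all add: assms(3) lin_add[OF assms(2)] lin_scale[OF assms(2)] V.scale_left_distrib)
qed

text \<open>Both sides are finite double sums over the same two chosen representatives, so F may be
  arbitrary.\<close>

lemma sw_swap:
  "vector_space s \<Longrightarrow> sw s \<alpha> x (\<lambda>a b. sw s \<beta> y (\<lambda>c d. F a b c d)) = sw s \<beta> y (\<lambda>c d. sw s \<alpha> x (\<lambda>a b. F a b c d))"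
  unfolding sw_eq_free_extend by (rule free_extend_swap)

lemma sw_pull:
  assumes "vector_space s" "lin s \<beta> g" "x \<in> H \<alpha>" "\<And>a b. a \<in> H \<alpha> \<Longrightarrow> b \<in> H \<alpha> \<Longrightarrow> F a b \<in> H \<beta>"
  shows "g (sw scale \<alpha> x F) = sw s \<alpha> x (\<lambda>a b. g (F a b))"
  unfolding sw_eq_free_extend
  by (rule linear_on_free_extend[OF vector_space_axioms assms(1) subspace_H assms(2)[unfolded lin_def]])
    (intro assms(4) keys_comult_nth[OF assms(3)])

lemma sw_closed:
  assumes "x \<in> H \<alpha>" "\<And>a b. a \<in> H \<alpha> \<Longrightarrow> b \<in> H \<alpha> \<Longrightarrow> F a b \<in> H \<beta>"
  shows "sw scale \<alpha> x F \<in> H \<beta>"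
  unfolding sw_eq_free_extend
  by (rule free_extend_mem[OF vector_space_axioms subspace_H])
    (intro assms(2) keys_comult_nth[OF assms(1)])

lemma sw_pull_general:
  assumes "vector_space s" "vector_space s'" "linear_on s s' UNIV UNIV g"
  shows "g (sw s \<alpha> x F) = sw s' \<alpha> x (\<lambda>a b. g (F a b))"
proof -
  interpret V: vector_space s by fact
  show ?thesis
    unfolding sw_eq_free_extend
    by (rule linear_on_free_extend[OF assms(1,2) V.subspace_UNIV assms(3)]) simp
qed

lemma sw_scale:
  assumes "vector_space s"
  shows "sw s \<alpha> x (\<lambda>a b. s c (F a b)) = s c (sw s \<alpha> x F)"
proof -
  interpret V: vector_space s by fact
  show ?thesis
    by (rule sw_pull_general[OF assms assms, symmetric]) (simp add: linear_on_def V.scale_right_distrib mult.commute)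
qed

lemma sw_sw_arg:
  assumes "vector_space s" "x \<in> H \<alpha>" "\<And>a b. a \<in> H \<alpha> \<Longrightarrow> b \<in> H \<alpha> \<Longrightarrow> F a b \<in> H \<beta>"
    and "\<And>a. a \<in> H \<beta> \<Longrightarrow> lin s \<beta> (G a)" "\<And>b. b \<in> H \<beta> \<Longrightarrow> lin s \<beta> (\<lambda>a. G a b)"
  shows "sw s \<beta> (sw scale \<alpha> x F) G = sw s \<alpha> x (\<lambda>a b. sw s \<beta> (F a b) G)"
  by (rule sw_pull[OF assms(1) sw_linear assms(2,3)]) (use assms in auto)

lemma sw_scale_arg:
  assumes "vector_space s" "x \<in> H \<alpha>"
    and "\<And>a. a \<in> H \<alpha> \<Longrightarrow> lin s \<alpha> (G a)" "\<And>b. b \<in> H \<alpha> \<Longrightarrow> lin s \<alpha> (\<lambda>a. G a b)"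
  shows "sw s \<alpha> (scale c x) G = s c (sw s \<alpha> x G)"
  by (rule lin_scale[OF sw_linear]) (use assms in auto)

lemma counit_left:
  assumes "vector_space s" "lin s \<alpha> F" "x \<in> H \<alpha>"
  shows "sw s \<alpha> x (\<lambda>a b. s (\<epsilon> \<alpha> a) (F b)) = F x"
proof -
  have "F x = F (sw scale \<alpha> x (\<lambda>a b. scale (\<epsilon> \<alpha> a) b))"
    using coalgebra.counit_left[OF coalgebra assms(3)] by (simp add: sw_def)
  also have "\<dots> = sw s \<alpha> x (\<lambda>a b. F (scale (\<epsilon> \<alpha> a) b))"
    by (rule sw_pull) (use assms in auto)
  also have "\<dots> = sw s \<alpha> x (\<lambda>a b. s (\<epsilon> \<alpha> a) (F b))"
    by (rule sw_cong[OF refl]) (simp add: assms(3) lin_scale[OF assms(2)])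
  finally show ?thesis by simp
qed

lemma counit_right:
  assumes "vector_space s" "lin s \<alpha> F" "x \<in> H \<alpha>"
  shows "sw s \<alpha> x (\<lambda>a b. s (\<epsilon> \<alpha> b) (F a)) = F x"
proof -
  have "F x = F (sw scale \<alpha> x (\<lambda>a b. scale (\<epsilon> \<alpha> b) a))"
    using coalgebra.counit_right[OF coalgebra assms(3)] by (simp add: sw_def)
  also have "\<dots> = sw s \<alpha> x (\<lambda>a b. F (scale (\<epsilon> \<alpha> b) a))"
    by (rule sw_pull) (use assms in auto)
  also have "\<dots> = sw s \<alpha> x (\<lambda>a b. s (\<epsilon> \<alpha> b) (F a))"
    by (rule sw_cong[OF refl]) (simp add: assms(3) lin_scale[OF assms(2)])
  finally show ?thesis by simp
qed

lemma linear_on_free_extend_fun: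
  "vector_space s \<Longrightarrow> linear_on free_scale s UNIV UNIV (free_extend s \<phi>)"
  by (simp add: linear_on_def free_extend_add free_extend_scale)

lemma sw_free_closed:
  assumes "x \<in> H \<alpha>" "\<And>a b. a \<in> H \<alpha> \<Longrightarrow> b \<in> H \<alpha> \<Longrightarrow> F a b \<in> formal_tensors Vs"
  shows "sw free_scale \<alpha> x F \<in> formal_tensors Vs"
  unfolding sw_eq_free_extend
  by (rule free_extend_formal) (intro assms(2) keys_comult_nth[OF assms(1)])

text \<open>The coalgebra axiom says that two formal tensors differ by a relation of the threefold
  tensor product. The free extension of the trilinear map F kills that difference, and it commutes
  with the Sweedler sums that form the two tensors.\<close>

lemma coassoc:
  assumes s: "vector_space s" and x: "x \<in> H \<alpha>"
    and F1: "\<And>b c. b \<in> H \<alpha> \<Longrightarrow> c \<in> H \<alpha> \<Longrightarrow> lin s \<alpha> (\<lambda>a. F a b c)"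
    and F2: "\<And>a c. a \<in> H \<alpha> \<Longrightarrow> c \<in> H \<alpha> \<Longrightarrow> lin s \<alpha> (\<lambda>b. F a b c)"
    and F3: "\<And>a b. a \<in> H \<alpha> \<Longrightarrow> b \<in> H \<alpha> \<Longrightarrow> lin s \<alpha> (\<lambda>c. F a b c)"
  shows "sw s \<alpha> x (\<lambda>a b. sw s \<alpha> a (\<lambda>a1 a2. F a1 a2 b)) = sw s \<alpha> x (\<lambda>a b. sw s \<alpha> b (\<lambda>b1 b2. F a b1 b2))"
proof -
  interpret V: vector_space s by fact
  let ?Vs = "[H \<alpha>, H \<alpha>, H \<alpha>]"
  let ?\<phi> = "\<lambda>xs. F (xs ! 0) (xs ! 1) (xs ! 2)"
  let ?L = "sw free_scale \<alpha> x (\<lambda>a b. sw free_scale \<alpha> a (\<lambda>a1 a2. gen [a1, a2, b]))"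
  let ?R = "sw free_scale \<alpha> x (\<lambda>a b. sw free_scale \<alpha> b (\<lambda>b1 b2. gen [a, b1, b2]))"
  note v = vector_space_free_scale
  have formal: "gen [a, b, c] \<in> formal_tensors ?Vs" if "a \<in> H \<alpha>" "b \<in> H \<alpha>" "c \<in> H \<alpha>" for a b c
    using that by (auto simp: formal_tensors_def set_Cons_def)
  have "?L \<in> formal_tensors ?Vs" "?R \<in> formal_tensors ?Vs"
    by (intro sw_free_closed formal x; assumption)+
  then have d: "?L - ?R \<in> tensor_relations scale ?Vs"
    using coalgebra.coassoc[OF coalgebra x] by (simp add: sw_def tensor_class_eq_iff del: listset.simps)
  have "free_extend s ?\<phi> (?L - ?R) = 0"
  proof (rule tensor_relations_kernel[OF s _ _ d])
    fix xs :: "'h list" and i u v c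
    assume xs: "xs \<in> listset ?Vs" and "i < length ?Vs" and u: "u \<in> ?Vs ! i"
    then have i: "i = 0 \<or> i = 1 \<or> i = 2" by auto
    obtain p q r where pqr: "xs = [p, q, r]" "p \<in> H \<alpha>" "q \<in> H \<alpha>" "r \<in> H \<alpha>"
      using xs by (auto simp: set_Cons_def)
    have u': "u \<in> H \<alpha>" using u i by auto
    show "?\<phi> (xs[i := scale c u]) = s c (?\<phi> (xs[i := u]))"
      using i pqr u' lin_scale[OF F1] lin_scale[OF F2] lin_scale[OF F3] by auto
    assume "v \<in> ?Vs ! i"
    then have v': "v \<in> H \<alpha>" using i by auto
    show "?\<phi> (xs[i := u + v]) = ?\<phi> (xs[i := u]) + ?\<phi> (xs[i := v])"
      using i pqr u' v' lin_add[OF F1] lin_add[OF F2] lin_add[OF F3] by auto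
  qed
  then have "free_extend s ?\<phi> ?L = free_extend s ?\<phi> ?R"
    by (simp add: free_extend_diff[OF s])
  then show ?thesis
    by (simp add: sw_pull_general[OF v s linear_on_free_extend_fun[OF s]] free_extend_gen[OF s])
qed

lemma sw_grouplike:
  assumes s: "vector_space s" and x: "x \<in> H \<alpha>" and \<Delta>x: "\<Delta> \<alpha> x = tensor_class scale [H \<alpha>, H \<alpha>] (gen [x, x])"
    and F1: "\<And>a. a \<in> H \<alpha> \<Longrightarrow> lin s \<alpha> (F a)" and F2: "\<And>b. b \<in> H \<alpha> \<Longrightarrow> lin s \<alpha> (\<lambda>a. F a b)"
  shows "sw s \<alpha> x F = F x x"
proof -
  have bil: "bilinear_on scale s (H \<alpha>) (H \<alpha>) UNIV F"
    using F1 F2 by (auto simp: bilinear_on_def lin_def)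
  have "gen [x, x] \<in> formal_tensors [H \<alpha>, H \<alpha>]" using x by (auto simp: formal_tensors_def set_Cons_def)
  from mem_tensor_class[OF this, of scale] sweedler_eq[OF s bil \<Delta>_closed[OF x], of "gen [x, x]"]
  show ?thesis by (simp add: sw_def \<Delta>x free_extend_gen[OF s])
qed

text \<open>The double sum of generators on the right of the coalgebra map axiom is itself a
  representative of \<Delta> (f x y), so the Sweedler sum may be evaluated on it.\<close>

lemma sw_coalgebra_map2:
  assumes f: "coalgebra_map2 scale (H \<alpha>) (\<Delta> \<alpha>) (\<epsilon> \<alpha>) (H \<beta>) (\<Delta> \<beta>) (\<epsilon> \<beta>) (H \<gamma>) (\<Delta> \<gamma>) (\<epsilon> \<gamma>) f"
    and s: "vector_space s" and xy: "x \<in> H \<alpha>" "y \<in> H \<beta>"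
    and F1: "\<And>a. a \<in> H \<gamma> \<Longrightarrow> lin s \<gamma> (F a)" and F2: "\<And>b. b \<in> H \<gamma> \<Longrightarrow> lin s \<gamma> (\<lambda>a. F a b)"
  shows "sw s \<gamma> (f x y) F = sw s \<alpha> x (\<lambda>x1 x2. sw s \<beta> y (\<lambda>y1 y2. F (f x1 y1) (f x2 y2)))"
proof -
  have bil: "bilinear_on scale s (H \<gamma>) (H \<gamma>) UNIV F"
    using F1 F2 by (auto simp: bilinear_on_def lin_def)
  have fc: "f a b \<in> H \<gamma>" if "a \<in> H \<alpha>" "b \<in> H \<beta>" for a b
    using f that by (auto simp: coalgebra_map2_def bilinear_on_def linear_on_def)
  let ?f = "sw free_scale \<alpha> x (\<lambda>x1 x2. sw free_scale \<beta> y (\<lambda>y1 y2. gen [f x1 y1, f x2 y2]))"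
  have "?f \<in> formal_tensors [H \<gamma>, H \<gamma>]"
    by (intro sw_free_closed xy) (auto simp: formal_tensors_def set_Cons_def fc)
  from mem_tensor_class[OF this, of scale]
  have "?f \<in> \<Delta> \<gamma> (f x y)"
    using f xy by (simp add: coalgebra_map2_def sw_def)
  from sweedler_eq[OF s bil \<Delta>_closed[OF fc[OF xy]] this]
  have "sw s \<gamma> (f x y) F = free_extend s (eval2 F) ?f" by (simp add: sw_def)
  then show ?thesis
    by (simp add: sw_pull_general[OF vector_space_free_scale s linear_on_free_extend_fun[OF s]] free_extend_gen[OF s])
qed

lemma sw_cocommutative:
  assumes co: "cocommutative scale (H \<alpha>) (\<Delta> \<alpha>)"
    and s: "vector_space s" and x: "x \<in> H \<alpha>"
    and F1: "\<And>a. a \<in> H \<alpha> \<Longrightarrow> lin s \<alpha> (F a)" and F2: "\<And>b. b \<in> H \<alpha> \<Longrightarrow> lin s \<alpha> (\<lambda>a. F a b)"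
  shows "sw s \<alpha> x F = sw s \<alpha> x (\<lambda>a b. F b a)"
proof -
  have bil: "bilinear_on scale s (H \<alpha>) (H \<alpha>) UNIV F"
    using F1 F2 by (auto simp: bilinear_on_def lin_def)
  let ?f = "sw free_scale \<alpha> x (\<lambda>a b. gen [b, a])"
  have "?f \<in> formal_tensors [H \<alpha>, H \<alpha>]"
    by (intro sw_free_closed x) (auto simp: formal_tensors_def set_Cons_def)
  from mem_tensor_class[OF this, of scale]
  have "?f \<in> \<Delta> \<alpha> x"
    using co x by (simp add: cocommutative_def sw_def)
  from sweedler_eq[OF s bil \<Delta>_closed[OF x] this]
  have "sw s \<alpha> x F = free_extend s (eval2 F) ?f" by (simp add: sw_def)
  then show ?thesis
    by (simp add: sw_pull_general[OF vector_space_free_scale s linear_on_free_extend_fun[OF s]] free_extend_gen[OF s])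
qed

text \<open>
  It suffices to test against bilinear maps into the free space: the projection along the tensor
  relations, applied to generators, is one of them.
\<close>

lemma coalgebra_map2I:
  assumes bil: "bilinear_on scale scale (H \<alpha>) (H \<beta>) (H \<gamma>) f"
    and eps: "\<And>x y. x \<in> H \<alpha> \<Longrightarrow> y \<in> H \<beta> \<Longrightarrow> \<epsilon> \<gamma> (f x y) = \<epsilon> \<alpha> x * \<epsilon> \<beta> y"
    and comult: "\<And>x y (F :: 'h \<Rightarrow> 'h \<Rightarrow> ('h list \<Rightarrow>\<^sub>0 'k)). x \<in> H \<alpha> \<Longrightarrow> y \<in> H \<beta> \<Longrightarrow>
      (\<And>a. a \<in> H \<gamma> \<Longrightarrow> lin free_scale \<gamma> (F a)) \<Longrightarrow> (\<And>b. b \<in> H \<gamma> \<Longrightarrow> lin free_scale \<gamma> (\<lambda>a. F a b)) \<Longrightarrow>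
      sw free_scale \<gamma> (f x y) F =
      sw free_scale \<alpha> x (\<lambda>x1 x2. sw free_scale \<beta> y (\<lambda>y1 y2. F (f x1 y1) (f x2 y2)))"
  shows "coalgebra_map2 scale (H \<alpha>) (\<Delta> \<alpha>) (\<epsilon> \<alpha>) (H \<beta>) (\<Delta> \<beta>) (\<epsilon> \<beta>) (H \<gamma>) (\<Delta> \<gamma>) (\<epsilon> \<gamma>) f"
  unfolding coalgebra_map2_def
proof (intro conjI ballI bil)
  fix x y assume xy: "x \<in> H \<alpha>" "y \<in> H \<beta>"
  then show "\<epsilon> \<gamma> (f x y) = \<epsilon> \<alpha> x * \<epsilon> \<beta> y" by (rule eps)
  have fc: "f a b \<in> H \<gamma>" if "a \<in> H \<alpha>" "b \<in> H \<beta>" for a b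
    using bil that by (auto simp: bilinear_on_def linear_on_def)
  let ?f = "sw free_scale \<alpha> x (\<lambda>x1 x2. sw free_scale \<beta> y (\<lambda>y1 y2. gen [f x1 y1, f x2 y2]))"
  note v = vector_space_free_scale
  note r = tensor_rep_mem[OF \<Delta>_closed[OF fc[OF xy]]]
  have "tensor_class scale [H \<gamma>, H \<gamma>] (tensor_rep (\<Delta> \<gamma> (f x y))) = tensor_class scale [H \<gamma>, H \<gamma>] ?f"
  proof (rule tensor_class_eqI)
    show "tensor_rep (\<Delta> \<gamma> (f x y)) \<in> formal_tensors [H \<gamma>, H \<gamma>]" by (rule r)
    show "?f \<in> formal_tensors [H \<gamma>, H \<gamma>]"
      by (intro sw_free_closed xy) (auto simp: formal_tensors_def set_Cons_def fc)
    fix F :: "'h \<Rightarrow> 'h \<Rightarrow> ('h list \<Rightarrow>\<^sub>0 'k)"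
    assume F: "bilinear_on scale free_scale (H \<gamma>) (H \<gamma>) UNIV F"
    have "free_extend free_scale (eval2 F) (tensor_rep (\<Delta> \<gamma> (f x y))) = sw free_scale \<gamma> (f x y) F"
      by (simp add: sw_eq_free_extend)
    also have "\<dots> = sw free_scale \<alpha> x (\<lambda>x1 x2. sw free_scale \<beta> y (\<lambda>y1 y2. F (f x1 y1) (f x2 y2)))"
      by (rule comult[OF xy]) (use F in \<open>auto simp: bilinear_on_def lin_def\<close>)
    also have "\<dots> = free_extend free_scale (eval2 F) ?f"
      by (simp add: sw_pull_general[OF v v linear_on_free_extend_fun[OF v]] free_extend_gen[OF v])
    finally show "free_extend free_scale (eval2 F) (tensor_rep (\<Delta> \<gamma> (f x y))) = free_extend free_scale (eval2 F) ?f" .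
  qed auto
  then show "\<Delta> \<gamma> (f x y) = tensor_class scale [H \<gamma>, H \<gamma>]
      (sweedler free_scale (\<Delta> \<alpha> x) (\<lambda>x1 x2. sweedler free_scale (\<Delta> \<beta> y) (\<lambda>y1 y2. gen [f x1 y1, f x2 y2])))"
    using r(3) by (simp add: sw_def)
qed

lemma bilinear_onI:
  assumes "\<And>x y. x \<in> H \<alpha> \<Longrightarrow> y \<in> H \<beta> \<Longrightarrow> f x y \<in> H \<gamma>"
    and "\<And>x. x \<in> H \<alpha> \<Longrightarrow> lin scale \<beta> (f x)" "\<And>y. y \<in> H \<beta> \<Longrightarrow> lin scale \<alpha> (\<lambda>x. f x y)"
  shows "bilinear_on scale scale (H \<alpha>) (H \<beta>) (H \<gamma>) f"
  using assms by (auto simp: bilinear_on_def lin_def linear_on_def)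

end

section \<open>Sweedler rules for structure maps\<close>

context coalgebra_family
begin

lemma vector_spaces [simp]: "vector_space scale" "vector_space (free_scale :: 'k \<Rightarrow> ('b \<Rightarrow>\<^sub>0 'k) \<Rightarrow> _)"
  by (rule vector_space_axioms vector_space_free_scale)+

declare sw_cong [cong] lin_id [simp]

text \<open>Two target spaces suffice for these simp rules: the ambient space for identities between
  elements and a free space for identities between tensors. Fixing s makes the premise
  \<open>vector_space s\<close> immediate for simp.\<close>

lemmas lin_rules [simp] =
  lin_sw_arg[where s = scale] lin_sw_arg[where s = free_scale]
  lin_sw[where s = scale] lin_sw[where s = free_scale]
  lin_scale_const[where s = scale] lin_scale_const[where s = free_scale]
  lin_counit[where s = scale] lin_counit[where s = free_scale]

lemmas sw_rules [simp] =
  sw_closed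
  sw_scale[where s = scale] sw_scale[where s = free_scale]
  sw_sw_arg[where s = scale] sw_sw_arg[where s = free_scale]
  sw_scale_arg[where s = scale] sw_scale_arg[where s = free_scale]
  counit_left[where s = scale] counit_left[where s = free_scale]
  counit_right[where s = scale] counit_right[where s = free_scale]

lemma vector_space_times [simp]: "vector_space ((*) :: 'k \<Rightarrow> 'k \<Rightarrow> 'k)"
  by unfold_locales (auto simp: algebra_simps)

lemma counit_sw [simp]:
  assumes "x \<in> H \<alpha>" "\<And>a b. a \<in> H \<alpha> \<Longrightarrow> b \<in> H \<alpha> \<Longrightarrow> F a b \<in> H \<beta>"
  shows "\<epsilon> \<beta> (sw scale \<alpha> x F) = sw (*) \<alpha> x (\<lambda>a b. \<epsilon> \<beta> (F a b))"
  by (rule sw_pull[OF vector_space_times _ assms]) (rule linI; simp)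

lemma counit_counit [simp]:
  assumes "x \<in> H \<alpha>"
  shows "sw (*) \<alpha> x (\<lambda>a b. \<epsilon> \<alpha> a * \<epsilon> \<alpha> b) = \<epsilon> \<alpha> x"
  by (rule counit_left[OF vector_space_times _ assms]) (rule linI; simp)

lemma linear_rules:
  assumes "linear_on scale scale (H \<alpha>) (H \<beta>) f"
  shows "\<And>x. x \<in> H \<alpha> \<Longrightarrow> f x \<in> H \<beta>"
    and "\<And>\<delta> g. lin scale \<delta> g \<Longrightarrow> (\<And>x. x \<in> H \<delta> \<Longrightarrow> g x \<in> H \<alpha>) \<Longrightarrow> lin scale \<delta> (\<lambda>x. f (g x))"
    and "\<And>c x. x \<in> H \<alpha> \<Longrightarrow> f (scale c x) = scale c (f x)"
    and "\<And>\<delta> x F. x \<in> H \<delta> \<Longrightarrow> (\<And>a b. a \<in> H \<delta> \<Longrightarrow> b \<in> H \<delta> \<Longrightarrow> F a b \<in> H \<alpha>) \<Longrightarrow>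
      f (sw scale \<delta> x F) = sw scale \<delta> x (\<lambda>a b. f (F a b))"
proof -
  have l: "lin scale \<alpha> f" using assms by (auto simp: lin_def linear_on_def)
  show "\<And>x. x \<in> H \<alpha> \<Longrightarrow> f x \<in> H \<beta>" using assms by (auto simp: linear_on_def)
  show "\<And>\<delta> g. lin scale \<delta> g \<Longrightarrow> (\<And>x. x \<in> H \<delta> \<Longrightarrow> g x \<in> H \<alpha>) \<Longrightarrow> lin scale \<delta> (\<lambda>x. f (g x))"
    by (rule lin_comp[OF _ _ l])
  show "\<And>c x. x \<in> H \<alpha> \<Longrightarrow> f (scale c x) = scale c (f x)" by (rule lin_scale[OF l])
  show "\<And>\<delta> x F. x \<in> H \<delta> \<Longrightarrow> (\<And>a b. a \<in> H \<delta> \<Longrightarrow> b \<in> H \<delta> \<Longrightarrow> F a b \<in> H \<alpha>) \<Longrightarrow>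
      f (sw scale \<delta> x F) = sw scale \<delta> x (\<lambda>a b. f (F a b))"
    by (rule sw_pull[OF vector_space_axioms l])
qed

text \<open>Instantiated for each bilinear structure map, this bundle makes it a pure simp step to
  expand a nested expression into iterated Sweedler sums.\<close>

lemma bilinear_rules:
  assumes "bilinear_on scale scale (H \<alpha>) (H \<beta>) (H \<gamma>) f"
  shows "\<And>x y. x \<in> H \<alpha> \<Longrightarrow> y \<in> H \<beta> \<Longrightarrow> f x y \<in> H \<gamma>"
    and "\<And>\<delta> g c. lin scale \<delta> g \<Longrightarrow> (\<And>x. x \<in> H \<delta> \<Longrightarrow> g x \<in> H \<alpha>) \<Longrightarrow> c \<in> H \<beta> \<Longrightarrow> lin scale \<delta> (\<lambda>x. f (g x) c)"
    and "\<And>\<delta> g c. lin scale \<delta> g \<Longrightarrow> (\<And>x. x \<in> H \<delta> \<Longrightarrow> g x \<in> H \<beta>) \<Longrightarrow> c \<in> H \<alpha> \<Longrightarrow> lin scale \<delta> (\<lambda>x. f c (g x))"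
    and "\<And>c x y. x \<in> H \<alpha> \<Longrightarrow> y \<in> H \<beta> \<Longrightarrow> f (scale c x) y = scale c (f x y)"
    and "\<And>c x y. x \<in> H \<alpha> \<Longrightarrow> y \<in> H \<beta> \<Longrightarrow> f x (scale c y) = scale c (f x y)"
    and "\<And>\<delta> x y F. x \<in> H \<delta> \<Longrightarrow> (\<And>a b. a \<in> H \<delta> \<Longrightarrow> b \<in> H \<delta> \<Longrightarrow> F a b \<in> H \<alpha>) \<Longrightarrow> y \<in> H \<beta> \<Longrightarrow>
      f (sw scale \<delta> x F) y = sw scale \<delta> x (\<lambda>a b. f (F a b) y)"
    and "\<And>\<delta> x y F. x \<in> H \<delta> \<Longrightarrow> (\<And>a b. a \<in> H \<delta> \<Longrightarrow> b \<in> H \<delta> \<Longrightarrow> F a b \<in> H \<beta>) \<Longrightarrow> y \<in> H \<alpha> \<Longrightarrow>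
      f y (sw scale \<delta> x F) = sw scale \<delta> x (\<lambda>a b. f y (F a b))"
proof -
  have 1: "linear_on scale scale (H \<alpha>) (H \<gamma>) (\<lambda>x. f x y)" if "y \<in> H \<beta>" for y
    using assms that by (auto simp: bilinear_on_def)
  have 2: "linear_on scale scale (H \<beta>) (H \<gamma>) (f x)" if "x \<in> H \<alpha>" for x
    using assms that by (auto simp: bilinear_on_def)
  show "\<And>x y. x \<in> H \<alpha> \<Longrightarrow> y \<in> H \<beta> \<Longrightarrow> f x y \<in> H \<gamma>" by (rule linear_rules(1)[OF 2])
  show "\<And>\<delta> g c. lin scale \<delta> g \<Longrightarrow> (\<And>x. x \<in> H \<delta> \<Longrightarrow> g x \<in> H \<alpha>) \<Longrightarrow> c \<in> H \<beta> \<Longrightarrow> lin scale \<delta> (\<lambda>x. f (g x) c)"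
    by (rule linear_rules(2)[OF 1])
  show "\<And>\<delta> g c. lin scale \<delta> g \<Longrightarrow> (\<And>x. x \<in> H \<delta> \<Longrightarrow> g x \<in> H \<beta>) \<Longrightarrow> c \<in> H \<alpha> \<Longrightarrow> lin scale \<delta> (\<lambda>x. f c (g x))"
    by (rule linear_rules(2)[OF 2])
  show "\<And>c x y. x \<in> H \<alpha> \<Longrightarrow> y \<in> H \<beta> \<Longrightarrow> f (scale c x) y = scale c (f x y)"
    by (rule linear_rules(3)[OF 1])
  show "\<And>c x y. x \<in> H \<alpha> \<Longrightarrow> y \<in> H \<beta> \<Longrightarrow> f x (scale c y) = scale c (f x y)"
    by (rule linear_rules(3)[OF 2])
  show "\<And>\<delta> x y F. x \<in> H \<delta> \<Longrightarrow> (\<And>a b. a \<in> H \<delta> \<Longrightarrow> b \<in> H \<delta> \<Longrightarrow> F a b \<in> H \<alpha>) \<Longrightarrow> y \<in> H \<beta> \<Longrightarrow>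
      f (sw scale \<delta> x F) y = sw scale \<delta> x (\<lambda>a b. f (F a b) y)"
    by (rule linear_rules(4)[OF 1])
  show "\<And>\<delta> x y F. x \<in> H \<delta> \<Longrightarrow> (\<And>a b. a \<in> H \<delta> \<Longrightarrow> b \<in> H \<delta> \<Longrightarrow> F a b \<in> H \<beta>) \<Longrightarrow> y \<in> H \<alpha> \<Longrightarrow>
      f y (sw scale \<delta> x F) = sw scale \<delta> x (\<lambda>a b. f y (F a b))"
    by (rule linear_rules(4)[OF 2])
qed

text \<open>Coassociativity regroups the first two of three factors into one comultiplication, where
  cocommutativity swaps them.\<close>

lemma sw_exchange:
  assumes co: "cocommutative scale (H \<alpha>) (\<Delta> \<alpha>)"
    and s: "vector_space s" and x: "x \<in> H \<alpha>"
    and F1: "\<And>b c. b \<in> H \<alpha> \<Longrightarrow> c \<in> H \<alpha> \<Longrightarrow> lin s \<alpha> (\<lambda>a. F a b c)"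
    and F2: "\<And>a c. a \<in> H \<alpha> \<Longrightarrow> c \<in> H \<alpha> \<Longrightarrow> lin s \<alpha> (\<lambda>b. F a b c)"
    and F3: "\<And>a b. a \<in> H \<alpha> \<Longrightarrow> b \<in> H \<alpha> \<Longrightarrow> lin s \<alpha> (\<lambda>c. F a b c)"
  shows "sw s \<alpha> x (\<lambda>a r. sw s \<alpha> r (\<lambda>b c. F a b c)) = sw s \<alpha> x (\<lambda>a r. sw s \<alpha> r (\<lambda>b c. F b a c))"
proof -
  have "sw s \<alpha> x (\<lambda>a r. sw s \<alpha> r (\<lambda>b c. F a b c)) = sw s \<alpha> x (\<lambda>r c. sw s \<alpha> r (\<lambda>a b. F a b c))"
    by (rule coassoc[symmetric]) (simp_all add: s x F1 F2 F3)
  also have "\<dots> = sw s \<alpha> x (\<lambda>r c. sw s \<alpha> r (\<lambda>a b. F b a c))"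
    by (rule sw_cong[OF refl], rule sw_cocommutative[OF co s]) (use x in \<open>simp_all add: F1 F2\<close>)
  also have "\<dots> = sw s \<alpha> x (\<lambda>a r. sw s \<alpha> r (\<lambda>b c. F b a c))"
    by (rule coassoc) (simp_all add: s x F1 F2 F3)
  finally show ?thesis .
qed

text \<open>Splitting off the first factor by coassociativity leaves three factors, of which
  \<open>sw_exchange\<close> swaps the first two. This interchange of the middle factors is what
  makes convolution products of coalgebra maps comultiplicative.\<close>

lemma sw_exchange4:
  assumes co: "cocommutative scale (H \<alpha>) (\<Delta> \<alpha>)"
    and s: "vector_space s" and x: "x \<in> H \<alpha>"
    and F: "\<And>b c d. b \<in> H \<alpha> \<Longrightarrow> c \<in> H \<alpha> \<Longrightarrow> d \<in> H \<alpha> \<Longrightarrow> lin s \<alpha> (\<lambda>a. F a b c d)"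
      "\<And>a c d. a \<in> H \<alpha> \<Longrightarrow> c \<in> H \<alpha> \<Longrightarrow> d \<in> H \<alpha> \<Longrightarrow> lin s \<alpha> (\<lambda>b. F a b c d)"
      "\<And>a b d. a \<in> H \<alpha> \<Longrightarrow> b \<in> H \<alpha> \<Longrightarrow> d \<in> H \<alpha> \<Longrightarrow> lin s \<alpha> (\<lambda>c. F a b c d)"
      "\<And>a b c. a \<in> H \<alpha> \<Longrightarrow> b \<in> H \<alpha> \<Longrightarrow> c \<in> H \<alpha> \<Longrightarrow> lin s \<alpha> (\<lambda>d. F a b c d)"
  shows "sw s \<alpha> x (\<lambda>p q. sw s \<alpha> p (\<lambda>a b. sw s \<alpha> q (\<lambda>c d. F a b c d))) =
         sw s \<alpha> x (\<lambda>p q. sw s \<alpha> p (\<lambda>a b. sw s \<alpha> q (\<lambda>c d. F a c b d)))"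
proof -
  note sl = lin_sw[OF s] sw_linear[OF s]
  have "sw s \<alpha> x (\<lambda>p q. sw s \<alpha> p (\<lambda>a b. sw s \<alpha> q (\<lambda>c d. F a b c d))) =
      sw s \<alpha> x (\<lambda>a r. sw s \<alpha> r (\<lambda>b q. sw s \<alpha> q (\<lambda>c d. F a b c d)))"
    by (rule coassoc) (simp_all add: s x F sl)
  also have "\<dots> = sw s \<alpha> x (\<lambda>a r. sw s \<alpha> r (\<lambda>b q. sw s \<alpha> q (\<lambda>c d. F a c b d)))"
    by (rule sw_cong[OF refl], rule sw_exchange[OF co s]) (use x in \<open>simp_all add: F\<close>)
  also have "\<dots> = sw s \<alpha> x (\<lambda>p q. sw s \<alpha> p (\<lambda>a b. sw s \<alpha> q (\<lambda>c d. F a c b d)))"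
    by (rule coassoc[symmetric]) (simp_all add: s x F sl)
  finally show ?thesis .
qed

text \<open>The monoid argument \<psi>' = \<psi>' (\<theta> \<psi>) = (\<psi>' \<theta>) \<psi> =
  \<psi> for convolution, with coassociativity as associativity; exhibiting one inverse thus also
  yields the uniqueness clause.\<close>

lemma convolution_invertibleI:
  assumes \<psi>: "convolution_inverse scale (H \<alpha>) (\<Delta> \<alpha>) (\<epsilon> \<alpha>) (H \<beta>) \<theta> \<psi>"
    and \<theta>: "bilinear_on scale scale (H \<alpha>) (H \<beta>) (H \<beta>) \<theta>"
  shows "convolution_invertible scale (H \<alpha>) (\<Delta> \<alpha>) (\<epsilon> \<alpha>) (H \<beta>) \<theta>"
  unfolding convolution_invertible_def
proof (rule exI[of _ \<psi>], rule conjI[OF \<psi>], intro allI impI ballI)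
  fix \<psi>' x y
  assume \<psi>': "convolution_inverse scale (H \<alpha>) (\<Delta> \<alpha>) (\<epsilon> \<alpha>) (H \<beta>) \<theta> \<psi>'" and x: "x \<in> H \<alpha>" and y: "y \<in> H \<beta>"
  have b: "bilinear_on scale scale (H \<alpha>) (H \<beta>) (H \<beta>) \<psi>" "bilinear_on scale scale (H \<alpha>) (H \<beta>) (H \<beta>) \<psi>'"
    using \<psi> \<psi>' by (simp_all add: convolution_inverse_def)
  note [simp] = bilinear_rules[OF \<theta>] bilinear_rules[OF b(1)] bilinear_rules[OF b(2)]
  have r: "sw scale \<alpha> a (\<lambda>b c. \<theta> b (\<psi> c w)) = scale (\<epsilon> \<alpha> a) w"
    and l: "sw scale \<alpha> a (\<lambda>b c. \<psi>' b (\<theta> c w)) = scale (\<epsilon> \<alpha> a) w" if "a \<in> H \<alpha>" "w \<in> H \<beta>" for a w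
    using \<psi> \<psi>' that by (simp_all add: convolution_inverse_def sw_def)
  have "\<psi>' x y = sw scale \<alpha> x (\<lambda>a b. \<psi>' a (scale (\<epsilon> \<alpha> b) y))" using x y by simp
  also have "\<dots> = sw scale \<alpha> x (\<lambda>a b. \<psi>' a (sw scale \<alpha> b (\<lambda>c d. \<theta> c (\<psi> d y))))"
    by (rule sw_cong[OF refl]) (use x y r in auto)
  also have "\<dots> = sw scale \<alpha> x (\<lambda>a b. sw scale \<alpha> b (\<lambda>c d. \<psi>' a (\<theta> c (\<psi> d y))))"
    using x y by simp
  also have "\<dots> = sw scale \<alpha> x (\<lambda>b d. sw scale \<alpha> b (\<lambda>a c. \<psi>' a (\<theta> c (\<psi> d y))))"
    by (rule coassoc[symmetric]) (use x y in simp_all)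
  also have "\<dots> = sw scale \<alpha> x (\<lambda>b d. scale (\<epsilon> \<alpha> b) (\<psi> d y))"
    by (rule sw_cong[OF refl]) (use x y l in auto)
  also have "\<dots> = \<psi> x y" using x y by simp
  finally show "\<psi>' x y = \<psi> x y" .
qed

end

sublocale hopf_pi_algebra \<subseteq> coalgebra_family scale H \<Delta> \<epsilon>
  by (rule coalgebra_family.intro[OF vector_space_axioms], rule coalgebra_family_axioms.intro, rule coalg)

section \<open>Antipodes and convolution products in a Hopf \<pi>-algebra\<close>

context hopf_pi_algebra
begin

text \<open>The target degree is a variable with an equation, so that the closure rule also proves
  membership in \<open>H 0\<close> or \<open>H \<beta>\<close> when the degrees agree only after
  group arithmetic. The same device recurs in the later rules.\<close>

lemma mul_bilinear: "\<gamma> = \<alpha> + \<beta> \<Longrightarrow> bilinear_on scale scale (H \<alpha>) (H \<beta>) (H \<gamma>) (mul \<alpha> \<beta>)"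
  using mul_coalgebra_map by (simp add: coalgebra_map2_def)

lemmas mul_rules [simp] = bilinear_rules(1)[OF mul_bilinear] bilinear_rules(2-)[OF mul_bilinear[OF refl]]

lemma antipode_linear': "\<beta> = - \<alpha> \<Longrightarrow> linear_on scale scale (H \<alpha>) (H \<beta>) (S \<alpha>)"
  using antipode_linear by simp

lemmas antipode_rules [simp] = linear_rules(1)[OF antipode_linear'] linear_rules(2-)[OF antipode_linear]

lemma counit_mul [simp]:
  "x \<in> H \<alpha> \<Longrightarrow> y \<in> H \<beta> \<Longrightarrow> \<gamma> = \<alpha> + \<beta> \<Longrightarrow> \<epsilon> \<gamma> (mul \<alpha> \<beta> x y) = \<epsilon> \<alpha> x * \<epsilon> \<beta> y"
  using mul_coalgebra_map by (simp add: coalgebra_map2_def)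

lemma sw_mul:
  assumes "vector_space s" "x \<in> H \<alpha>" "y \<in> H \<beta>" "\<gamma> = \<alpha> + \<beta>"
    and "\<And>a. a \<in> H \<gamma> \<Longrightarrow> lin s \<gamma> (F a)" "\<And>b. b \<in> H \<gamma> \<Longrightarrow> lin s \<gamma> (\<lambda>a. F a b)"
  shows "sw s \<gamma> (mul \<alpha> \<beta> x y) F =
    sw s \<alpha> x (\<lambda>x1 x2. sw s \<beta> y (\<lambda>y1 y2. F (mul \<alpha> \<beta> x1 y1) (mul \<alpha> \<beta> x2 y2)))"
  unfolding assms(4)
  by (rule sw_coalgebra_map2[OF mul_coalgebra_map assms(1-3)]) (use assms(4-) in simp_all)

declare one_closed [simp] counit_one [simp] mul_one_left [simp] mul_one_right [simp]

lemma sw_one: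
  assumes "vector_space s" "\<And>a. a \<in> H 0 \<Longrightarrow> lin s 0 (F a)" "\<And>b. b \<in> H 0 \<Longrightarrow> lin s 0 (\<lambda>a. F a b)"
  shows "sw s 0 one F = F one one"
  by (rule sw_grouplike[OF assms(1) one_closed comult_one assms(2,3)])

lemmas comult_rules [simp] =
  sw_one[where s = scale] sw_one[where s = free_scale]
  sw_mul[where s = scale] sw_mul[where s = free_scale]

lemma mul_assoc' [simp]:
  "x \<in> H \<alpha> \<Longrightarrow> y \<in> H \<beta> \<Longrightarrow> z \<in> H \<gamma> \<Longrightarrow> \<delta> = \<alpha> + \<beta> \<Longrightarrow>
    mul \<delta> \<gamma> (mul \<alpha> \<beta> x y) z = mul \<alpha> (\<beta> + \<gamma>) x (mul \<beta> \<gamma> y z)"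
  by (simp add: mul_assoc)

lemma antipode_left' [simp]:
  "x \<in> H \<alpha> \<Longrightarrow> sw scale \<alpha> x (\<lambda>a b. mul (- \<alpha>) \<alpha> (S \<alpha> a) b) = scale (\<epsilon> \<alpha> x) one"
  using antipode_left by (simp add: sw_def)

lemma antipode_right' [simp]:
  "x \<in> H \<alpha> \<Longrightarrow> sw scale \<alpha> x (\<lambda>a b. mul \<alpha> (- \<alpha>) a (S \<alpha> b)) = scale (\<epsilon> \<alpha> x) one"
  using antipode_right by (simp add: sw_def)

lemma antipode_left_cancel:
  assumes x: "x \<in> H \<alpha>" and w: "w \<in> H \<beta>"
  shows "sw scale \<alpha> x (\<lambda>a b. mul (- \<alpha>) (\<alpha> + \<beta>) (S \<alpha> a) (mul \<alpha> \<beta> b w)) = scale (\<epsilon> \<alpha> x) w"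
proof -
  \<comment> \<open>Simp expands the right side: the outer product has to enter the sum and be
    reassociated before the antipode law evaluates that sum, so the law is switched off
    here.\<close>
  have "sw scale \<alpha> x (\<lambda>a b. mul (- \<alpha>) (\<alpha> + \<beta>) (S \<alpha> a) (mul \<alpha> \<beta> b w)) =
      mul 0 \<beta> (sw scale \<alpha> x (\<lambda>a b. mul (- \<alpha>) \<alpha> (S \<alpha> a) b)) w"
    using x w by (simp del: antipode_left')
  also have "\<dots> = scale (\<epsilon> \<alpha> x) w" using x w by simp
  finally show ?thesis .
qed

lemma antipode_right_cancel:
  assumes x: "x \<in> H \<alpha>" and w: "w \<in> H \<beta>"
  shows "sw scale \<alpha> x (\<lambda>a b. mul \<alpha> (- \<alpha> + \<beta>) a (mul (- \<alpha>) \<beta> (S \<alpha> b) w)) = scale (\<epsilon> \<alpha> x) w"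
proof -
  have "sw scale \<alpha> x (\<lambda>a b. mul \<alpha> (- \<alpha> + \<beta>) a (mul (- \<alpha>) \<beta> (S \<alpha> b) w)) =
      mul 0 \<beta> (sw scale \<alpha> x (\<lambda>a b. mul \<alpha> (- \<alpha>) a (S \<alpha> b))) w"
    using x w by (simp del: antipode_right')
  also have "\<dots> = scale (\<epsilon> \<alpha> x) w" using x w by simp
  finally show ?thesis .
qed

text \<open>Covers both constructions at once: f the identity and g the action give the subadjacent
  product, while f the antipode and g the product \<circ> give the action of a brace.\<close>

lemma mul_convolution_coalgebra_map:
  assumes co: "cocommutative scale (H \<alpha>) (\<Delta> \<alpha>)"
    and f: "linear_on scale scale (H \<alpha>) (H \<alpha>') f"
    and counit_f: "\<And>x. x \<in> H \<alpha> \<Longrightarrow> \<epsilon> \<alpha>' (f x) = \<epsilon> \<alpha> x"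
    and comult_f: "\<And>x (F :: 'h \<Rightarrow> 'h \<Rightarrow> ('h list \<Rightarrow>\<^sub>0 'k)). x \<in> H \<alpha> \<Longrightarrow>
      (\<And>a. a \<in> H \<alpha>' \<Longrightarrow> lin free_scale \<alpha>' (F a)) \<Longrightarrow> (\<And>b. b \<in> H \<alpha>' \<Longrightarrow> lin free_scale \<alpha>' (\<lambda>a. F a b)) \<Longrightarrow>
      sw free_scale \<alpha>' (f x) F = sw free_scale \<alpha> x (\<lambda>a b. F (f a) (f b))"
    and g: "coalgebra_map2 scale (H \<alpha>) (\<Delta> \<alpha>) (\<epsilon> \<alpha>) (H \<beta>) (\<Delta> \<beta>) (\<epsilon> \<beta>) (H \<gamma>) (\<Delta> \<gamma>) (\<epsilon> \<gamma>) g"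
  shows "coalgebra_map2 scale (H \<alpha>) (\<Delta> \<alpha>) (\<epsilon> \<alpha>) (H \<beta>) (\<Delta> \<beta>) (\<epsilon> \<beta>) (H (\<alpha>' + \<gamma>)) (\<Delta> (\<alpha>' + \<gamma>)) (\<epsilon> (\<alpha>' + \<gamma>))
    (\<lambda>x y. sw scale \<alpha> x (\<lambda>a b. mul \<alpha>' \<gamma> (f a) (g b y)))"
proof (rule coalgebra_map2I)
  have "bilinear_on scale scale (H \<alpha>) (H \<beta>) (H \<gamma>) g"
    using g by (simp add: coalgebra_map2_def)
  note [simp] = linear_rules[OF f] bilinear_rules[OF this] counit_f
  have [simp]: "\<epsilon> \<gamma> (g x y) = \<epsilon> \<alpha> x * \<epsilon> \<beta> y" if "x \<in> H \<alpha>" "y \<in> H \<beta>" for x y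
    using g that by (simp add: coalgebra_map2_def)
  note comult_g [simp] = sw_coalgebra_map2[OF g vector_spaces(2)]
  let ?m = "\<lambda>x y. sw scale \<alpha> x (\<lambda>a b. mul \<alpha>' \<gamma> (f a) (g b y))"
  show "bilinear_on scale scale (H \<alpha>) (H \<beta>) (H (\<alpha>' + \<gamma>)) ?m"
    by (rule bilinear_onI) simp_all
  fix x y assume xy: "x \<in> H \<alpha>" "y \<in> H \<beta>"
  show "\<epsilon> (\<alpha>' + \<gamma>) (?m x y) = \<epsilon> \<alpha> x * \<epsilon> \<beta> y"
  proof -
    have "\<epsilon> (\<alpha>' + \<gamma>) (?m x y) = sw (*) \<alpha> x (\<lambda>a b. \<epsilon> \<beta> y * (\<epsilon> \<alpha> a * \<epsilon> \<alpha> b))"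
      using xy by (simp add: mult_ac)
    also have "\<dots> = \<epsilon> \<alpha> x * \<epsilon> \<beta> y"
      using xy by (subst sw_scale[OF vector_space_times]) simp
    finally show ?thesis .
  qed
  fix F :: "'h \<Rightarrow> 'h \<Rightarrow> ('h list \<Rightarrow>\<^sub>0 'k)"
  assume F2: "\<And>a. a \<in> H (\<alpha>' + \<gamma>) \<Longrightarrow> lin free_scale (\<alpha>' + \<gamma>) (F a)"
    and F1: "\<And>b. b \<in> H (\<alpha>' + \<gamma>) \<Longrightarrow> lin free_scale (\<alpha>' + \<gamma>) (\<lambda>a. F a b)"
  let ?s = "free_scale :: 'k \<Rightarrow> ('h list \<Rightarrow>\<^sub>0 'k) \<Rightarrow> _"
  have [simp]: "lin ?s \<sigma> (\<lambda>x. F (h x) c)"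
    if "lin scale \<sigma> h" "\<And>x. x \<in> H \<sigma> \<Longrightarrow> h x \<in> H (\<alpha>' + \<gamma>)" "c \<in> H (\<alpha>' + \<gamma>)" for \<sigma> h c
    by (rule lin_comp[OF that(1,2) F1[OF that(3)]])
  have [simp]: "lin ?s \<sigma> (\<lambda>x. F c (h x))"
    if "lin scale \<sigma> h" "\<And>x. x \<in> H \<sigma> \<Longrightarrow> h x \<in> H (\<alpha>' + \<gamma>)" "c \<in> H (\<alpha>' + \<gamma>)" for \<sigma> h c
    by (rule lin_comp[OF that(1,2) F2[OF that(3)]])
  have pull1: "F (sw scale \<alpha> p G) c = sw ?s \<alpha> p (\<lambda>a b. F (G a b) c)"
    if "p \<in> H \<alpha>" "\<And>a b. a \<in> H \<alpha> \<Longrightarrow> b \<in> H \<alpha> \<Longrightarrow> G a b \<in> H (\<alpha>' + \<gamma>)" "c \<in> H (\<alpha>' + \<gamma>)" for p G c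
    by (rule sw_pull[OF _ F1]) (use that in simp_all)
  have pull2: "F c (sw scale \<alpha> p G) = sw ?s \<alpha> p (\<lambda>a b. F c (G a b))"
    if "p \<in> H \<alpha>" "\<And>a b. a \<in> H \<alpha> \<Longrightarrow> b \<in> H \<alpha> \<Longrightarrow> G a b \<in> H (\<alpha>' + \<gamma>)" "c \<in> H (\<alpha>' + \<gamma>)" for p G c
    by (rule sw_pull[OF _ F2]) (use that in simp_all)
  have "sw ?s (\<alpha>' + \<gamma>) (?m x y) F =
    sw ?s \<alpha> x (\<lambda>p q. sw ?s \<alpha> p (\<lambda>a b. sw ?s \<alpha> q (\<lambda>c d. sw ?s \<beta> y (\<lambda>y1 y2.
      F (mul \<alpha>' \<gamma> (f a) (g c y1)) (mul \<alpha>' \<gamma> (f b) (g d y2))))))"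
    using xy by (simp add: F1 F2 comult_f)
  \<comment> \<open>Comultiplying the product gives the order f(x1) g(x3), f(x2) g(x4), whereas two
    copies of the convolution product need f(x1) g(x2), f(x3) g(x4); cocommutativity bridges the
    gap.\<close>
  also have "\<dots> = sw ?s \<alpha> x (\<lambda>p q. sw ?s \<alpha> p (\<lambda>a b. sw ?s \<alpha> q (\<lambda>c d. sw ?s \<beta> y (\<lambda>y1 y2.
      F (mul \<alpha>' \<gamma> (f a) (g b y1)) (mul \<alpha>' \<gamma> (f c) (g d y2))))))"
    by (rule sw_exchange4[OF co]) (use xy in simp_all)
  also have "\<dots> = sw ?s \<alpha> x (\<lambda>p q. sw ?s \<alpha> p (\<lambda>a b. sw ?s \<beta> y (\<lambda>y1 y2. sw ?s \<alpha> q (\<lambda>c d.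
      F (mul \<alpha>' \<gamma> (f a) (g b y1)) (mul \<alpha>' \<gamma> (f c) (g d y2))))))"
    by (simp add: sw_swap[of ?s \<alpha> _ \<beta> y])
  also have "\<dots> = sw ?s \<alpha> x (\<lambda>p q. sw ?s \<beta> y (\<lambda>y1 y2. sw ?s \<alpha> p (\<lambda>a b. sw ?s \<alpha> q (\<lambda>c d.
      F (mul \<alpha>' \<gamma> (f a) (g b y1)) (mul \<alpha>' \<gamma> (f c) (g d y2))))))"
    by (rule sw_cong[OF refl], rule sw_swap) simp
  also have "\<dots> = sw ?s \<alpha> x (\<lambda>p q. sw ?s \<beta> y (\<lambda>y1 y2. sw ?s \<alpha> p (\<lambda>a b.
      F (mul \<alpha>' \<gamma> (f a) (g b y1)) (?m q y2))))"
    using xy by (simp add: pull2)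
  also have "\<dots> = sw ?s \<alpha> x (\<lambda>x1 x2. sw ?s \<beta> y (\<lambda>y1 y2. F (?m x1 y1) (?m x2 y2)))"
    using xy by (simp add: pull1)
  finally show "sw ?s (\<alpha>' + \<gamma>) (?m x y) F =
    sw ?s \<alpha> x (\<lambda>x1 x2. sw ?s \<beta> y (\<lambda>y1 y2. F (?m x1 y1) (?m x2 y2)))" .
qed

text \<open>In the convolution algebra of maps on the tensor product of \<open>H \<alpha>\<close>
  and \<open>H \<beta>\<close>, S after f is a left inverse of f because f is a coalgebra map, and R
  is a right inverse by hypothesis; hence they coincide. Coassociativity is applied to x and y
  separately, with exchanges of sums in between.\<close>

lemma antipode_unique:
  assumes f: "coalgebra_map2 scale (H \<alpha>) (\<Delta> \<alpha>) (\<epsilon> \<alpha>) (H \<beta>) (\<Delta> \<beta>) (\<epsilon> \<beta>) (H \<gamma>) (\<Delta> \<gamma>) (\<epsilon> \<gamma>) f"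
    and R: "bilinear_on scale scale (H \<alpha>) (H \<beta>) (H (- \<gamma>)) R"
    and inv: "\<And>x y. x \<in> H \<alpha> \<Longrightarrow> y \<in> H \<beta> \<Longrightarrow>
      sw scale \<alpha> x (\<lambda>x1 x2. sw scale \<beta> y (\<lambda>y1 y2. mul \<gamma> (- \<gamma>) (f x1 y1) (R x2 y2))) =
      scale (\<epsilon> \<alpha> x) (scale (\<epsilon> \<beta> y) one)"
    and x: "x \<in> H \<alpha>" and y: "y \<in> H \<beta>"
  shows "S \<gamma> (f x y) = R x y"
proof -
  have "bilinear_on scale scale (H \<alpha>) (H \<beta>) (H \<gamma>) f"
    using f by (simp add: coalgebra_map2_def)
  note [simp] = bilinear_rules[OF this] bilinear_rules[OF R]
  have counit_f: "\<epsilon> \<gamma> (f x y) = \<epsilon> \<alpha> x * \<epsilon> \<beta> y" if "x \<in> H \<alpha>" "y \<in> H \<beta>" for x y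
    using f that by (simp add: coalgebra_map2_def)
  let ?G = "\<lambda>a b c p q r. mul (- \<gamma>) 0 (S \<gamma> (f a p)) (mul \<gamma> (- \<gamma>) (f b q) (R c r))"
  \<comment> \<open>The two sums together form the comultiplication of f a b, so this is the left
    antipode law at f a b.\<close>
  have left: "sw scale \<alpha> a (\<lambda>a1 a2. sw scale \<beta> b (\<lambda>b1 b2. mul (- \<gamma>) 0 (S \<gamma> (f a1 b1)) (mul \<gamma> (- \<gamma>) (f a2 b2) w))) =
      scale (\<epsilon> \<alpha> a) (scale (\<epsilon> \<beta> b) w)"
    if "a \<in> H \<alpha>" "b \<in> H \<beta>" "w \<in> H (- \<gamma>)" for a b w
  proof -
    have "sw scale \<alpha> a (\<lambda>a1 a2. sw scale \<beta> b (\<lambda>b1 b2. mul (- \<gamma>) 0 (S \<gamma> (f a1 b1)) (mul \<gamma> (- \<gamma>) (f a2 b2) w))) =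
        sw scale \<gamma> (f a b) (\<lambda>u v. mul (- \<gamma>) 0 (S \<gamma> u) (mul \<gamma> (- \<gamma>) v w))"
      by (rule sw_coalgebra_map2[OF f, symmetric]) (use that in simp_all)
    also have "\<dots> = scale (\<epsilon> \<alpha> a) (scale (\<epsilon> \<beta> b) w)"
      using antipode_left_cancel[of "f a b" \<gamma> w "- \<gamma>"] that by (simp add: counit_f)
    finally show ?thesis .
  qed
  have "S \<gamma> (f x y) = sw scale \<alpha> x (\<lambda>a b. sw scale \<beta> y (\<lambda>p q.
      mul (- \<gamma>) 0 (S \<gamma> (f a p)) (scale (\<epsilon> \<alpha> b) (scale (\<epsilon> \<beta> q) one))))"
    using x y by (simp del: scale_scale)
  also have "\<dots> = sw scale \<alpha> x (\<lambda>a b. sw scale \<beta> y (\<lambda>p q. mul (- \<gamma>) 0 (S \<gamma> (f a p))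
      (sw scale \<alpha> b (\<lambda>b1 b2. sw scale \<beta> q (\<lambda>q1 q2. mul \<gamma> (- \<gamma>) (f b1 q1) (R b2 q2))))))"
    by (intro sw_cong[OF refl]) (use x y inv in auto)
  also have "\<dots> = sw scale \<alpha> x (\<lambda>a s. sw scale \<beta> y (\<lambda>p t. sw scale \<alpha> s (\<lambda>b c. sw scale \<beta> t (\<lambda>q r. ?G a b c p q r))))"
    using x y by simp
  also have "\<dots> = sw scale \<alpha> x (\<lambda>a s. sw scale \<alpha> s (\<lambda>b c. sw scale \<beta> y (\<lambda>p t. sw scale \<beta> t (\<lambda>q r. ?G a b c p q r))))"
    by (rule sw_cong[OF refl], rule sw_swap) simp
  also have "\<dots> = sw scale \<alpha> x (\<lambda>s c. sw scale \<alpha> s (\<lambda>a b. sw scale \<beta> y (\<lambda>p t. sw scale \<beta> t (\<lambda>q r. ?G a b c p q r))))"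
    by (rule coassoc[symmetric]) (use x y in simp_all)
  also have "\<dots> = sw scale \<alpha> x (\<lambda>s c. sw scale \<alpha> s (\<lambda>a b. sw scale \<beta> y (\<lambda>t r. sw scale \<beta> t (\<lambda>p q. ?G a b c p q r))))"
    by (intro sw_cong[OF refl] coassoc[symmetric]) (use x y in simp_all)
  also have "\<dots> = sw scale \<alpha> x (\<lambda>s c. sw scale \<beta> y (\<lambda>t r. sw scale \<alpha> s (\<lambda>a b. sw scale \<beta> t (\<lambda>p q. ?G a b c p q r))))"
    by (rule sw_cong[OF refl], rule sw_swap) simp
  also have "\<dots> = sw scale \<alpha> x (\<lambda>s c. sw scale \<beta> y (\<lambda>t r. scale (\<epsilon> \<alpha> s) (scale (\<epsilon> \<beta> t) (R c r))))"
    by (intro sw_cong[OF refl] left) (use x y in simp_all)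
  also have "\<dots> = R x y" using x y by (simp del: scale_scale)
  finally show ?thesis .
qed

text \<open>Apply \<epsilon> to S(x1) x2 = \<epsilon>(x) 1 and absorb \<epsilon>(x2) by the counit
  law.\<close>

lemma counit_antipode [simp]:
  assumes "x \<in> H \<alpha>" "\<beta> = - \<alpha>"
  shows "\<epsilon> \<beta> (S \<alpha> x) = \<epsilon> \<alpha> x"
proof -
  have l: "lin (*) \<alpha> (\<lambda>a. \<epsilon> (- \<alpha>) (S \<alpha> a))"
    using antipode_linear[of \<alpha>] by (intro linI) (simp_all add: linear_on_def)
  have "\<epsilon> (- \<alpha>) (S \<alpha> x) = sw (*) \<alpha> x (\<lambda>a b. \<epsilon> \<alpha> b * \<epsilon> (- \<alpha>) (S \<alpha> a))"
    using counit_right[OF vector_space_times l assms(1)] by simp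
  also have "\<dots> = \<epsilon> 0 (sw scale \<alpha> x (\<lambda>a b. mul (- \<alpha>) \<alpha> (S \<alpha> a) b))"
    using assms(1) by (simp add: mult.commute del: antipode_left')
  also have "\<dots> = \<epsilon> \<alpha> x" using assms(1) by simp
  finally show ?thesis by (simp add: assms(2))
qed

lemma antipode_one [simp]: "S 0 one = one"
  using antipode_left'[OF one_closed] by (simp del: antipode_left')

text \<open>Both sides, as functions of \<open>x\<close>, are convolution inverse to the comultiplication.\<close>

lemma sw_antipode:
  fixes F :: "'h \<Rightarrow> 'h \<Rightarrow> ('b \<Rightarrow>\<^sub>0 'k)"
  assumes x: "x \<in> H \<alpha>"
    and F2: "\<And>a. a \<in> H (- \<alpha>) \<Longrightarrow> lin free_scale (- \<alpha>) (F a)"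
    and F1: "\<And>b. b \<in> H (- \<alpha>) \<Longrightarrow> lin free_scale (- \<alpha>) (\<lambda>a. F a b)"
  shows "sw free_scale (- \<alpha>) (S \<alpha> x) F = sw free_scale \<alpha> x (\<lambda>a b. F (S \<alpha> b) (S \<alpha> a))"
proof -
  let ?s = "free_scale :: 'k \<Rightarrow> ('b \<Rightarrow>\<^sub>0 'k) \<Rightarrow> _"
  have [simp]: "lin ?s \<sigma> (\<lambda>x. F (h x) c)"
    if "lin scale \<sigma> h" "\<And>x. x \<in> H \<sigma> \<Longrightarrow> h x \<in> H (- \<alpha>)" "c \<in> H (- \<alpha>)" for \<sigma> h c
    by (rule lin_comp[OF that(1,2) F1[OF that(3)]])
  have [simp]: "lin ?s \<sigma> (\<lambda>x. F c (h x))"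
    if "lin scale \<sigma> h" "\<And>x. x \<in> H \<sigma> \<Longrightarrow> h x \<in> H (- \<alpha>)" "c \<in> H (- \<alpha>)" for \<sigma> h c
    by (rule lin_comp[OF that(1,2) F2[OF that(3)]])
  have scale1 [simp]: "F (scale k a) b = free_scale k (F a b)"
    and scale2 [simp]: "F a (scale k b) = free_scale k (F a b)" if "a \<in> H (- \<alpha>)" "b \<in> H (- \<alpha>)" for a b k
    using lin_scale[OF F1] lin_scale[OF F2] that by auto
  have pull1: "F (sw scale \<alpha> p G) c = sw ?s \<alpha> p (\<lambda>a b. F (G a b) c)"
    if "p \<in> H \<alpha>" "\<And>a b. a \<in> H \<alpha> \<Longrightarrow> b \<in> H \<alpha> \<Longrightarrow> G a b \<in> H (- \<alpha>)" "c \<in> H (- \<alpha>)" for p G c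
    by (rule sw_pull[OF _ F1]) (use that in simp_all)
  have pull2: "F c (sw scale \<alpha> p G) = sw ?s \<alpha> p (\<lambda>a b. F c (G a b))"
    if "p \<in> H \<alpha>" "\<And>a b. a \<in> H \<alpha> \<Longrightarrow> b \<in> H \<alpha> \<Longrightarrow> G a b \<in> H (- \<alpha>)" "c \<in> H (- \<alpha>)" for p G c
    by (rule sw_pull[OF _ F2]) (use that in simp_all)
  let ?G = "\<lambda>s1 s2 b1 b2 c1 c2. F (mul (- \<alpha>) 0 s1 (mul \<alpha> (- \<alpha>) b1 (S \<alpha> c2))) (mul (- \<alpha>) 0 s2 (mul \<alpha> (- \<alpha>) b2 (S \<alpha> c1)))"
  have right: "sw ?s \<alpha> r (\<lambda>b c. sw ?s \<alpha> b (\<lambda>b1 b2. sw ?s \<alpha> c (\<lambda>c1 c2. ?G s1 s2 b1 b2 c1 c2))) =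
      free_scale (\<epsilon> \<alpha> r) (F s1 s2)"
    if r: "r \<in> H \<alpha>" and s: "s1 \<in> H (- \<alpha>)" "s2 \<in> H (- \<alpha>)" for r s1 s2
  proof -
    have "sw ?s \<alpha> r (\<lambda>b c. sw ?s \<alpha> b (\<lambda>b1 b2. sw ?s \<alpha> c (\<lambda>c1 c2. ?G s1 s2 b1 b2 c1 c2))) =
        sw ?s \<alpha> r (\<lambda>b1 t. sw ?s \<alpha> t (\<lambda>b2 c. sw ?s \<alpha> c (\<lambda>c1 c2. ?G s1 s2 b1 b2 c1 c2)))"
      by (rule coassoc) (use r s in simp_all)
    \<comment> \<open>The four factors of r appear in the order b1, b2, c1, c2. Because the antipode
      reverses the legs, b2 meets S(c1) in the second leg; once this adjacent pair has cancelled, b1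
      and S(c2) become adjacent in the first.\<close>
    also have "\<dots> = sw ?s \<alpha> r (\<lambda>b1 t. sw ?s \<alpha> t (\<lambda>u c2. sw ?s \<alpha> u (\<lambda>b2 c1. ?G s1 s2 b1 b2 c1 c2)))"
      by (rule sw_cong[OF refl], rule coassoc[symmetric]) (use r s in simp_all)
    also have "\<dots> = sw ?s \<alpha> r (\<lambda>b1 t. sw ?s \<alpha> t (\<lambda>u c2. F (mul (- \<alpha>) 0 s1 (mul \<alpha> (- \<alpha>) b1 (S \<alpha> c2)))
        (mul (- \<alpha>) 0 s2 (sw scale \<alpha> u (\<lambda>b2 c1. mul \<alpha> (- \<alpha>) b2 (S \<alpha> c1))))))"
      using r s by (simp add: pull2 del: antipode_right')
    also have "\<dots> = sw ?s \<alpha> r (\<lambda>b1 t. F (mul (- \<alpha>) 0 s1 (mul \<alpha> (- \<alpha>) b1 (S \<alpha> t))) s2)"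
      using r s by simp
    also have "\<dots> = F (mul (- \<alpha>) 0 s1 (sw scale \<alpha> r (\<lambda>b1 t. mul \<alpha> (- \<alpha>) b1 (S \<alpha> t)))) s2"
      using r s by (simp add: pull1 del: antipode_right')
    also have "\<dots> = free_scale (\<epsilon> \<alpha> r) (F s1 s2)" using r s by simp
    finally show ?thesis .
  qed
  have "sw ?s (- \<alpha>) (S \<alpha> x) F = sw ?s \<alpha> x (\<lambda>a r. free_scale (\<epsilon> \<alpha> r) (sw ?s (- \<alpha>) (S \<alpha> a) F))"
    using x by (simp add: F1 F2)
  also have "\<dots> = sw ?s \<alpha> x (\<lambda>a r. sw ?s (- \<alpha>) (S \<alpha> a) (\<lambda>s1 s2. free_scale (\<epsilon> \<alpha> r) (F s1 s2)))"
    by simp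
  also have "\<dots> = sw ?s \<alpha> x (\<lambda>a r. sw ?s (- \<alpha>) (S \<alpha> a) (\<lambda>s1 s2.
      sw ?s \<alpha> r (\<lambda>b c. sw ?s \<alpha> b (\<lambda>b1 b2. sw ?s \<alpha> c (\<lambda>c1 c2. ?G s1 s2 b1 b2 c1 c2)))))"
    by (intro sw_cong[OF refl] right[symmetric]) (use x in simp_all)
  also have "\<dots> = sw ?s \<alpha> x (\<lambda>a r. sw ?s \<alpha> r (\<lambda>b c. sw ?s (- \<alpha>) (S \<alpha> a) (\<lambda>s1 s2.
      sw ?s \<alpha> b (\<lambda>b1 b2. sw ?s \<alpha> c (\<lambda>c1 c2. ?G s1 s2 b1 b2 c1 c2)))))"
    by (rule sw_cong[OF refl], rule sw_swap) simp
  also have "\<dots> = sw ?s \<alpha> x (\<lambda>t c. sw ?s \<alpha> t (\<lambda>a b. sw ?s (- \<alpha>) (S \<alpha> a) (\<lambda>s1 s2.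
      sw ?s \<alpha> b (\<lambda>b1 b2. sw ?s \<alpha> c (\<lambda>c1 c2. ?G s1 s2 b1 b2 c1 c2)))))"
    by (rule coassoc[symmetric]) (use x in simp_all)
  also have "\<dots> = sw ?s \<alpha> x (\<lambda>t c. sw ?s 0 (sw scale \<alpha> t (\<lambda>a b. mul (- \<alpha>) \<alpha> (S \<alpha> a) b)) (\<lambda>u v.
      sw ?s \<alpha> c (\<lambda>c1 c2. F (mul 0 (- \<alpha>) u (S \<alpha> c2)) (mul 0 (- \<alpha>) v (S \<alpha> c1)))))"
    using x by (simp del: antipode_left')
  also have "\<dots> = sw ?s \<alpha> x (\<lambda>a b. F (S \<alpha> b) (S \<alpha> a))"
    using x by simp
  finally show ?thesis .
qed

end

section \<open>The subadjacent Hopf algebra\<close>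

text \<open>The convolution inverse \<psi> is a parameter, not a choice from
  \<open>act_invertible\<close>, because T is built from it and the result is claimed for every such
  \<psi>.\<close>

locale cocommutative_post_hopf_pi_algebra = post_hopf_pi_algebra scale H \<Delta> \<epsilon> mul one S act
  for scale :: "'k::field \<Rightarrow> 'h::ab_group_add \<Rightarrow> 'h"
    and H :: "'p::ab_group_add \<Rightarrow> 'h set"
    and \<Delta> :: "'p \<Rightarrow> 'h \<Rightarrow> ('h list \<Rightarrow>\<^sub>0 'k) set"
    and \<epsilon> :: "'p \<Rightarrow> 'h \<Rightarrow> 'k"
    and mul :: "'p \<Rightarrow> 'p \<Rightarrow> 'h \<Rightarrow> 'h \<Rightarrow> 'h"
    and one :: "'h"
    and S :: "'p \<Rightarrow> 'h \<Rightarrow> 'h"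
    and act :: "'p \<Rightarrow> 'p \<Rightarrow> 'h \<Rightarrow> 'h \<Rightarrow> 'h" +
  fixes \<psi> :: "'p \<Rightarrow> 'p \<Rightarrow> 'h \<Rightarrow> 'h \<Rightarrow> 'h"
  assumes cocommutative: "cocommutative_family scale H \<Delta>"
    and \<psi>_inverse: "\<And>\<alpha> \<beta>. convolution_inverse scale (H \<alpha>) (\<Delta> \<alpha>) (\<epsilon> \<alpha>) (H \<beta>) (act \<alpha> \<beta>) (\<psi> \<alpha> \<beta>)"
begin

lemma cocommutative_H: "cocommutative scale (H \<alpha>) (\<Delta> \<alpha>)"
  using cocommutative by (simp add: cocommutative_family_def)

lemma act_bilinear: "bilinear_on scale scale (H \<alpha>) (H \<beta>) (H \<beta>) (act \<alpha> \<beta>)"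
  using act_coalgebra_map by (simp add: coalgebra_map2_def)

lemma \<psi>_bilinear: "bilinear_on scale scale (H \<alpha>) (H \<beta>) (H \<beta>) (\<psi> \<alpha> \<beta>)"
  using \<psi>_inverse by (simp add: convolution_inverse_def)

lemmas act_rules [simp] = bilinear_rules[OF act_bilinear] and \<psi>_rules [simp] = bilinear_rules[OF \<psi>_bilinear]

lemma counit_act [simp]: "x \<in> H \<alpha> \<Longrightarrow> y \<in> H \<beta> \<Longrightarrow> \<epsilon> \<beta> (act \<alpha> \<beta> x y) = \<epsilon> \<alpha> x * \<epsilon> \<beta> y"
  using act_coalgebra_map by (simp add: coalgebra_map2_def)

lemmas sw_act = sw_coalgebra_map2[OF act_coalgebra_map]

lemmas comult_act_rules [simp] = sw_act[where s = scale] sw_act[where s = free_scale]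

lemma \<psi>_act [simp]: "x \<in> H \<alpha> \<Longrightarrow> y \<in> H \<beta> \<Longrightarrow> sw scale \<alpha> x (\<lambda>a b. \<psi> \<alpha> \<beta> a (act \<alpha> \<beta> b y)) = scale (\<epsilon> \<alpha> x) y"
  and act_\<psi> [simp]: "x \<in> H \<alpha> \<Longrightarrow> y \<in> H \<beta> \<Longrightarrow> sw scale \<alpha> x (\<lambda>a b. act \<alpha> \<beta> a (\<psi> \<alpha> \<beta> b y)) = scale (\<epsilon> \<alpha> x) y"
  using \<psi>_inverse by (simp_all add: convolution_inverse_def sw_def)

lemma act_mul': "x \<in> H \<alpha> \<Longrightarrow> y \<in> H \<beta> \<Longrightarrow> z \<in> H \<gamma> \<Longrightarrow> \<delta> = \<beta> + \<gamma> \<Longrightarrow>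
    act \<alpha> \<delta> x (mul \<beta> \<gamma> y z) = sw scale \<alpha> x (\<lambda>x1 x2. mul \<beta> \<gamma> (act \<alpha> \<beta> x1 y) (act \<alpha> \<gamma> x2 z))"
  by (simp add: act_mul sw_def)

text \<open>
  The map \<open>x \<mapsto> x \<triangleright> 1\<close> is idempotent for convolution, and as a coalgebra map it is convolution
  invertible with inverse \<open>x \<mapsto> S (x \<triangleright> 1)\<close>; hence it is trivial.
\<close>

lemma act_one_right [simp]:
  assumes x: "x \<in> H \<alpha>"
  shows "act \<alpha> 0 x one = scale (\<epsilon> \<alpha> x) one"
proof -
  let ?u = "\<lambda>x. act \<alpha> 0 x one"
  have inv: "sw scale \<alpha> a (\<lambda>a1 a2. mul 0 0 (S 0 (?u a1)) (?u a2)) = scale (\<epsilon> \<alpha> a) one" if "a \<in> H \<alpha>" for a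
  proof -
    have "sw scale \<alpha> a (\<lambda>a1 a2. mul 0 0 (S 0 (?u a1)) (?u a2)) =
        sw scale 0 (?u a) (\<lambda>a1 a2. mul 0 0 (S 0 a1) a2)"
      using that by simp
    also have "\<dots> = scale (\<epsilon> \<alpha> a) one"
      using that antipode_left'[of "?u a" 0] by (simp del: antipode_left')
    finally show ?thesis .
  qed
  have idem: "sw scale \<alpha> b (\<lambda>b1 b2. mul 0 0 (?u b1) (?u b2)) = ?u b" if "b \<in> H \<alpha>" for b
    using act_mul'[OF that one_closed one_closed, of 0] that by simp
  have "?u x = sw scale \<alpha> x (\<lambda>a b. mul 0 0 (scale (\<epsilon> \<alpha> a) one) (?u b))"
    using x by simp
  also have "\<dots> = sw scale \<alpha> x (\<lambda>a b. mul 0 0 (sw scale \<alpha> a (\<lambda>a1 a2. mul 0 0 (S 0 (?u a1)) (?u a2))) (?u b))"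
    by (rule sw_cong[OF refl]) (use x inv in auto)
  also have "\<dots> = sw scale \<alpha> x (\<lambda>a b. sw scale \<alpha> a (\<lambda>a1 a2. mul 0 0 (S 0 (?u a1)) (mul 0 0 (?u a2) (?u b))))"
    using x by simp
  also have "\<dots> = sw scale \<alpha> x (\<lambda>a b. sw scale \<alpha> b (\<lambda>b1 b2. mul 0 0 (S 0 (?u a)) (mul 0 0 (?u b1) (?u b2))))"
    by (rule coassoc) (use x in simp_all)
  also have "\<dots> = sw scale \<alpha> x (\<lambda>a b. mul 0 0 (S 0 (?u a)) (sw scale \<alpha> b (\<lambda>b1 b2. mul 0 0 (?u b1) (?u b2))))"
    using x by simp
  also have "\<dots> = sw scale \<alpha> x (\<lambda>a b. mul 0 0 (S 0 (?u a)) (?u b))"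
    by (rule sw_cong[OF refl]) (use x idem in auto)
  also have "\<dots> = scale (\<epsilon> \<alpha> x) one" by (rule inv[OF x])
  finally show ?thesis .
qed

lemma act_act': "x \<in> H \<alpha> \<Longrightarrow> y \<in> H \<beta> \<Longrightarrow> z \<in> H \<gamma> \<Longrightarrow>
    sw scale \<alpha> x (\<lambda>x1 x2. act (\<alpha> + \<beta>) \<gamma> (mul \<alpha> \<beta> x1 (act \<alpha> \<beta> x2 y)) z) = act \<alpha> \<gamma> x (act \<beta> \<gamma> y z)"
  using act_act[of x \<alpha> y \<beta> z \<gamma>] by (simp add: sw_def[symmetric])

text \<open>Acting by 1 is idempotent by the composition law, since 1 (1 \<triangleright> 1) = 1. It
  is also injective, because 1 is grouplike and so \<psi> at 1 undoes it. An injective idempotent is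
  the identity.\<close>

lemma act_one_left [simp]:
  assumes z: "z \<in> H \<beta>"
  shows "act 0 \<beta> one z = z"
proof -
  have idem: "act 0 \<beta> one (act 0 \<beta> one z) = act 0 \<beta> one z"
    using act_act'[OF one_closed one_closed z] z by simp
  have inj: "\<psi> 0 \<beta> one (act 0 \<beta> one y) = y" if "y \<in> H \<beta>" for y
    using \<psi>_act[OF one_closed that] that by (simp del: \<psi>_act)
  show ?thesis using inj[of "act 0 \<beta> one z"] inj[OF z] z idem by simp
qed

section \<open>The subadjacent product\<close>

abbreviation sm :: "'p \<Rightarrow> 'p \<Rightarrow> 'h \<Rightarrow> 'h \<Rightarrow> 'h" where
  "sm \<equiv> subadjacent_mul scale \<Delta> mul act"

lemma sm_eq: "sm \<alpha> \<beta> x y = sw scale \<alpha> x (\<lambda>x1 x2. mul \<alpha> \<beta> x1 (act \<alpha> \<beta> x2 y))"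
  by (simp add: subadjacent_mul_def sw_def)

lemma sm_bilinear: "\<gamma> = \<alpha> + \<beta> \<Longrightarrow> bilinear_on scale scale (H \<alpha>) (H \<beta>) (H \<gamma>) (sm \<alpha> \<beta>)"
proof -
  assume "\<gamma> = \<alpha> + \<beta>"
  have sm: "sm \<alpha> \<beta> = (\<lambda>x y. sw scale \<alpha> x (\<lambda>x1 x2. mul \<alpha> \<beta> x1 (act \<alpha> \<beta> x2 y)))"
    by (intro ext sm_eq)
  from \<open>\<gamma> = \<alpha> + \<beta>\<close> show "bilinear_on scale scale (H \<alpha>) (H \<beta>) (H \<gamma>) (sm \<alpha> \<beta>)"
    unfolding sm by (intro bilinear_onI) simp_all
qed

lemmas sm_rules [simp] = bilinear_rules(1)[OF sm_bilinear] bilinear_rules(2-)[OF sm_bilinear[OF refl]]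

lemma sm_act: "x \<in> H \<alpha> \<Longrightarrow> y \<in> H \<beta> \<Longrightarrow> z \<in> H \<gamma> \<Longrightarrow>
    act (\<alpha> + \<beta>) \<gamma> (sm \<alpha> \<beta> x y) z = act \<alpha> \<gamma> x (act \<beta> \<gamma> y z)"
  by (simp add: sm_eq act_act')

lemma sm_coalgebra_map:
  "coalgebra_map2 scale (H \<alpha>) (\<Delta> \<alpha>) (\<epsilon> \<alpha>) (H \<beta>) (\<Delta> \<beta>) (\<epsilon> \<beta>)
     (H (\<alpha> + \<beta>)) (\<Delta> (\<alpha> + \<beta>)) (\<epsilon> (\<alpha> + \<beta>)) (sm \<alpha> \<beta>)"
proof -
  have sm: "sm \<alpha> \<beta> = (\<lambda>x y. sw scale \<alpha> x (\<lambda>x1 x2. mul \<alpha> \<beta> x1 (act \<alpha> \<beta> x2 y)))"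
    by (intro ext sm_eq)
  show ?thesis unfolding sm
    by (rule mul_convolution_coalgebra_map[OF cocommutative_H _ _ _ act_coalgebra_map])
      (simp_all add: linear_on_def)
qed

text \<open>Since \<open>*\<close> is a coalgebra map, (x * y) * z = (x1 * y1) ((x2 * y2)
  \<triangleright> z). The composition law turns this into x1 (x2 \<triangleright> y1) (x3
  \<triangleright> (y2 \<triangleright> z)), and the product law for \<triangleright> collects it as
  x1 (x2 \<triangleright> (y1 (y2 \<triangleright> z))). Cocommutativity is used only through the
  first step.\<close>

lemma sm_assoc [simp]:
  assumes x: "x \<in> H \<alpha>" and y: "y \<in> H \<beta>" and z: "z \<in> H \<gamma>" and \<delta>: "\<delta> = \<alpha> + \<beta>"
  shows "sm \<delta> \<gamma> (sm \<alpha> \<beta> x y) z = sm \<alpha> (\<beta> + \<gamma>) x (sm \<beta> \<gamma> y z)"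
proof -
  let ?G = "\<lambda>a b c y1 y2. mul \<alpha> (\<beta> + \<gamma>) a (mul \<beta> \<gamma> (act \<alpha> \<beta> b y1) (act \<alpha> \<gamma> c (act \<beta> \<gamma> y2 z)))"
  have "sm (\<alpha> + \<beta>) \<gamma> (sm \<alpha> \<beta> x y) z =
      sw scale (\<alpha> + \<beta>) (sm \<alpha> \<beta> x y) (\<lambda>u v. mul (\<alpha> + \<beta>) \<gamma> u (act (\<alpha> + \<beta>) \<gamma> v z))"
    by (rule sm_eq)
  also have "\<dots> = sw scale \<alpha> x (\<lambda>x1 x2. sw scale \<beta> y (\<lambda>y1 y2.
      mul (\<alpha> + \<beta>) \<gamma> (sm \<alpha> \<beta> x1 y1) (act (\<alpha> + \<beta>) \<gamma> (sm \<alpha> \<beta> x2 y2) z)))"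
    by (rule sw_coalgebra_map2[OF sm_coalgebra_map]) (use x y z in simp_all)
  also have "\<dots> = sw scale \<alpha> x (\<lambda>x1 x2. sw scale \<beta> y (\<lambda>y1 y2.
      mul (\<alpha> + \<beta>) \<gamma> (sm \<alpha> \<beta> x1 y1) (act \<alpha> \<gamma> x2 (act \<beta> \<gamma> y2 z))))"
    using x y z by (simp add: sm_act)
  also have "\<dots> = sw scale \<alpha> x (\<lambda>x1 x2. sw scale \<beta> y (\<lambda>y1 y2. sw scale \<alpha> x1 (\<lambda>a b. ?G a b x2 y1 y2)))"
    using x y z by (simp add: sm_eq)
  also have "\<dots> = sw scale \<beta> y (\<lambda>y1 y2. sw scale \<alpha> x (\<lambda>x1 x2. sw scale \<alpha> x1 (\<lambda>a b. ?G a b x2 y1 y2)))"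
    by (rule sw_swap) simp
  also have "\<dots> = sw scale \<beta> y (\<lambda>y1 y2. sw scale \<alpha> x (\<lambda>x1 x2. sw scale \<alpha> x2 (\<lambda>a b. ?G x1 a b y1 y2)))"
    by (rule sw_cong[OF refl], rule coassoc) (use x y z in simp_all)
  also have "\<dots> = sw scale \<alpha> x (\<lambda>x1 x2. sw scale \<beta> y (\<lambda>y1 y2. sw scale \<alpha> x2 (\<lambda>a b. ?G x1 a b y1 y2)))"
    by (rule sw_swap) simp
  also have "\<dots> = sm \<alpha> (\<beta> + \<gamma>) x (sm \<beta> \<gamma> y z)"
    using x y z by (simp add: sm_eq act_mul')
  finally show ?thesis by (simp add: \<delta>)
qed

lemma sm_one_left [simp]: "x \<in> H \<alpha> \<Longrightarrow> sm 0 \<alpha> one x = x"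
  and sm_one_right [simp]: "x \<in> H \<alpha> \<Longrightarrow> sm \<alpha> 0 x one = x"
  by (simp_all add: sm_eq)

section \<open>The subadjacent antipode\<close>

abbreviation T :: "'p \<Rightarrow> 'h \<Rightarrow> 'h" where
  "T \<equiv> subadjacent_antipode scale \<Delta> S \<psi>"

lemma T_eq: "T \<alpha> x = sw scale \<alpha> x (\<lambda>x1 x2. \<psi> \<alpha> (- \<alpha>) x1 (S \<alpha> x2))"
  by (simp add: subadjacent_antipode_def sw_def)

lemma T_linear: "\<beta> = - \<alpha> \<Longrightarrow> linear_on scale scale (H \<alpha>) (H \<beta>) (T \<alpha>)"
proof -
  assume \<beta>: "\<beta> = - \<alpha>"
  have T: "T \<alpha> = (\<lambda>x. sw scale \<alpha> x (\<lambda>x1 x2. \<psi> \<alpha> (- \<alpha>) x1 (S \<alpha> x2)))"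
    by (intro ext T_eq)
  have "lin scale \<alpha> (T \<alpha>)" unfolding T by simp
  moreover have "T \<alpha> x \<in> H \<beta>" if "x \<in> H \<alpha>" for x unfolding T_eq using that \<beta> by simp
  ultimately show "linear_on scale scale (H \<alpha>) (H \<beta>) (T \<alpha>)" by (auto simp: lin_def linear_on_def)
qed

lemmas T_rules [simp] = linear_rules(1)[OF T_linear] linear_rules(2-)[OF T_linear[OF refl]]

text \<open>
  That \<open>T\<close> is a right antipode is immediate; that it is also a left one follows by identifying
  left multiplication by \<open>T x\<close> with this two-sided inverse of left multiplication by \<open>x\<close>.
\<close>

definition left_div :: "'p \<Rightarrow> 'p \<Rightarrow> 'h \<Rightarrow> 'h \<Rightarrow> 'h" where
  "left_div \<alpha> \<gamma> x y = sw scale \<alpha> x (\<lambda>a b. \<psi> \<alpha> (- \<alpha> + \<gamma>) a (mul (- \<alpha>) \<gamma> (S \<alpha> b) y))"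

lemma left_div_bilinear:
  "\<delta> = - \<alpha> + \<gamma> \<Longrightarrow> bilinear_on scale scale (H \<alpha>) (H \<gamma>) (H \<delta>) (left_div \<alpha> \<gamma>)"
proof -
  assume \<delta>: "\<delta> = - \<alpha> + \<gamma>"
  have W: "left_div \<alpha> \<gamma> = (\<lambda>x y. sw scale \<alpha> x (\<lambda>a b. \<psi> \<alpha> (- \<alpha> + \<gamma>) a (mul (- \<alpha>) \<gamma> (S \<alpha> b) y)))"
    by (intro ext left_div_def)
  from \<delta> show "bilinear_on scale scale (H \<alpha>) (H \<gamma>) (H \<delta>) (left_div \<alpha> \<gamma>)"
    unfolding W by (intro bilinear_onI) simp_all
qed

lemmas left_div_rules [simp] =
  bilinear_rules(1)[OF left_div_bilinear] bilinear_rules(2-)[OF left_div_bilinear[OF refl]]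

text \<open>The sum is x1 (x2 \<triangleright> \<psi> x3 (S(x4) y)): the action cancels against
  \<psi> in the middle, and x1 S(x2) y remains.\<close>

lemma sm_left_div:
  assumes x: "x \<in> H \<alpha>" and y: "y \<in> H \<gamma>"
  shows "sw scale \<alpha> x (\<lambda>a b. sm \<alpha> (- \<alpha> + \<gamma>) a (left_div \<alpha> \<gamma> b y)) = scale (\<epsilon> \<alpha> x) y"
proof -
  let ?\<delta> = "- \<alpha> + \<gamma>"
  let ?G = "\<lambda>a c p q. mul \<alpha> ?\<delta> a (act \<alpha> ?\<delta> c (\<psi> \<alpha> ?\<delta> p (mul (- \<alpha>) \<gamma> (S \<alpha> q) y)))"
  have "sw scale \<alpha> x (\<lambda>a b. sm \<alpha> ?\<delta> a (left_div \<alpha> \<gamma> b y)) =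
      sw scale \<alpha> x (\<lambda>r d. sw scale \<alpha> r (\<lambda>a c. sw scale \<alpha> d (\<lambda>p q. ?G a c p q)))"
    using x y by (simp add: left_div_def sm_eq)
  also have "\<dots> = sw scale \<alpha> x (\<lambda>a r. sw scale \<alpha> r (\<lambda>c d. sw scale \<alpha> d (\<lambda>p q. ?G a c p q)))"
    by (rule coassoc) (use x y in simp_all)
  also have "\<dots> = sw scale \<alpha> x (\<lambda>a r. sw scale \<alpha> r (\<lambda>d q. sw scale \<alpha> d (\<lambda>c p. ?G a c p q)))"
    by (rule sw_cong[OF refl], rule coassoc[symmetric]) (use x y in simp_all)
  also have "\<dots> = sw scale \<alpha> x (\<lambda>a r. sw scale \<alpha> r (\<lambda>d q. mul \<alpha> ?\<delta> a
      (sw scale \<alpha> d (\<lambda>c p. act \<alpha> ?\<delta> c (\<psi> \<alpha> ?\<delta> p (mul (- \<alpha>) \<gamma> (S \<alpha> q) y))))))"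
    using x y by (simp del: act_\<psi>)
  also have "\<dots> = sw scale \<alpha> x (\<lambda>a r. mul \<alpha> ?\<delta> a (mul (- \<alpha>) \<gamma> (S \<alpha> r) y))"
    using x y by simp
  also have "\<dots> = scale (\<epsilon> \<alpha> x) y"
    by (rule antipode_right_cancel[OF x y])
  finally show ?thesis .
qed

text \<open>The sum is \<psi> x1 (S(x2) x3 (x4 \<triangleright> y)): first S(x2) x3 cancels, then
  \<psi> cancels against the action.\<close>

lemma left_div_sm:
  assumes x: "x \<in> H \<alpha>" and y: "y \<in> H \<beta>"
  shows "sw scale \<alpha> x (\<lambda>a b. left_div \<alpha> (\<alpha> + \<beta>) a (sm \<alpha> \<beta> b y)) = scale (\<epsilon> \<alpha> x) y"
proof -
  let ?G = "\<lambda>p q c d. \<psi> \<alpha> \<beta> p (mul (- \<alpha>) (\<alpha> + \<beta>) (S \<alpha> q) (mul \<alpha> \<beta> c (act \<alpha> \<beta> d y)))"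
  have "sw scale \<alpha> x (\<lambda>a b. left_div \<alpha> (\<alpha> + \<beta>) a (sm \<alpha> \<beta> b y)) =
      sw scale \<alpha> x (\<lambda>r b. sw scale \<alpha> r (\<lambda>p q. sw scale \<alpha> b (\<lambda>c d. ?G p q c d)))"
    using x y by (simp add: left_div_def sm_eq)
  also have "\<dots> = sw scale \<alpha> x (\<lambda>p r. sw scale \<alpha> r (\<lambda>q b. sw scale \<alpha> b (\<lambda>c d. ?G p q c d)))"
    by (rule coassoc) (use x y in simp_all)
  also have "\<dots> = sw scale \<alpha> x (\<lambda>p r. sw scale \<alpha> r (\<lambda>u d. sw scale \<alpha> u (\<lambda>q c. ?G p q c d)))"
    by (rule sw_cong[OF refl], rule coassoc[symmetric]) (use x y in simp_all)
  also have "\<dots> = sw scale \<alpha> x (\<lambda>p r. sw scale \<alpha> r (\<lambda>u d. \<psi> \<alpha> \<beta> p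
      (sw scale \<alpha> u (\<lambda>q c. mul (- \<alpha>) (\<alpha> + \<beta>) (S \<alpha> q) (mul \<alpha> \<beta> c (act \<alpha> \<beta> d y))))))"
    using x y by simp
  also have "\<dots> = scale (\<epsilon> \<alpha> x) y"
    using x y by (simp add: antipode_left_cancel)
  finally show ?thesis .
qed

lemma T_eq_left_div: "x \<in> H \<alpha> \<Longrightarrow> T \<alpha> x = left_div \<alpha> 0 x one"
  by (simp add: T_eq left_div_def)

lemma sm_T:
  assumes x: "x \<in> H \<alpha>"
  shows "sw scale \<alpha> x (\<lambda>a b. sm \<alpha> (- \<alpha>) a (T \<alpha> b)) = scale (\<epsilon> \<alpha> x) one"
  using sm_left_div[OF x one_closed] x by (simp add: T_eq_left_div)

text \<open>Associativity and the right antipode law give x1 * (T(x2) * y) = \<epsilon>(x) y, so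
  left multiplication by T(x) is a right convolution inverse of left multiplication by x. As
  \<open>left_div\<close> is a left inverse, the two agree.\<close>

lemma T_sm_eq_left_div:
  assumes x: "x \<in> H \<alpha>" and y: "y \<in> H \<gamma>"
  shows "sm (- \<alpha>) \<gamma> (T \<alpha> x) y = left_div \<alpha> \<gamma> x y"
proof -
  let ?\<delta> = "- \<alpha> + \<gamma>"
  let ?V = "\<lambda>d. sm (- \<alpha>) \<gamma> (T \<alpha> d) y"
  have V: "sw scale \<alpha> b (\<lambda>c d. sm \<alpha> ?\<delta> c (?V d)) = scale (\<epsilon> \<alpha> b) y" if b: "b \<in> H \<alpha>" for b
  proof -
    have "sw scale \<alpha> b (\<lambda>c d. sm \<alpha> ?\<delta> c (?V d)) =
        sm 0 \<gamma> (sw scale \<alpha> b (\<lambda>c d. sm \<alpha> (- \<alpha>) c (T \<alpha> d))) y"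
      using b y by simp
    also have "\<dots> = scale (\<epsilon> \<alpha> b) y" using b y by (simp add: sm_T)
    finally show ?thesis .
  qed
  have "left_div \<alpha> \<gamma> x y = sw scale \<alpha> x (\<lambda>a b. left_div \<alpha> \<gamma> a (scale (\<epsilon> \<alpha> b) y))"
    using x y by simp
  also have "\<dots> = sw scale \<alpha> x (\<lambda>a b. left_div \<alpha> \<gamma> a (sw scale \<alpha> b (\<lambda>c d. sm \<alpha> ?\<delta> c (?V d))))"
    by (rule sw_cong[OF refl]) (use x V in auto)
  also have "\<dots> = sw scale \<alpha> x (\<lambda>a b. sw scale \<alpha> b (\<lambda>c d. left_div \<alpha> \<gamma> a (sm \<alpha> ?\<delta> c (?V d))))"
    using x y by simp
  also have "\<dots> = sw scale \<alpha> x (\<lambda>u d. sw scale \<alpha> u (\<lambda>a c. left_div \<alpha> \<gamma> a (sm \<alpha> ?\<delta> c (?V d))))"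
    by (rule coassoc[symmetric]) (use x y in simp_all)
  also have "\<dots> = sw scale \<alpha> x (\<lambda>u d. scale (\<epsilon> \<alpha> u) (?V d))"
  proof (rule sw_cong[OF refl])
    fix u d assume "x \<in> H \<alpha> \<longrightarrow> u \<in> H \<alpha> \<and> d \<in> H \<alpha>"
    with x y show "sw scale \<alpha> u (\<lambda>a c. left_div \<alpha> \<gamma> a (sm \<alpha> ?\<delta> c (?V d))) = scale (\<epsilon> \<alpha> u) (?V d)"
      using left_div_sm[of u \<alpha> "?V d" ?\<delta>] by simp
  qed
  also have "\<dots> = ?V x" using x y by simp
  finally show ?thesis by simp
qed

lemma T_sm:
  assumes x: "x \<in> H \<alpha>"
  shows "sw scale \<alpha> x (\<lambda>a b. sm (- \<alpha>) \<alpha> (T \<alpha> a) b) = scale (\<epsilon> \<alpha> x) one"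
  using left_div_sm[OF x one_closed] x by (simp add: T_sm_eq_left_div)

lemma sm_brace:
  assumes g: "g \<in> H \<alpha>" and h: "h \<in> H \<beta>" and l: "l \<in> H \<gamma>"
  shows "sm \<alpha> (\<beta> + \<gamma>) g (mul \<beta> \<gamma> h l) =
    sw scale \<alpha> g (\<lambda>g1 g'. sw scale \<alpha> g' (\<lambda>g2 g3.
      mul (\<alpha> + \<beta> - \<alpha>) (\<alpha> + \<gamma>) (mul (\<alpha> + \<beta>) (- \<alpha>) (sm \<alpha> \<beta> g1 h) (S \<alpha> g2)) (sm \<alpha> \<gamma> g3 l)))"
proof -
  let ?L = "\<lambda>a b c. mul \<alpha> (\<beta> + \<gamma>) a (mul \<beta> \<gamma> (act \<alpha> \<beta> b h) (act \<alpha> \<gamma> c l))"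
  \<comment> \<open>The action is recovered from the two products; this is the same formula that
    defines \<triangleright> for a brace.\<close>
  have c: "sw scale \<alpha> b (\<lambda>g2 g3. mul (- \<alpha>) (\<alpha> + \<gamma>) (S \<alpha> g2) (sm \<alpha> \<gamma> g3 l)) = act \<alpha> \<gamma> b l"
    if b: "b \<in> H \<alpha>" for b
  proof -
    have "sw scale \<alpha> b (\<lambda>g2 g3. mul (- \<alpha>) (\<alpha> + \<gamma>) (S \<alpha> g2) (sm \<alpha> \<gamma> g3 l)) =
        sw scale \<alpha> b (\<lambda>g2 r. sw scale \<alpha> r (\<lambda>c d. mul (- \<alpha>) (\<alpha> + \<gamma>) (S \<alpha> g2) (mul \<alpha> \<gamma> c (act \<alpha> \<gamma> d l))))"
      using b l by (simp add: sm_eq)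
    also have "\<dots> = sw scale \<alpha> b (\<lambda>r d. sw scale \<alpha> r (\<lambda>g2 c. mul (- \<alpha>) (\<alpha> + \<gamma>) (S \<alpha> g2) (mul \<alpha> \<gamma> c (act \<alpha> \<gamma> d l))))"
      by (rule coassoc[symmetric]) (use b l in simp_all)
    also have "\<dots> = act \<alpha> \<gamma> b l" using b l by (simp add: antipode_left_cancel)
    finally show ?thesis .
  qed
  have "sw scale \<alpha> g (\<lambda>g1 g'. sw scale \<alpha> g' (\<lambda>g2 g3.
      mul (\<alpha> + \<beta> - \<alpha>) (\<alpha> + \<gamma>) (mul (\<alpha> + \<beta>) (- \<alpha>) (sm \<alpha> \<beta> g1 h) (S \<alpha> g2)) (sm \<alpha> \<gamma> g3 l))) =
    sw scale \<alpha> g (\<lambda>g1 g'. mul (\<alpha> + \<beta>) \<gamma> (sm \<alpha> \<beta> g1 h)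
      (sw scale \<alpha> g' (\<lambda>g2 g3. mul (- \<alpha>) (\<alpha> + \<gamma>) (S \<alpha> g2) (sm \<alpha> \<gamma> g3 l))))"
    using g h l by simp
  also have "\<dots> = sw scale \<alpha> g (\<lambda>g1 g'. mul (\<alpha> + \<beta>) \<gamma> (sm \<alpha> \<beta> g1 h) (act \<alpha> \<gamma> g' l))"
    by (rule sw_cong[OF refl]) (use g c in auto)
  also have "\<dots> = sw scale \<alpha> g (\<lambda>r c. sw scale \<alpha> r (\<lambda>a b. ?L a b c))"
    using g h l by (simp add: sm_eq)
  also have "\<dots> = sw scale \<alpha> g (\<lambda>a r. sw scale \<alpha> r (\<lambda>b c. ?L a b c))"
    by (rule coassoc) (use g h l in simp_all)
  also have "\<dots> = sm \<alpha> (\<beta> + \<gamma>) g (mul \<beta> \<gamma> h l)"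
    using g h l by (simp add: sm_eq act_mul')
  finally show ?thesis by simp
qed

theorem subadjacent_hopf_pi_brace: "hopf_pi_brace scale H \<Delta> \<epsilon> mul one S sm one T"
proof (rule hopf_pi_brace.intro)
  show "hopf_pi_algebra scale H \<Delta> \<epsilon> mul one S" by (rule hopf_pi_algebra_axioms)
  show "hopf_pi_algebra scale H \<Delta> \<epsilon> sm one T"
    by (rule hopf_pi_algebra.intro[OF vector_space_axioms], rule hopf_pi_algebra_axioms.intro)
      (use coalg sm_coalgebra_map comult_one T_linear sm_T T_sm in \<open>simp_all add: sw_def\<close>)
  show "hopf_pi_brace_axioms scale H \<Delta> mul S sm"
    by (rule hopf_pi_brace_axioms.intro) (simp add: sm_brace flip: sw_def)
qed

end

section \<open>The action of a brace\<close>

locale cocommutative_hopf_pi_brace = hopf_pi_brace scale H \<Delta> \<epsilon> mul one S cmul cone T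
  for scale :: "'k::field \<Rightarrow> 'h::ab_group_add \<Rightarrow> 'h"
    and H :: "'p::ab_group_add \<Rightarrow> 'h set"
    and \<Delta> :: "'p \<Rightarrow> 'h \<Rightarrow> ('h list \<Rightarrow>\<^sub>0 'k) set"
    and \<epsilon> :: "'p \<Rightarrow> 'h \<Rightarrow> 'k"
    and mul :: "'p \<Rightarrow> 'p \<Rightarrow> 'h \<Rightarrow> 'h \<Rightarrow> 'h"
    and one :: "'h"
    and S :: "'p \<Rightarrow> 'h \<Rightarrow> 'h"
    and cmul :: "'p \<Rightarrow> 'p \<Rightarrow> 'h \<Rightarrow> 'h \<Rightarrow> 'h"
    and cone :: "'h"
    and T :: "'p \<Rightarrow> 'h \<Rightarrow> 'h" +
  assumes cocommutative: "cocommutative_family scale H \<Delta>"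
begin

lemma cocommutative_H: "cocommutative scale (H \<alpha>) (\<Delta> \<alpha>)"
  using cocommutative by (simp add: cocommutative_family_def)

text \<open>Both Hopf structures have the same underlying coalgebras, so rules stated for
  \<open>circ\<close> and for \<open>dot\<close> speak about the same sums.\<close>

abbreviation (input) sw :: "('k \<Rightarrow> 'u::ab_group_add \<Rightarrow> 'u) \<Rightarrow> 'p \<Rightarrow> 'h \<Rightarrow> ('h \<Rightarrow> 'h \<Rightarrow> 'u) \<Rightarrow> 'u" where
  "sw \<equiv> dot.sw"

text \<open>Bracketed to the right, as \<open>mul_assoc'\<close> normalises products; the degree
  \<open>\<alpha> + \<beta> - \<alpha>\<close> of the axiom disappears on the way.\<close>

lemma brace':
  assumes "g \<in> H \<alpha>" "h \<in> H \<beta>" "l \<in> H \<gamma>" "\<delta> = \<beta> + \<gamma>"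
  shows "cmul \<alpha> \<delta> g (mul \<beta> \<gamma> h l) = sw scale \<alpha> g (\<lambda>g1 g'. sw scale \<alpha> g' (\<lambda>g2 g3.
    mul (\<alpha> + \<beta>) \<gamma> (cmul \<alpha> \<beta> g1 h) (mul (- \<alpha>) (\<alpha> + \<gamma>) (S \<alpha> g2) (cmul \<alpha> \<gamma> g3 l))))"
proof -
  have "cmul \<alpha> \<delta> g (mul \<beta> \<gamma> h l) = sw scale \<alpha> g (\<lambda>g1 g'. sw scale \<alpha> g' (\<lambda>g2 g3.
      mul (\<alpha> + \<beta> - \<alpha>) (\<alpha> + \<gamma>) (mul (\<alpha> + \<beta>) (- \<alpha>) (cmul \<alpha> \<beta> g1 h) (S \<alpha> g2)) (cmul \<alpha> \<gamma> g3 l)))"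
    using brace[OF assms(1-3)] by (simp add: assms(4) dot.sw_def)
  also have "\<dots> = sw scale \<alpha> g (\<lambda>g1 g'. sw scale \<alpha> g' (\<lambda>g2 g3.
      mul (\<alpha> + \<beta>) \<gamma> (cmul \<alpha> \<beta> g1 h) (mul (- \<alpha>) (\<alpha> + \<gamma>) (S \<alpha> g2) (cmul \<alpha> \<gamma> g3 l))))"
    using assms by simp
  finally show ?thesis .
qed

text \<open>The brace law at g = \<open>cone\<close> and h = l = 1 reduces to 1 =
  S(\<open>cone\<close>), because \<open>cone\<close> is grouplike and neutral for \<circ>. The
  antipode law S(\<open>cone\<close>) \<open>cone\<close> = 1 then gives the claim.\<close>

lemma cone_eq_one: "cone = one"
proof -
  have "cmul 0 0 cone (mul 0 0 one one) = mul 0 0 (cmul 0 0 cone one) (mul 0 0 (S 0 cone) (cmul 0 0 cone one))"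
    by (subst brace') (simp_all add: circ.sw_one)
  then have "one = S 0 cone" by simp
  moreover have "mul 0 0 (S 0 cone) cone = one"
    using dot.antipode_left'[OF circ.one_closed] by (simp add: circ.sw_one del: dot.antipode_left')
  ultimately have "mul 0 0 one cone = one" by simp
  then show ?thesis by simp
qed

lemma cmul_one_left [simp]: "x \<in> H \<alpha> \<Longrightarrow> cmul 0 \<alpha> one x = x"
  and cmul_one_right [simp]: "x \<in> H \<alpha> \<Longrightarrow> cmul \<alpha> 0 x one = x"
  using circ.mul_one_left[of x \<alpha>] circ.mul_one_right[of x \<alpha>] by (simp_all add: cone_eq_one)

text \<open>By \<open>antipode_unique\<close> it suffices that the right side is a right convolution
  inverse of \<circ>. In (x1 \<circ> y1) S(x2) (x3 \<circ> S(y2)) S(x4) the first three factors are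
  x1 \<circ> (y1 S(y2)) by the brace law, and (x1 \<circ> 1) S(x2) = x1 S(x2) collapses.\<close>

lemma antipode_cmul:
  assumes x: "x \<in> H \<alpha>" and y: "y \<in> H \<beta>"
  shows "S (\<alpha> + \<beta>) (cmul \<alpha> \<beta> x y) =
    sw scale \<alpha> x (\<lambda>a r. sw scale \<alpha> r (\<lambda>b c.
      mul (- \<alpha>) (- \<beta>) (S \<alpha> a) (mul (\<alpha> - \<beta>) (- \<alpha>) (cmul \<alpha> (- \<beta>) b (S \<beta> y)) (S \<alpha> c))))"
proof (rule dot.antipode_unique[OF circ.mul_coalgebra_map _ _ x y])
  let ?R = "\<lambda>x y. sw scale \<alpha> x (\<lambda>a r. sw scale \<alpha> r (\<lambda>b c.
      mul (- \<alpha>) (- \<beta>) (S \<alpha> a) (mul (\<alpha> - \<beta>) (- \<alpha>) (cmul \<alpha> (- \<beta>) b (S \<beta> y)) (S \<alpha> c))))"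
  show "bilinear_on scale scale (H \<alpha>) (H \<beta>) (H (- (\<alpha> + \<beta>))) ?R"
    by (rule dot.bilinear_onI) simp_all
  fix x y assume x: "x \<in> H \<alpha>" and y: "y \<in> H \<beta>"
  let ?G = "\<lambda>p a b c y1 y2. mul (\<alpha> + \<beta>) (- \<alpha> - \<beta>) (cmul \<alpha> \<beta> p y1)
    (mul (- \<alpha>) (- \<beta>) (S \<alpha> a) (mul (\<alpha> - \<beta>) (- \<alpha>) (cmul \<alpha> (- \<beta>) b (S \<beta> y2)) (S \<alpha> c)))"
  have inner: "sw scale \<alpha> v (\<lambda>p u. sw scale \<alpha> u (\<lambda>a b. ?G p a b c y1 y2)) =
      mul \<alpha> (- \<alpha>) (cmul \<alpha> 0 v (mul \<beta> (- \<beta>) y1 (S \<beta> y2))) (S \<alpha> c)"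
    if "v \<in> H \<alpha>" "c \<in> H \<alpha>" "y1 \<in> H \<beta>" "y2 \<in> H \<beta>" for v c y1 y2
  proof -
    \<comment> \<open>Reassociating the right side yields this degree with its summands in the other
      order.\<close>
    have index: "- \<beta> - \<alpha> = - \<alpha> - \<beta>" by simp
    show ?thesis using that by (simp add: brace' index)
  qed
  have "sw scale \<alpha> x (\<lambda>x1 x2. sw scale \<beta> y (\<lambda>y1 y2. mul (\<alpha> + \<beta>) (- (\<alpha> + \<beta>)) (cmul \<alpha> \<beta> x1 y1) (?R x2 y2))) =
      sw scale \<alpha> x (\<lambda>p q. sw scale \<beta> y (\<lambda>y1 y2. sw scale \<alpha> q (\<lambda>a r. sw scale \<alpha> r (\<lambda>b c. ?G p a b c y1 y2))))"
    using x y by simp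
  also have "\<dots> = sw scale \<beta> y (\<lambda>y1 y2. sw scale \<alpha> x (\<lambda>p q. sw scale \<alpha> q (\<lambda>a r. sw scale \<alpha> r (\<lambda>b c. ?G p a b c y1 y2))))"
    by (rule dot.sw_swap) simp
  also have "\<dots> = sw scale \<beta> y (\<lambda>y1 y2. sw scale \<alpha> x (\<lambda>p q. sw scale \<alpha> q (\<lambda>u c. sw scale \<alpha> u (\<lambda>a b. ?G p a b c y1 y2))))"
    by (intro dot.sw_cong[OF refl] dot.coassoc[symmetric]) (use x y in simp_all)
  also have "\<dots> = sw scale \<beta> y (\<lambda>y1 y2. sw scale \<alpha> x (\<lambda>v c. sw scale \<alpha> v (\<lambda>p u. sw scale \<alpha> u (\<lambda>a b. ?G p a b c y1 y2))))"
    by (intro dot.sw_cong[OF refl] dot.coassoc[symmetric]) (use x y in simp_all)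
  also have "\<dots> = sw scale \<beta> y (\<lambda>y1 y2. sw scale \<alpha> x (\<lambda>v c.
      mul \<alpha> (- \<alpha>) (cmul \<alpha> 0 v (mul \<beta> (- \<beta>) y1 (S \<beta> y2))) (S \<alpha> c)))"
    by (intro dot.sw_cong[OF refl] inner) (use x y in simp_all)
  also have "\<dots> = sw scale \<alpha> x (\<lambda>v c. sw scale \<beta> y (\<lambda>y1 y2.
      mul \<alpha> (- \<alpha>) (cmul \<alpha> 0 v (mul \<beta> (- \<beta>) y1 (S \<beta> y2))) (S \<alpha> c)))"
    by (rule dot.sw_swap) simp
  also have "\<dots> = sw scale \<alpha> x (\<lambda>v c.
      mul \<alpha> (- \<alpha>) (cmul \<alpha> 0 v (sw scale \<beta> y (\<lambda>y1 y2. mul \<beta> (- \<beta>) y1 (S \<beta> y2)))) (S \<alpha> c))"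
    using x y by (simp del: dot.antipode_right')
  also have "\<dots> = scale (\<epsilon> \<alpha> x) (scale (\<epsilon> \<beta> y) one)"
    using x y by (simp add: mult.commute)
  finally show "sw scale \<alpha> x (\<lambda>x1 x2. sw scale \<beta> y (\<lambda>y1 y2. mul (\<alpha> + \<beta>) (- (\<alpha> + \<beta>)) (cmul \<alpha> \<beta> x1 y1) (?R x2 y2))) =
    scale (\<epsilon> \<alpha> x) (scale (\<epsilon> \<beta> y) one)" .
qed

section \<open>The post-Hopf axioms for the action of a brace\<close>

abbreviation bact :: "'p \<Rightarrow> 'p \<Rightarrow> 'h \<Rightarrow> 'h \<Rightarrow> 'h" where
  "bact \<equiv> brace_action scale \<Delta> mul S cmul"

lemma bact_eq: "bact \<alpha> \<beta> x y = sw scale \<alpha> x (\<lambda>x1 x2. mul (- \<alpha>) (\<alpha> + \<beta>) (S \<alpha> x1) (cmul \<alpha> \<beta> x2 y))"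
  by (simp add: brace_action_def dot.sw_def)

text \<open>The action is the convolution product of S and \<circ>. In general S reverses the
  comultiplication; cocommutativity reverses it back, so S qualifies as a coalgebra map.\<close>

lemma bact_coalgebra_map:
  "coalgebra_map2 scale (H \<alpha>) (\<Delta> \<alpha>) (\<epsilon> \<alpha>) (H \<beta>) (\<Delta> \<beta>) (\<epsilon> \<beta>) (H \<beta>) (\<Delta> \<beta>) (\<epsilon> \<beta>) (bact \<alpha> \<beta>)"
proof -
  have bact: "bact \<alpha> \<beta> = (\<lambda>x y. sw scale \<alpha> x (\<lambda>x1 x2. mul (- \<alpha>) (\<alpha> + \<beta>) (S \<alpha> x1) (cmul \<alpha> \<beta> x2 y)))"
    by (intro ext bact_eq)
  have S: "sw free_scale (- \<alpha>) (S \<alpha> x) F = sw free_scale \<alpha> x (\<lambda>a b. F (S \<alpha> a) (S \<alpha> b))"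
    if x: "x \<in> H \<alpha>" and F2: "\<And>a. a \<in> H (- \<alpha>) \<Longrightarrow> dot.lin free_scale (- \<alpha>) (F a)"
      and F1: "\<And>b. b \<in> H (- \<alpha>) \<Longrightarrow> dot.lin free_scale (- \<alpha>) (\<lambda>a. F a b)"
    for x and F :: "'h \<Rightarrow> 'h \<Rightarrow> ('h list \<Rightarrow>\<^sub>0 'k)"
  proof -
    have "sw free_scale (- \<alpha>) (S \<alpha> x) F = sw free_scale \<alpha> x (\<lambda>a b. F (S \<alpha> b) (S \<alpha> a))"
      by (rule dot.sw_antipode[OF x F2 F1])
    also have "\<dots> = sw free_scale \<alpha> x (\<lambda>a b. F (S \<alpha> a) (S \<alpha> b))"
      by (rule dot.sw_cocommutative[OF cocommutative_H _ x])
        (auto intro!: dot.lin_comp[OF _ _ F1] dot.lin_comp[OF _ _ F2])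
    finally show ?thesis .
  qed
  have "coalgebra_map2 scale (H \<alpha>) (\<Delta> \<alpha>) (\<epsilon> \<alpha>) (H \<beta>) (\<Delta> \<beta>) (\<epsilon> \<beta>)
     (H (- \<alpha> + (\<alpha> + \<beta>))) (\<Delta> (- \<alpha> + (\<alpha> + \<beta>))) (\<epsilon> (- \<alpha> + (\<alpha> + \<beta>))) (bact \<alpha> \<beta>)"
    unfolding bact
    by (rule dot.mul_convolution_coalgebra_map[OF cocommutative_H dot.antipode_linear _ S circ.mul_coalgebra_map])
      simp_all
  then show ?thesis by simp
qed

lemma bact_bilinear: "bilinear_on scale scale (H \<alpha>) (H \<beta>) (H \<beta>) (bact \<alpha> \<beta>)"
  using bact_coalgebra_map by (simp add: coalgebra_map2_def)

lemmas bact_rules [simp] = dot.bilinear_rules[OF bact_bilinear]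

text \<open>The brace law expands the left side to S(x1) (x2 \<circ> y) S(x3) (x4 \<circ> z);
  grouping the four factors of x in pairs gives the right side.\<close>

lemma bact_mul:
  assumes x: "x \<in> H \<alpha>" and y: "y \<in> H \<beta>" and z: "z \<in> H \<gamma>"
  shows "bact \<alpha> (\<beta> + \<gamma>) x (mul \<beta> \<gamma> y z) =
    sw scale \<alpha> x (\<lambda>x1 x2. mul \<beta> \<gamma> (bact \<alpha> \<beta> x1 y) (bact \<alpha> \<gamma> x2 z))"
proof -
  let ?G = "\<lambda>a b c d. mul (- \<alpha>) (\<alpha> + (\<beta> + \<gamma>)) (S \<alpha> a) (mul (\<alpha> + \<beta>) \<gamma> (cmul \<alpha> \<beta> b y)
      (mul (- \<alpha>) (\<alpha> + \<gamma>) (S \<alpha> c) (cmul \<alpha> \<gamma> d z)))"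
  have "bact \<alpha> (\<beta> + \<gamma>) x (mul \<beta> \<gamma> y z) =
      sw scale \<alpha> x (\<lambda>a r. sw scale \<alpha> r (\<lambda>b q. sw scale \<alpha> q (\<lambda>c d. ?G a b c d)))"
    using x y z by (simp add: bact_eq brace' add.assoc)
  also have "\<dots> = sw scale \<alpha> x (\<lambda>p q. sw scale \<alpha> p (\<lambda>a b. sw scale \<alpha> q (\<lambda>c d. ?G a b c d)))"
    by (rule dot.coassoc[symmetric]) (use x y z in \<open>simp_all add: add.assoc\<close>)
  also have "\<dots> = sw scale \<alpha> x (\<lambda>p q. sw scale \<alpha> p (\<lambda>a b.
      mul \<beta> \<gamma> (mul (- \<alpha>) (\<alpha> + \<beta>) (S \<alpha> a) (cmul \<alpha> \<beta> b y)) (bact \<alpha> \<gamma> q z)))"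
    using x y z by (simp add: bact_eq add.assoc)
  also have "\<dots> = sw scale \<alpha> x (\<lambda>x1 x2. mul \<beta> \<gamma> (bact \<alpha> \<beta> x1 y) (bact \<alpha> \<gamma> x2 z))"
    using x y z by (simp add: bact_eq[of \<alpha> \<beta>])
  finally show ?thesis .
qed

text \<open>The subadjacent product of this action is \<circ> again, so the composition axiom of a
  post-Hopf algebra becomes the statement that \<triangleright> is an action of \<circ>.\<close>

lemma mul_bact:
  assumes x: "x \<in> H \<alpha>" and y: "y \<in> H \<beta>"
  shows "sw scale \<alpha> x (\<lambda>a b. mul \<alpha> \<beta> a (bact \<alpha> \<beta> b y)) = cmul \<alpha> \<beta> x y"
proof -
  let ?G = "\<lambda>a b c. mul \<alpha> \<beta> a (mul (- \<alpha>) (\<alpha> + \<beta>) (S \<alpha> b) (cmul \<alpha> \<beta> c y))"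
  have "sw scale \<alpha> x (\<lambda>a b. mul \<alpha> \<beta> a (bact \<alpha> \<beta> b y)) = sw scale \<alpha> x (\<lambda>a r. sw scale \<alpha> r (\<lambda>b c. ?G a b c))"
    using x y by (simp add: bact_eq)
  also have "\<dots> = sw scale \<alpha> x (\<lambda>r c. sw scale \<alpha> r (\<lambda>a b. ?G a b c))"
    by (rule dot.coassoc[symmetric]) (use x y in simp_all)
  also have "\<dots> = sw scale \<alpha> x (\<lambda>r c. scale (\<epsilon> \<alpha> r) (cmul \<alpha> \<beta> c y))"
  proof (rule dot.sw_cong[OF refl])
    fix r c assume "x \<in> H \<alpha> \<longrightarrow> r \<in> H \<alpha> \<and> c \<in> H \<alpha>"
    with x y show "sw scale \<alpha> r (\<lambda>a b. ?G a b c) = scale (\<epsilon> \<alpha> r) (cmul \<alpha> \<beta> c y)"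
      using dot.antipode_right_cancel[of r \<alpha> "cmul \<alpha> \<beta> c y" "\<alpha> + \<beta>"] by simp
  qed
  also have "\<dots> = cmul \<alpha> \<beta> x y" using x y by simp
  finally show ?thesis .
qed

text \<open>With the formula for S(x1 \<circ> y1), the factor S(x) of (x \<circ> y) \<triangleright>
  z becomes part of S(x1) (x2 \<circ> S(y1)) S(x3) (x4 \<circ> (y2 \<circ> z)). Read backwards, the
  brace law makes this S(x1) (x2 \<circ> (S(y1) (y2 \<circ> z))), which is x \<triangleright> (y
  \<triangleright> z).\<close>

lemma bact_bact:
  assumes x: "x \<in> H \<alpha>" and y: "y \<in> H \<beta>" and z: "z \<in> H \<gamma>"
  shows "bact \<alpha> \<gamma> x (bact \<beta> \<gamma> y z) = bact (\<alpha> + \<beta>) \<gamma> (cmul \<alpha> \<beta> x y) z"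
proof -
  let ?G = "\<lambda>a b c d y1 y2. mul (- \<alpha>) (\<alpha> + \<gamma>) (S \<alpha> a) (mul (\<alpha> - \<beta>) (\<beta> + \<gamma>) (cmul \<alpha> (- \<beta>) b (S \<beta> y1))
      (mul (- \<alpha>) (\<alpha> + (\<beta> + \<gamma>)) (S \<alpha> c) (cmul \<alpha> (\<beta> + \<gamma>) d (cmul \<beta> \<gamma> y2 z))))"
  have "bact (\<alpha> + \<beta>) \<gamma> (cmul \<alpha> \<beta> x y) z =
      sw scale (\<alpha> + \<beta>) (cmul \<alpha> \<beta> x y) (\<lambda>u v. mul (- (\<alpha> + \<beta>)) (\<alpha> + \<beta> + \<gamma>) (S (\<alpha> + \<beta>) u) (cmul (\<alpha> + \<beta>) \<gamma> v z))"
    by (rule bact_eq)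
  also have "\<dots> = sw scale \<alpha> x (\<lambda>p d. sw scale \<beta> y (\<lambda>y1 y2.
      mul (- (\<alpha> + \<beta>)) (\<alpha> + \<beta> + \<gamma>) (S (\<alpha> + \<beta>) (cmul \<alpha> \<beta> p y1)) (cmul (\<alpha> + \<beta>) \<gamma> (cmul \<alpha> \<beta> d y2) z)))"
    by (rule circ.sw_mul) (use x y z in simp_all)
  also have "\<dots> = sw scale \<alpha> x (\<lambda>p d. sw scale \<beta> y (\<lambda>y1 y2.
      sw scale \<alpha> p (\<lambda>a r. sw scale \<alpha> r (\<lambda>b c. ?G a b c d y1 y2))))"
    using x y z by (simp add: antipode_cmul add.assoc)
  also have "\<dots> = sw scale \<beta> y (\<lambda>y1 y2. sw scale \<alpha> x (\<lambda>p d.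
      sw scale \<alpha> p (\<lambda>a r. sw scale \<alpha> r (\<lambda>b c. ?G a b c d y1 y2))))"
    by (rule dot.sw_swap) simp
  also have "\<dots> = sw scale \<beta> y (\<lambda>y1 y2. sw scale \<alpha> x (\<lambda>a t.
      sw scale \<alpha> t (\<lambda>r d. sw scale \<alpha> r (\<lambda>b c. ?G a b c d y1 y2))))"
    by (intro dot.sw_cong[OF refl] dot.coassoc) (use x y z in \<open>simp_all add: add.assoc\<close>)
  also have "\<dots> = sw scale \<beta> y (\<lambda>y1 y2. sw scale \<alpha> x (\<lambda>a t.
      sw scale \<alpha> t (\<lambda>b r. sw scale \<alpha> r (\<lambda>c d. ?G a b c d y1 y2))))"
    by (intro dot.sw_cong[OF refl] dot.coassoc) (use x y z in \<open>simp_all add: add.assoc\<close>)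
  also have "\<dots> = sw scale \<alpha> x (\<lambda>a t. sw scale \<beta> y (\<lambda>y1 y2.
      sw scale \<alpha> t (\<lambda>b r. sw scale \<alpha> r (\<lambda>c d. ?G a b c d y1 y2))))"
    by (rule dot.sw_swap) simp
  also have "\<dots> = bact \<alpha> \<gamma> x (bact \<beta> \<gamma> y z)"
    using x y z by (simp add: bact_eq brace' add.assoc)
  finally show ?thesis by simp
qed

lemma bact_one: "y \<in> H \<beta> \<Longrightarrow> bact 0 \<beta> one y = y"
  by (simp add: bact_eq)

lemma bact_antipode_inverse:
  "convolution_inverse scale (H \<alpha>) (\<Delta> \<alpha>) (\<epsilon> \<alpha>) (H \<beta>) (bact \<alpha> \<beta>) (\<lambda>x y. bact (- \<alpha>) \<beta> (T \<alpha> x) y)"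
  unfolding convolution_inverse_def
proof (intro conjI ballI)
  show "bilinear_on scale scale (H \<alpha>) (H \<beta>) (H \<beta>) (\<lambda>x y. bact (- \<alpha>) \<beta> (T \<alpha> x) y)"
    by (rule dot.bilinear_onI) simp_all
  fix x y assume xy: "x \<in> H \<alpha>" "y \<in> H \<beta>"
  \<comment> \<open>Since \<triangleright> is an action of \<circ>, the two actions merge into the
    one of T(x1) \<circ> x2, and the antipode law of \<circ> leaves \<epsilon>(x) times the action
    of 1.\<close>
  have "sw scale \<alpha> x (\<lambda>a b. bact (- \<alpha>) \<beta> (T \<alpha> a) (bact \<alpha> \<beta> b y)) =
      bact 0 \<beta> (sw scale \<alpha> x (\<lambda>a b. cmul (- \<alpha>) \<alpha> (T \<alpha> a) b)) y"
    using xy by (simp add: bact_bact del: circ.antipode_left')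
  also have "\<dots> = scale (\<epsilon> \<alpha> x) y"
    using xy by (simp add: cone_eq_one bact_one)
  finally show "sweedler scale (\<Delta> \<alpha> x) (\<lambda>a b. bact (- \<alpha>) \<beta> (T \<alpha> a) (bact \<alpha> \<beta> b y)) = scale (\<epsilon> \<alpha> x) y"
    by (simp add: dot.sw_def)
  have "sw scale \<alpha> x (\<lambda>a b. bact \<alpha> \<beta> a (bact (- \<alpha>) \<beta> (T \<alpha> b) y)) =
      bact 0 \<beta> (sw scale \<alpha> x (\<lambda>a b. cmul \<alpha> (- \<alpha>) a (T \<alpha> b))) y"
    using xy by (simp add: bact_bact del: circ.antipode_right')
  also have "\<dots> = scale (\<epsilon> \<alpha> x) y"
    using xy by (simp add: cone_eq_one bact_one)
  finally show "sweedler scale (\<Delta> \<alpha> x) (\<lambda>a b. bact \<alpha> \<beta> a (bact (- \<alpha>) \<beta> (T \<alpha> b) y)) = scale (\<epsilon> \<alpha> x) y"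
    by (simp add: dot.sw_def)
qed

theorem brace_action_post_hopf_pi_algebra: "post_hopf_pi_algebra scale H \<Delta> \<epsilon> mul one S bact"
proof (rule post_hopf_pi_algebra.intro[OF dot.hopf_pi_algebra_axioms], rule post_hopf_pi_algebra_axioms.intro)
  show "coalgebra_map2 scale (H \<alpha>) (\<Delta> \<alpha>) (\<epsilon> \<alpha>) (H \<beta>) (\<Delta> \<beta>) (\<epsilon> \<beta>) (H \<beta>) (\<Delta> \<beta>) (\<epsilon> \<beta>) (bact \<alpha> \<beta>)" for \<alpha> \<beta>
    by (rule bact_coalgebra_map)
  show "convolution_invertible scale (H \<alpha>) (\<Delta> \<alpha>) (\<epsilon> \<alpha>) (H \<beta>) (bact \<alpha> \<beta>)" for \<alpha> \<beta>
    by (rule dot.convolution_invertibleI[OF bact_antipode_inverse bact_bilinear])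
  fix \<alpha> \<beta> \<gamma> x y z assume xyz: "x \<in> H \<alpha>" "y \<in> H \<beta>" "z \<in> H \<gamma>"
  show "bact \<alpha> (\<beta> + \<gamma>) x (mul \<beta> \<gamma> y z) =
      sweedler scale (\<Delta> \<alpha> x) (\<lambda>x1 x2. mul \<beta> \<gamma> (bact \<alpha> \<beta> x1 y) (bact \<alpha> \<gamma> x2 z))"
    using bact_mul[OF xyz] by (simp add: dot.sw_def)
  show "bact \<alpha> \<gamma> x (bact \<beta> \<gamma> y z) =
      bact (\<alpha> + \<beta>) \<gamma> (sweedler scale (\<Delta> \<alpha> x) (\<lambda>x1 x2. mul \<alpha> \<beta> x1 (bact \<alpha> \<beta> x2 y))) z"
    using bact_bact[OF xyz] mul_bact[OF xyz(1,2)] by (simp add: dot.sw_def)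
qed

end

theorem theorem3p6:
  fixes scale :: "'k::field \<Rightarrow> 'h::ab_group_add \<Rightarrow> 'h"
    and H :: "'p::ab_group_add \<Rightarrow> 'h set"
    and \<Delta> :: "'p \<Rightarrow> 'h \<Rightarrow> ('h list \<Rightarrow>\<^sub>0 'k) set"
    and \<epsilon> :: "'p \<Rightarrow> 'h \<Rightarrow> 'k"
    and mul :: "'p \<Rightarrow> 'p \<Rightarrow> 'h \<Rightarrow> 'h \<Rightarrow> 'h"
    and one :: "'h"
    and S :: "'p \<Rightarrow> 'h \<Rightarrow> 'h"
  shows "(\<forall>act \<psi>.
            post_hopf_pi_algebra scale H \<Delta> \<epsilon> mul one S act \<and>
            cocommutative_family scale H \<Delta> \<and>
            (\<forall>\<alpha> \<beta>. convolution_inverse scale (H \<alpha>) (\<Delta> \<alpha>) (\<epsilon> \<alpha>) (H \<beta>) (act \<alpha> \<beta>) (\<psi> \<alpha> \<beta>)) \<longrightarrow>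
            hopf_pi_brace scale H \<Delta> \<epsilon> mul one S
              (subadjacent_mul scale \<Delta> mul act) one (subadjacent_antipode scale \<Delta> S \<psi>))
       \<and> (\<forall>cmul cone T.
            hopf_pi_brace scale H \<Delta> \<epsilon> mul one S cmul cone T \<and>
            cocommutative_family scale H \<Delta> \<longrightarrow>
            post_hopf_pi_algebra scale H \<Delta> \<epsilon> mul one S (brace_action scale \<Delta> mul S cmul))"
proof (intro conjI allI impI; elim conjE)
  fix act \<psi>
  assume post: "post_hopf_pi_algebra scale H \<Delta> \<epsilon> mul one S act"
    and "cocommutative_family scale H \<Delta>"
    and "\<forall>\<alpha> \<beta>. convolution_inverse scale (H \<alpha>) (\<Delta> \<alpha>) (\<epsilon> \<alpha>) (H \<beta>) (act \<alpha> \<beta>) (\<psi> \<alpha> \<beta>)"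
  then interpret cocommutative_post_hopf_pi_algebra scale H \<Delta> \<epsilon> mul one S act \<psi>
    by (intro cocommutative_post_hopf_pi_algebra.intro[OF post] cocommutative_post_hopf_pi_algebra_axioms.intro) simp_all
  show "hopf_pi_brace scale H \<Delta> \<epsilon> mul one S
      (subadjacent_mul scale \<Delta> mul act) one (subadjacent_antipode scale \<Delta> S \<psi>)"
    by (rule subadjacent_hopf_pi_brace)
next
  fix cmul cone T
  assume "hopf_pi_brace scale H \<Delta> \<epsilon> mul one S cmul cone T" and "cocommutative_family scale H \<Delta>"
  then interpret cocommutative_hopf_pi_brace scale H \<Delta> \<epsilon> mul one S cmul cone T
    by (intro cocommutative_hopf_pi_brace.intro cocommutative_hopf_pi_brace_axioms.intro)
  show "post_hopf_pi_algebra scale H \<Delta> \<epsilon> mul one S (brace_action scale \<Delta> mul S cmul)"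
    by (rule brace_action_post_hopf_pi_algebra)
qed

end
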